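(* Let $\mathcal{E}$ be a unital qubit channel with Stokes matrix $R$, let $S=\begin{pmatrix}R_{zz}&R_{zx}\\R_{xz}&R_{xx}\end{pmatrix}$ and write $S=V\,\mathrm{diag}[d_z,d_x]\,U$ with $U,V\in SO(2)$ and real $d_z,d_x$. For $j\in\{z,x\}$ let $\langle V_j|$ be the $j$-th row of $V$ and $|\tilde U_j\rangle$ the $j$-th column of $\mathrm{diag}[d_z,d_x]U$ (so $S_{ij}=\langle V_i|\tilde U_j\rangle$). Let $Q_A^*=U^{-1}$, $Q_B^*=V^{-1}$, let $\mathcal{U}_A^*,\mathcal{U}_B^*$ be the corresponding $z$–$x$ plane rotation channels and $\mathcal{E}^*=\mathcal{U}_B^*\circ\mathcal{E}\circ\mathcal{U}_A^*$, with $\omega^*$ its parameter vector $(R^*_{zz},R^*_{zx},R^*_{xz},R^*_{xx},t^*_z,t^*_x)$. Then $$G_2(\mathcal{E})=\min_{\tilde{\mathcal{E}}\in\mathcal{P}_{ba}(\omega^* )}K(\tilde{\mathcal{E}})=1-h\Big(\frac{1+d_z}{2}\Big)-h\Big(\frac{1+d_x}{2}\Big).$$ Furthermore, the maximum defining $G_2(\mathcal{E})$ is achieved without any compensation, i.e. $\min_{\tilde{\mathcal{E}}\in\mathcal{P}_{ba}(\omega)}K(\tilde{\mathcal{E}})=\min_{\tilde{\mathcal{E}}\in\mathcal{P}_{ba}(\omega^* )}K(\tilde{\mathcal{E}})$ with $\omega$ the parameter vector of $\mathcal{E}$, if and only if $|\tilde U_z\rangle$ and $|V_z\rangle$ are scalar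 multiples of each other.
   Context: A qubit channel is described by its Stokes parameterization $(R,t)$: in Bloch coordinates $(\theta_z,\theta_x,\theta_y)$, $\theta_a=\mathrm{Tr}(\rho\sigma_a)$, it acts as $\theta\mapsto R\theta+t$ (indices ordered $z,x,y$); unital means $t=0$. A unitary channel inducing a rotation of the Bloch sphere within the $z$–$x$ plane (i.e. fixing the $y$ axis) corresponds to a rotation matrix $\begin{pmatrix}Q&0\\0&1\end{pmatrix}$ with $Q\in SO(2)$; for such $\mathcal{U}_A,\mathcal{U}_B$ (with $Q_A,Q_B$), $\mathcal{E}'=\mathcal{U}_B\circ\mathcal{E}\circ\mathcal{U}_A$ has upper-left $2\times2$ block $S'=Q_BSQ_A$. For a qubit channel $\mathcal{F}$ with complementary (environment) channel $\mathcal{F}_E$, and $|0_z\rangle,|1_z\rangle$ the $\pm1$ eigenvectors of $\sigma_z$: $H_{\mathcal{F}}(X|E)=H(\rho_{XE})-H(\rho_E)$ (von Neumann, base 2) for $\rho_{XE}=\sum_x\frac12|x_z\rangle\langle x_z|\otimes\mathcal{F}_E(|x_z\rangle\langle x_z|)$; $H_{\mathcal{F}}(X|Y)$ is the conditional Shannon entropy for $P_{XY}(x,y)=\frac12\langle y_z|\mathcal{F}(|x_z\rangle\langle x_z|)|y_z\rangle$; $K(\mathcal{F})=H_{\mathcal{F}}(X|E)-H_{\mathcal{F}}(X|Y)$; $h$ is the binary entropy function (base 2). For $\omega\in\mathbb{R}^6$, $\mathcal{P}_{ba}(\omega)$ is the set of all qubit channels whose parameters $(R_{zz},R_{zx},R_{xz},R_{xx},t_z,t_x)$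 equal $\omega$ (the remaining Stokes parameters arbitrary). $G_2(\mathcal{E})=\max_{\mathcal{U}_A,\mathcal{U}_B}\min_{\tilde{\mathcal{E}}\in\mathcal{P}_{ba}(\omega')}K(\tilde{\mathcal{E}})$, maximum over $z$–$x$ plane rotation channels, where $\omega'$ is the parameter vector $(R'_{zz},R'_{zx},R'_{xz},R'_{xx},t'_z,t'_x)$ of $\mathcal{E}'=\mathcal{U}_B\circ\mathcal{E}\circ\mathcal{U}_A$. *)

theory Defs
  imports "Jordan_Normal_Form.Char_Poly"
begin

(* Conventions: Bloch/Stokes indices 0 = z, 1 = x, 2 = y.
   Computational basis: index 0 = |0_z> (+1 eigenvector of sigma_z), index 1 = |1_z>. *)

definition mtrace :: "'a::comm_ring_1 mat \<Rightarrow> 'a" where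
  "mtrace A = (\<Sum>i<dim_row A. A $$ (i,i))"

definition cadj :: "complex mat \<Rightarrow> complex mat" where
  "cadj A = mat (dim_col A) (dim_row A) (\<lambda>(i,j). cnj (A $$ (j,i)))"

definition sigma_z :: "complex mat" where
  "sigma_z = mat_of_rows_list 2 [[1,0],[0,-1]]"
definition sigma_x :: "complex mat" where
  "sigma_x = mat_of_rows_list 2 [[0,1],[1,0]]"
definition sigma_y :: "complex mat" where
  "sigma_y = mat_of_rows_list 2 [[0,-\<i>],[\<i>,0]]"

definition pauli :: "nat \<Rightarrow> complex mat" where
  "pauli a = (if a = 0 then sigma_z else if a = 1 then sigma_x else sigma_y)"

definition density :: "complex mat \<Rightarrow> bool" where
  "density \<rho> \<longleftrightarrow> \<rho> \<in> carrier_mat 2 2 \<and> cadj \<rho> = \<rho> \<and> mtrace \<rho> = 1 \<and>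
     (\<forall>v \<in> carrier_vec 2. 0 \<le> Re (\<Sum>i<2. cnj (v $ i) * (\<rho> *\<^sub>v v) $ i))"

definition bloch :: "complex mat \<Rightarrow> real vec" where
  "bloch \<rho> = vec 3 (\<lambda>a. Re (mtrace (\<rho> * pauli a)))"

definition stokes_map :: "real mat \<Rightarrow> real vec \<Rightarrow> complex mat \<Rightarrow> complex mat" where
  "stokes_map R t \<rho> = (let r = R *\<^sub>v bloch \<rho> + t in
     (1/2) \<cdot>\<^sub>m (1\<^sub>m 2 + complex_of_real (r $ 0) \<cdot>\<^sub>m sigma_z
        + complex_of_real (r $ 1) \<cdot>\<^sub>m sigma_x + complex_of_real (r $ 2) \<cdot>\<^sub>m sigma_y))"

definition kraus_apply :: "complex mat list \<Rightarrow> complex mat \<Rightarrow> complex mat" where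
  "kraus_apply Ks \<rho> = foldr (\<lambda>K acc. K * \<rho> * cadj K + acc) Ks (0\<^sub>m 2 2)"

definition kraus_tp :: "complex mat list \<Rightarrow> complex mat" where
  "kraus_tp Ks = foldr (\<lambda>K acc. cadj K * K + acc) Ks (0\<^sub>m 2 2)"

definition is_kraus_rep :: "real mat \<Rightarrow> real vec \<Rightarrow> complex mat list \<Rightarrow> bool" where
  "is_kraus_rep R t Ks \<longleftrightarrow> Ks \<noteq> [] \<and> set Ks \<subseteq> carrier_mat 2 2 \<and> kraus_tp Ks = 1\<^sub>m 2 \<and>
     (\<forall>\<rho>. density \<rho> \<longrightarrow> kraus_apply Ks \<rho> = stokes_map R t \<rho>)"

definition is_channel :: "real mat \<Rightarrow> real vec \<Rightarrow> bool" where
  "is_channel R t \<longleftrightarrow> R \<in> carrier_mat 3 3 \<and> t \<in> carrier_vec 3 \<and> (\<exists>Ks. is_kraus_rep R t Ks)"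

(* a Kraus representation of the channel; the complementary channel is built from it
   (entropic quantities below do not depend on this choice) *)
definition kraus_of :: "real mat \<Rightarrow> real vec \<Rightarrow> complex mat list" where
  "kraus_of R t = (SOME Ks. is_kraus_rep R t Ks)"

definition compl_channel :: "real mat \<Rightarrow> real vec \<Rightarrow> complex mat \<Rightarrow> complex mat" where
  "compl_channel R t \<rho> = (let Ks = kraus_of R t; n = length Ks in
     mat n n (\<lambda>(k,l). mtrace (Ks ! k * \<rho> * cadj (Ks ! l))))"

definition zproj :: "nat \<Rightarrow> complex mat" where
  "zproj x = mat 2 2 (\<lambda>(i,j). if i = x \<and> j = x then 1 else 0)"

definition eta :: "real \<Rightarrow> real" where
  "eta p = (if p \<le> 0 then 0 else - p * log 2 p)"

definition bin_entropy :: "real \<Rightarrow> real" where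
  "bin_entropy p = eta p + eta (1 - p)"

definition vn_entropy :: "complex mat \<Rightarrow> real" where
  "vn_entropy A = (\<Sum>e \<in> {e. poly (char_poly A) e = 0}.
       real (order e (char_poly A)) * eta (Re e))"

definition H_XE :: "real mat \<Rightarrow> real vec \<Rightarrow> real" where
  "H_XE R t = (let n = length (kraus_of R t);
      A = (1/2) \<cdot>\<^sub>m compl_channel R t (zproj 0);
      B = (1/2) \<cdot>\<^sub>m compl_channel R t (zproj 1)
    in vn_entropy (four_block_mat A (0\<^sub>m n n) (0\<^sub>m n n) B) - vn_entropy (A + B))"

definition P_XY :: "real mat \<Rightarrow> real vec \<Rightarrow> nat \<Rightarrow> nat \<Rightarrow> real" where
  "P_XY R t x y = (1/2) * Re (stokes_map R t (zproj x) $$ (y,y))"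

definition H_XY :: "real mat \<Rightarrow> real vec \<Rightarrow> real" where
  "H_XY R t = (\<Sum>x<2. \<Sum>y<2. eta (P_XY R t x y)) - (\<Sum>y<2. eta (P_XY R t 0 y + P_XY R t 1 y))"

definition key_rate :: "real mat \<Rightarrow> real vec \<Rightarrow> real" where
  "key_rate R t = H_XE R t - H_XY R t"

definition params :: "real mat \<Rightarrow> real vec \<Rightarrow> real \<times> real \<times> real \<times> real \<times> real \<times> real" where
  "params R t = (R $$ (0,0), R $$ (0,1), R $$ (1,0), R $$ (1,1), t $ 0, t $ 1)"

definition P_ba :: "real \<times> real \<times> real \<times> real \<times> real \<times> real \<Rightarrow> (real mat \<times> real vec) set" where
  "P_ba \<omega> = {(R,t). is_channel R t \<and> params R t = \<omega>}"

definition min_K :: "real \<times> real \<times> real \<times> real \<times> real \<times> real \<Rightarrow> real" where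
  "min_K \<omega> = Inf ((\<lambda>(R,t). key_rate R t) ` P_ba \<omega>)"

definition SO2 :: "real mat set" where
  "SO2 = {Q. Q \<in> carrier_mat 2 2 \<and> Q * transpose_mat Q = 1\<^sub>m 2 \<and> det Q = 1}"

definition rot_channel :: "real mat \<Rightarrow> real mat \<times> real vec" where
  "rot_channel Q = (mat 3 3 (\<lambda>(i,j). if i < 2 \<and> j < 2 then Q $$ (i,j) else if i = j then 1 else 0), 0\<^sub>v 3)"

definition stokes_comp :: "real mat \<times> real vec \<Rightarrow> real mat \<times> real vec \<Rightarrow> real mat \<times> real vec" where
  "stokes_comp F2 F1 = (fst F2 * fst F1, fst F2 *\<^sub>v snd F1 + snd F2)"

definition compensate :: "real mat \<Rightarrow> real vec \<Rightarrow> real mat \<Rightarrow> real mat \<Rightarrow> real mat \<times> real vec" where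
  "compensate R t QA QB = stokes_comp (rot_channel QB) (stokes_comp (R,t) (rot_channel QA))"

definition G2 :: "real mat \<Rightarrow> real vec \<Rightarrow> real" where
  "G2 R t = Sup {min_K (case_prod params (compensate R t QA QB)) | QA QB. QA \<in> SO2 \<and> QB \<in> SO2}"

definition is_maximum :: "real set \<Rightarrow> real \<Rightarrow> bool" where
  "is_maximum A v \<longleftrightarrow> v \<in> A \<and> (\<forall>a\<in>A. a \<le> v)"

definition is_minimum :: "real set \<Rightarrow> real \<Rightarrow> bool" where
  "is_minimum A v \<longleftrightarrow> v \<in> A \<and> (\<forall>a\<in>A. v \<le> a)"

end

theory Submission
  imports Defs "Jordan_Normal_Form.Schur_Decomposition"
begin

text \<open>
  Let \<open>\<rho>\<close> be the Choi state of a channel, in \<open>2 \<times> 2\<close> blocks indexed by the input, and \<open>Z \<rho>\<close> its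
  block diagonal part. Since \<open>M M\<^sup>*\<close> and \<open>M\<^sup>* M\<close> have the same nonzero spectrum,
  \<open>H(X|E) = H(Z \<rho>) - H(\<rho>)\<close>, while \<open>H(X|Y)\<close> depends only on the observed parameters.

  Among the channels with a given \<open>z\<close>-\<open>x\<close> block with signed singular values \<open>dz\<close>, \<open>dx\<close>, the one
  with vanishing remaining parameters except \<open>R\<^sub>y\<^sub>y = dz dx\<close> has key rate
  \<open>1 + h((1 + \<surd>(R\<^sub>z\<^sub>z\<^sup>2 + R\<^sub>x\<^sub>z\<^sup>2)) / 2) - h((1 + R\<^sub>z\<^sub>z) / 2) - h((1 + dz) / 2) - h((1 + dx) / 2)\<close>.
  As \<open>h((1 + x) / 2)\<close> is strictly decreasing in \<open>\<bar>x\<bar>\<close>, this is at most the claimed value, with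
  equality iff \<open>R\<^sub>x\<^sub>z = 0\<close>, that is, iff the two vectors of the theorem are parallel.

  If \<open>R\<^sub>x\<^sub>z = 0\<close>, every channel with these parameters satisfies the reverse bound: with \<open>\<sigma>\<close> the Choi
  state of the special channel, \<open>D(\<rho> | \<sigma>) \<ge> D(Z \<rho> | Z \<sigma>)\<close> rearranges to
  \<open>H(Z \<rho>) - H(\<rho>) \<ge> tr (\<rho> (log \<sigma> - log Z \<sigma>))\<close>, and the right side depends only on the observed
  parameters. This instance of monotonicity follows from an integral representation of relative
  entropy by \<open>\<chi>\<^sup>2\<close>-type quantities that are suprema of functions linear in \<open>(\<rho>, \<sigma>)\<close>.
\<close>

section \<open>Spectral decomposition and von Neumann entropy\<close>

lemma cadj_carrier [simp]: "A \<in> carrier_mat n m \<Longrightarrow> cadj A \<in> carrier_mat m n"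
  by (auto simp: cadj_def)

lemma cadj_dim [simp]: "dim_row (cadj A) = dim_col A" "dim_col (cadj A) = dim_row A"
  by (auto simp: cadj_def)

lemma cadj_index [simp]:
  "i < dim_col A \<Longrightarrow> j < dim_row A \<Longrightarrow> cadj A $$ (i,j) = cnj (A $$ (j,i))"
  by (auto simp: cadj_def)

lemma cadj_cadj [simp]: "cadj (cadj A) = A"
  by (rule eq_matI) auto

lemma mult_mat_index_sum:
  assumes "A \<in> carrier_mat n m" "B \<in> carrier_mat m k" "i < n" "j < k"
  shows "(A * B) $$ (i,j) = (\<Sum>l<m. A $$ (i,l) * B $$ (l,j))"
  using assms by (auto simp: scalar_prod_def lessThan_atLeast0 intro!: sum.cong)

lemma cadj_mult:
  assumes "A \<in> carrier_mat n m" "B \<in> carrier_mat m k"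
  shows "cadj (A * B) = cadj B * cadj A"
proof (rule eq_matI)
  fix i j assume "i < dim_row (cadj B * cadj A)" "j < dim_col (cadj B * cadj A)"
  hence ij: "i < k" "j < n" using assms by auto
  have "cadj (A * B) $$ (i,j) = cnj ((A * B) $$ (j,i))" using ij assms by auto
  also have "\<dots> = (\<Sum>l<m. cnj (A $$ (j,l) * B $$ (l,i)))"
    by (subst mult_mat_index_sum[OF assms]) (use ij in auto)
  also have "\<dots> = (\<Sum>l<m. cadj B $$ (i,l) * cadj A $$ (l,j))"
    by (rule sum.cong) (use ij assms in \<open>auto simp: mult.commute\<close>)
  also have "\<dots> = (cadj B * cadj A) $$ (i,j)"
    by (rule mult_mat_index_sum[symmetric, of _ k m _ n]) (use ij assms in auto)
  finally show "cadj (A * B) $$ (i,j) = (cadj B * cadj A) $$ (i,j)" .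
qed (use assms in auto)

lemma cadj_four_block_diag:
  assumes "A \<in> carrier_mat n1 m1" "B \<in> carrier_mat n2 m2"
  shows "cadj (four_block_mat A (0\<^sub>m n1 m2) (0\<^sub>m n2 m1) B)
    = four_block_mat (cadj A) (0\<^sub>m m1 n2) (0\<^sub>m m2 n1) (cadj B)"
  by (rule eq_matI) (use assms in auto)

text \<open>Complete \<open>v\<close> to a basis and orthogonalise: Gram-Schmidt keeps the leading
  vector, so after normalisation the first column is still a multiple of \<open>v\<close>.\<close>

lemma unitary_completion:
  fixes v :: "complex vec"
  assumes v: "v \<in> carrier_vec n" and v0: "v \<noteq> 0\<^sub>v n"
  obtains W c where "W \<in> carrier_mat n n" "cadj W * W = 1\<^sub>m n" "col W 0 = c \<cdot>\<^sub>v v"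
proof -
  have n: "n \<noteq> 0" using v v0 by (intro notI) auto
  interpret cof_vec_space n "TYPE(complex)" .
  define b where "b = basis_completion v"
  define ws where "ws = gram_schmidt n b"
  from basis_completion[OF v v0, folded b_def]
  have dist_b: "distinct b" and indep: "\<not> lin_dep (set b)" and b: "set b \<subseteq> carrier_vec n"
    and hdb: "hd b = v" and len_b: "length b = n" by auto
  from hdb len_b n obtain vs where bv: "b = v # vs" by (cases b) auto
  from gram_schmidt_result[OF b dist_b indep refl, folded ws_def]
  have ws: "set ws \<subseteq> carrier_vec n" "corthogonal ws" "length ws = n"
    by (auto simp: len_b)
  from gram_schmidt_hd[OF v, of vs, folded bv] have hdws: "hd ws = v" unfolding ws_def .
  have w: "ws ! i \<in> carrier_vec n" if "i < n" for i using ws that by auto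
  have w0: "ws ! 0 = v" using hdws ws(3) n by (cases ws) auto
  define nr where "nr i = (\<Sum>k<n. (cmod (ws ! i $ k))\<^sup>2)" for i
  have ip: "ws ! j \<bullet>c ws ! i = (\<Sum>k<n. cnj (ws ! i $ k) * ws ! j $ k)" if "i < n" "j < n" for i j
    using w[OF that(1)] w[OF that(2)]
    by (auto simp: scalar_prod_def lessThan_atLeast0 mult.commute intro!: sum.cong)
  have ipi: "(\<Sum>k<n. cnj (ws ! i $ k) * ws ! i $ k) = of_real (nr i)" for i
    unfolding nr_def of_real_sum by (rule sum.cong[OF refl]) (simp only: complex_norm_square mult.commute)
  have nr0: "nr i \<ge> 0" for i unfolding nr_def by (rule sum_nonneg) auto
  \<comment> \<open>\<open>corthogonal\<close> includes that each self inner product is nonzero, so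
    every vector can be normalised.\<close>
  have nrp: "nr i > 0" if "i < n" for i
  proof -
    have "ws ! i \<bullet>c ws ! i \<noteq> 0"
      using corthogonalD[OF ws(2), of i i] that ws(3) by auto
    thus ?thesis using ip[OF that that] ipi[of i] nr0[of i] by auto
  qed
  define W where "W = mat n n (\<lambda>(k,i). ws ! i $ k / of_real (sqrt (nr i)))"
  have W: "W \<in> carrier_mat n n" by (auto simp: W_def)
  have "cadj W * W = 1\<^sub>m n"
  proof (rule eq_matI)
    fix i j assume "i < dim_row (1\<^sub>m n)" "j < dim_col (1\<^sub>m n)"
    hence ij: "i < n" "j < n" by auto
    have "(cadj W * W) $$ (i,j) = (\<Sum>l<n. cadj W $$ (i,l) * W $$ (l,j))"
      by (rule mult_mat_index_sum) (use W ij in auto)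
    also have "\<dots> = (\<Sum>l<n. cnj (ws ! i $ l) * ws ! j $ l) / of_real (sqrt (nr i) * sqrt (nr j))"
      unfolding sum_divide_distrib by (rule sum.cong) (use ij W in \<open>auto simp: W_def\<close>)
    also have "\<dots> = (1\<^sub>m n) $$ (i,j)"
    proof (cases "i = j")
      case True
      thus ?thesis using ij ipi[of i] nrp[of i]
        by (simp flip: of_real_mult of_real_divide)
    next
      case False
      have "ws ! j \<bullet>c ws ! i = 0"
        using corthogonalD[OF ws(2), of j i] ij ws(3) False by auto
      thus ?thesis using ip[OF ij] False ij by auto
    qed
    finally show "(cadj W * W) $$ (i,j) = (1\<^sub>m n) $$ (i,j)" .
  qed (use W in auto)
  moreover have "col W 0 = (1 / of_real (sqrt (nr 0))) \<cdot>\<^sub>v v"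
    by (rule eq_vecI) (use n v w0 in \<open>auto simp: W_def\<close>)
  ultimately show ?thesis using that W by blast
qed

abbreviation real_diag :: "nat \<Rightarrow> (nat \<Rightarrow> real) \<Rightarrow> complex mat" where
  "real_diag n l \<equiv> mat_diag n (\<lambda>i. complex_of_real (l i))"

lemma cadj_real_diag [simp]: "cadj (real_diag n l) = real_diag n l"
  by (rule eq_matI) (auto simp: mat_diag_def)

lemma unitary_comm:
  assumes "W \<in> carrier_mat n n" "cadj W * W = 1\<^sub>m n"
  shows "W * cadj W = 1\<^sub>m n"
  using mat_mult_left_right_inverse[of "cadj W" n W] assms by auto

lemma mult_mat_assoc5:
  assumes "A \<in> carrier_mat n n" "B \<in> carrier_mat n n" "C \<in> carrier_mat n n"
    "D \<in> carrier_mat n n" "E \<in> carrier_mat n n"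
  shows "A * (B * C * D) * E = (A * B) * C * (D * (E :: complex mat))"
  using assms by (simp add: assoc_mult_mat[of _ n n _ n _ n])

text \<open>Deflation by induction on the dimension: a unitary whose first column is an eigenvector
  turns \<open>A\<close> into a real \<open>1 \<times> 1\<close> block and a smaller Hermitian
  block.\<close>

lemma hermitian_spectral:
  assumes "A \<in> carrier_mat n n" "cadj A = A"
  shows "\<exists>W l. W \<in> carrier_mat n n \<and> cadj W * W = 1\<^sub>m n \<and> A = W * real_diag n l * cadj W"
  using assms
proof (induction n arbitrary: A)
  case 0
  thus ?case by (intro exI[of _ "1\<^sub>m 0"] exI[of _ "\<lambda>_. 0"]) auto
next
  case (Suc n A)
  let ?N = "Suc n"
  note A = Suc.prems(1)
  obtain as where as: "char_poly A = (\<Prod>a\<leftarrow>as. [:- a, 1:])" "length as = ?N"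
    using char_poly_factorized[OF A] by auto
  then obtain e es where "as = e # es" by (cases as) auto
  hence "poly (char_poly A) e = 0" using as by auto
  hence "eigenvalue A e" using eigenvalue_root_char_poly[OF A] by auto
  then obtain v where v: "v \<in> carrier_vec ?N" "v \<noteq> 0\<^sub>v ?N" "A *\<^sub>v v = e \<cdot>\<^sub>v v"
    unfolding eigenvalue_def eigenvector_def using A by auto
  obtain W1 c where W1: "W1 \<in> carrier_mat ?N ?N" "cadj W1 * W1 = 1\<^sub>m ?N" "col W1 0 = c \<cdot>\<^sub>v v"
    using unitary_completion[OF v(1,2)] by blast
  note W1c = unitary_comm[OF W1(1,2)]
  \<comment> \<open>Conjugation moves the eigenvector to the first coordinate. The first column of
    \<open>A'\<close> is then \<open>e\<close> times the first unit vector, and Hermiticity clears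
    the first row and makes \<open>e\<close> real.\<close>
  define A' where "A' = cadj W1 * A * W1"
  have A': "A' \<in> carrier_mat ?N ?N" using A W1(1) by (auto simp: A'_def)
  have hA': "cadj A' = A'"
    unfolding A'_def using A W1(1) Suc.prems(2)
    by (simp add: cadj_mult[of _ ?N ?N _ ?N] assoc_mult_mat[of _ ?N ?N _ ?N _ ?N])
  have "A *\<^sub>v col W1 0 = e \<cdot>\<^sub>v col W1 0"
    unfolding W1(3) using A v by (auto simp: mult_mat_vec smult_smult_assoc mult.commute)
  hence "col (A * W1) 0 = e \<cdot>\<^sub>v col W1 0"
    using A W1(1) by (subst col_mult2[of _ ?N ?N _ ?N]) auto
  hence AW: "(A * W1) $$ (l,0) = e * W1 $$ (l,0)" if "l < ?N" for l
    using that A W1(1) by (metis (no_types, lifting) carrier_matD col_def index_col index_mult_mat(2,3)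
        index_smult_vec(1) zero_less_Suc dim_col)
  have col0: "A' $$ (i,0) = (if i = 0 then e else 0)" if i: "i < ?N" for i
  proof -
    have "A' $$ (i,0) = (cadj W1 * (A * W1)) $$ (i,0)"
      unfolding A'_def using A W1(1) by (simp add: assoc_mult_mat[of _ ?N ?N _ ?N _ ?N])
    also have "\<dots> = (\<Sum>l<?N. cadj W1 $$ (i,l) * (A * W1) $$ (l,0))"
      by (rule mult_mat_index_sum) (use A W1 i in auto)
    also have "\<dots> = e * (\<Sum>l<?N. cadj W1 $$ (i,l) * W1 $$ (l,0))"
      unfolding sum_distrib_left by (rule sum.cong) (auto simp: AW)
    also have "(\<Sum>l<?N. cadj W1 $$ (i,l) * W1 $$ (l,0)) = (cadj W1 * W1) $$ (i,0)"
      by (rule mult_mat_index_sum[symmetric, of _ ?N ?N _ ?N]) (use A W1 i in auto)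
    finally show ?thesis using i by (simp add: W1(2))
  qed
  have herm: "A' $$ (i,j) = cnj (A' $$ (j,i))" if "i < ?N" "j < ?N" for i j
    using arg_cong[OF hA', of "\<lambda>B. B $$ (i,j)"] that A' by auto
  have er: "e = of_real (Re e)"
    using herm[of 0 0] col0[of 0] by (auto simp: complex_eq_iff)
  define A3 where "A3 = mat n n (\<lambda>(i,j). A' $$ (Suc i, Suc j))"
  have A3: "A3 \<in> carrier_mat n n" by (auto simp: A3_def)
  have hA3: "cadj A3 = A3"
    by (rule eq_matI) (auto simp: A3_def herm[symmetric])
  from Suc.IH[OF A3 hA3] obtain W3 l where
    W3: "W3 \<in> carrier_mat n n" "cadj W3 * W3 = 1\<^sub>m n" and A3e: "A3 = W3 * real_diag n l * cadj W3"
    by blast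
  define l' where "l' i = (case i of 0 \<Rightarrow> Re e | Suc k \<Rightarrow> l k)" for i
  define W2 where "W2 = four_block_mat (1\<^sub>m 1) (0\<^sub>m 1 n) (0\<^sub>m n 1) W3"
  have W2: "W2 \<in> carrier_mat ?N ?N" using W3 by (auto simp: W2_def)
  have cW2: "cadj W2 = four_block_mat (1\<^sub>m 1) (0\<^sub>m 1 n) (0\<^sub>m n 1) (cadj W3)"
    unfolding W2_def
    by (subst cadj_four_block_diag[of _ 1 1 _ n n])
       (use W3 in \<open>auto intro!: cong_four_block_mat eq_matI\<close>)
  have uW2: "cadj W2 * W2 = 1\<^sub>m ?N"
    unfolding cW2 unfolding W2_def
    by (subst mult_four_block_mat[of _ 1 1 _ n _ n _ _ 1 _ n])
       (use W3 in \<open>auto simp: four_block_one_mat[of 1 n, simplified]\<close>)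
  have D: "real_diag ?N l' = four_block_mat (mat 1 1 (\<lambda>_. e)) (0\<^sub>m 1 n) (0\<^sub>m n 1) (real_diag n l)"
    by (rule eq_matI) (use er in \<open>auto simp: mat_diag_def l'_def split: nat.splits\<close>)
  have A'b: "A' = four_block_mat (mat 1 1 (\<lambda>_. e)) (0\<^sub>m 1 n) (0\<^sub>m n 1) A3"
  proof (rule eq_matI)
    fix i j assume "i < dim_row (four_block_mat (mat 1 1 (\<lambda>_. e)) (0\<^sub>m 1 n) (0\<^sub>m n 1) A3)"
      "j < dim_col (four_block_mat (mat 1 1 (\<lambda>_. e)) (0\<^sub>m 1 n) (0\<^sub>m n 1) A3)"
    hence ij: "i < ?N" "j < ?N" using A3 by auto
    show "A' $$ (i,j) = four_block_mat (mat 1 1 (\<lambda>_. e)) (0\<^sub>m 1 n) (0\<^sub>m n 1) A3 $$ (i,j)"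
      using ij col0[of i] col0[of j] herm[of i j] A3
      by (cases i; cases j) (auto simp: A3_def)
  qed (use A' A3 in auto)
  have WD: "W2 * real_diag ?N l'
      = four_block_mat (mat 1 1 (\<lambda>_. e)) (0\<^sub>m 1 n) (0\<^sub>m n 1) (W3 * real_diag n l)"
    unfolding D W2_def
    by (subst mult_four_block_mat[of _ 1 1 _ n _ n _ _ 1 _ n])
       (use W3 left_mult_zero_mat[of "real_diag n l" n n 1] in auto)
  have WDW: "W2 * real_diag ?N l' * cadj W2 = A'"
    unfolding WD unfolding cW2 A'b A3e
    by (subst mult_four_block_mat[of _ 1 1 _ n _ n _ _ 1 _ n])
       (use W3 left_mult_zero_mat[of "cadj W3" n n 1] right_mult_zero_mat[of "W3 * real_diag n l" n n 1] in auto)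
  define W where "W = W1 * W2"
  have W: "W \<in> carrier_mat ?N ?N" using W1 W2 by (auto simp: W_def)
  have cW: "cadj W = cadj W2 * cadj W1"
    unfolding W_def by (rule cadj_mult) (use W1 W2 in auto)
  have "cadj W * W = cadj W2 * (cadj W1 * W1) * W2"
    unfolding cW unfolding W_def using W1(1) W2
    by (simp add: assoc_mult_mat[of _ ?N ?N _ ?N _ ?N] mult_carrier_mat[of _ ?N ?N _ ?N])
  also have "\<dots> = 1\<^sub>m ?N" unfolding W1(2) using W2 uW2 by simp
  finally have uW: "cadj W * W = 1\<^sub>m ?N" .
  have "W * real_diag ?N l' * cadj W = W1 * (W2 * real_diag ?N l' * cadj W2) * cadj W1"
    unfolding cW unfolding W_def by (rule mult_mat_assoc5[symmetric]) (use W1 W2 in auto)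
  also have "\<dots> = (W1 * cadj W1) * A * (W1 * cadj W1)"
    unfolding WDW A'_def by (rule mult_mat_assoc5) (use W1 A in auto)
  also have "\<dots> = A" unfolding W1c using A by simp
  finally show ?case using W uW by metis
qed

text \<open>The eigenvalues are nonnegative because they are the squared norms of the columns of
  \<open>M * W\<close>.\<close>

lemma gram_spectral:
  assumes M: "M \<in> carrier_mat k n"
  obtains W l where "W \<in> carrier_mat n n" "cadj W * W = 1\<^sub>m n" "\<And>i. i < n \<Longrightarrow> 0 \<le> l i"
    "cadj M * M = W * real_diag n l * cadj W"
proof -
  let ?A = "cadj M * M"
  have A: "?A \<in> carrier_mat n n" using M by auto
  have h: "cadj ?A = ?A" using cadj_mult[of "cadj M" n k M n] M by auto
  obtain W l where W: "W \<in> carrier_mat n n" "cadj W * W = 1\<^sub>m n" and e: "?A = W * real_diag n l * cadj W"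
    using hermitian_spectral[OF A h] by blast
  have "cadj (M * W) * (M * W) = cadj W * ?A * W"
    using M W(1) A assoc_mult_mat[of "cadj M" n k M n W n] assoc_mult_mat[of "cadj W" n n "cadj M" k "M * W" n]
      assoc_mult_mat[of "cadj W" n n "cadj M * M" n W n] by (simp add: cadj_mult[of _ k n _ n])
  also have "\<dots> = (cadj W * W) * real_diag n l * (cadj W * W)"
    unfolding e by (rule mult_mat_assoc5) (use W in auto)
  also have "\<dots> = real_diag n l"
    unfolding W(2) left_mult_one_mat[OF mat_diag_dim] right_mult_one_mat[OF mat_diag_dim] ..
  finally have d: "cadj (M * W) * (M * W) = real_diag n l" .
  have "0 \<le> l i" if i: "i < n" for i
  proof -
    have "of_real (l i) = (cadj (M * W) * (M * W)) $$ (i,i)"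
      unfolding d using i by (simp add: mat_diag_def)
    also have "\<dots> = (\<Sum>j<k. cadj (M * W) $$ (i,j) * (M * W) $$ (j,i))"
      by (rule mult_mat_index_sum) (use M W i in auto)
    also have "\<dots> = (\<Sum>j<k. of_real ((cmod ((M * W) $$ (j,i)))\<^sup>2))"
      by (rule sum.cong[OF refl], subst cadj_index)
         (use M W i in \<open>auto simp only: complex_norm_square mult.commute index_mult_mat lessThan_iff carrier_matD\<close>)
    finally have "l i = (\<Sum>j<k. (cmod ((M * W) $$ (j,i)))\<^sup>2)"
      by (metis (no_types, lifting) of_real_eq_iff of_real_sum sum.cong)
    thus ?thesis by (simp add: sum_nonneg)
  qed
  thus ?thesis using that W e by blast
qed

section \<open>Von Neumann entropy as a sum over eigenvalues with multiplicity\<close>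

lemma order_linear_factors:
  "Polynomial.order e (\<Prod>a\<leftarrow>as. [:- a, 1:]) = count_list as (e :: complex)"
proof (induction as)
  case (Cons a as)
  have "(\<Prod>a\<leftarrow>as. [:- a, 1:]) \<noteq> (0 :: complex poly)" by (auto simp: prod_list_zero_iff)
  hence "Polynomial.order e (\<Prod>a\<leftarrow>a # as. [:- a, 1:]) = Polynomial.order e [:- a, 1:] + Polynomial.order e (\<Prod>a\<leftarrow>as. [:- a, 1:])"
    by (auto intro!: order_mult simp del: mult_pCons_left)
  moreover have "Polynomial.order e [:- a, 1:] = (if a = e then 1 else 0)"
    using order_power_n_n[of e 1] by (auto intro: order_0I)
  ultimately show ?case using Cons by auto
qed auto

lemma sum_count_list:
  fixes f :: "'a \<Rightarrow> real"
  shows "(\<Sum>e\<in>set as. real (count_list as e) * f e) = (\<Sum>a\<leftarrow>as. f a)"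
proof -
  have "(\<Sum>e\<in>S. real (count_list as e) * f e) = (\<Sum>a\<leftarrow>as. f a)" if "finite S" "set as \<subseteq> S" for S
    using that(2)
  proof (induction as)
    case (Cons a as)
    have "(\<Sum>e\<in>S. real (count_list (a # as) e) * f e)
        = (\<Sum>e\<in>S. real (count_list as e) * f e + (if a = e then f e else 0))"
      by (rule sum.cong) (auto simp: algebra_simps)
    thus ?case using Cons \<open>finite S\<close> by (simp add: sum.distrib)
  qed auto
  thus ?thesis by auto
qed

lemma vn_entropy_linear_factors:
  assumes "char_poly A = (\<Prod>a\<leftarrow>as. [:- a, 1:])"
  shows "vn_entropy A = (\<Sum>a\<leftarrow>as. eta (Re a))"
proof -
  have "{e. poly (char_poly A) e = 0} = set as"
    unfolding assms by (auto simp: poly_prod_list prod_list_zero_iff)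
  thus ?thesis unfolding vn_entropy_def
    by (simp add: assms order_linear_factors sum_count_list)
qed

lemma vn_entropy_unitary_diag:
  assumes W: "W \<in> carrier_mat n n" "cadj W * W = 1\<^sub>m n" and A: "A = W * real_diag n l * cadj W"
  shows "vn_entropy A = (\<Sum>i<n. eta (l i))"
proof -
  have "similar_mat A (real_diag n l)"
    by (rule similar_matI[of _ _ W "cadj W" n]) (use W A unitary_comm[OF W] in auto)
  hence "char_poly A = char_poly (real_diag n l)" by (rule char_poly_similar)
  also have "\<dots> = (\<Prod>a\<leftarrow>diag_mat (real_diag n l). [:- a, 1:])"
    by (rule char_poly_upper_triangular[of _ n]) (auto simp: mat_diag_def)
  finally have "vn_entropy A = (\<Sum>a\<leftarrow>diag_mat (real_diag n l). eta (Re a))"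
    by (rule vn_entropy_linear_factors)
  also have "\<dots> = (\<Sum>i\<leftarrow>[0..<n]. eta (l i))"
    unfolding diag_mat_def map_map
    by (intro arg_cong[where f = sum_list] map_cong) (auto simp: mat_diag_def)
  also have "\<dots> = (\<Sum>i<n. eta (l i))"
    by (simp add: interv_sum_list_conv_sum_set_nat lessThan_atLeast0)
  finally show ?thesis .
qed

text \<open>Two block eliminations of the matrix \<open>X\<close> with blocks \<open>x I\<close>,
  \<open>A\<close>, \<open>B\<close>, \<open>I\<close>: right multiplication by \<open>L\<close>, of
  determinant 1, exposes \<open>x I - A B\<close>; left multiplication by \<open>L'\<close>, of
  determinant \<open>x ^ m\<close>, exposes \<open>x I - B A\<close>. Comparing determinants gives
  the identity.\<close>

lemma char_poly_mult_swap:
  fixes A B :: "complex mat"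
  assumes A: "A \<in> carrier_mat n m" and B: "B \<in> carrier_mat m n"
  shows "[:0,1:] ^ m * char_poly (A * B) = [:0,1:] ^ n * char_poly (B * A)"
proof -
  interpret c: comm_ring_hom "\<lambda>a :: complex. [:a:]" by unfold_locales auto
  let ?h = "map_mat (\<lambda>a :: complex. [:a:])"
  let ?x = "[:0,1:] :: complex poly"
  define P where "P = ?h A"
  define Q where "Q = ?h B"
  have PQ: "P \<in> carrier_mat n m" "Q \<in> carrier_mat m n" using A B by (auto simp: P_def Q_def)
  have cp: "char_poly_matrix C = ?x \<cdot>\<^sub>m 1\<^sub>m k - ?h C" if "C \<in> carrier_mat k k" for C k
    using that by (intro eq_matI) (auto simp: char_poly_matrix_def)
  have cAB: "char_poly_matrix (A * B) = ?x \<cdot>\<^sub>m 1\<^sub>m n - P * Q"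
    using cp[of "A * B" n] A B c.mat_hom_mult[OF A B] by (auto simp: P_def Q_def)
  have cBA: "char_poly_matrix (B * A) = ?x \<cdot>\<^sub>m 1\<^sub>m m - Q * P"
    using cp[of "B * A" m] A B c.mat_hom_mult[OF B A] by (auto simp: P_def Q_def)
  define X where "X = four_block_mat (?x \<cdot>\<^sub>m 1\<^sub>m n) P Q (1\<^sub>m m)"
  have X: "X \<in> carrier_mat (n + m) (n + m)" using PQ by (auto simp: X_def)
  define L where "L = four_block_mat (1\<^sub>m n) (0\<^sub>m n m) (- Q) (1\<^sub>m m)"
  define L' where "L' = four_block_mat (1\<^sub>m n) (0\<^sub>m n m) (- Q) (?x \<cdot>\<^sub>m 1\<^sub>m m)"
  have L: "L \<in> carrier_mat (n + m) (n + m)" "L' \<in> carrier_mat (n + m) (n + m)"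
    using PQ by (auto simp: L_def L'_def)
  have dL: "det L = 1" unfolding L_def
    by (subst det_four_block_mat_upper_right_zero[of _ n _ m]) (use PQ in auto)
  have dL': "det L' = ?x ^ m" unfolding L'_def
    by (subst det_four_block_mat_upper_right_zero[of _ n _ m]) (use PQ in \<open>auto simp: det_smult\<close>)
  have XL: "X * L = four_block_mat (?x \<cdot>\<^sub>m 1\<^sub>m n - P * Q) P (0\<^sub>m m n) (1\<^sub>m m)"
    unfolding X_def L_def
    by (subst mult_four_block_mat[of _ n n _ m _ m _ _ n _ m])
       (use PQ in \<open>auto intro!: cong_four_block_mat eq_matI simp: scalar_prod_def\<close>)
  have LX: "L' * X = four_block_mat (?x \<cdot>\<^sub>m 1\<^sub>m n) P (0\<^sub>m m n) (?x \<cdot>\<^sub>m 1\<^sub>m m - Q * P)"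
  proof -
    have a: "- Q * (?x \<cdot>\<^sub>m 1\<^sub>m n) + (?x \<cdot>\<^sub>m 1\<^sub>m m) * Q = 0\<^sub>m m n"
      using PQ mult_smult_distrib[of "- Q" m n "1\<^sub>m n" n ?x] mult_smult_assoc_mat[of "1\<^sub>m m" m m Q n ?x]
      by (auto intro!: eq_matI)
    have b: "- Q * P + (?x \<cdot>\<^sub>m 1\<^sub>m m) * 1\<^sub>m m = ?x \<cdot>\<^sub>m 1\<^sub>m m - Q * P"
      using PQ by (auto intro!: eq_matI simp: scalar_prod_def sum_negf)
    have c: "1\<^sub>m n * (?x \<cdot>\<^sub>m 1\<^sub>m n) + 0\<^sub>m n m * Q = ?x \<cdot>\<^sub>m 1\<^sub>m n"
      "1\<^sub>m n * P + 0\<^sub>m n m * 1\<^sub>m m = P"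
      using PQ left_mult_zero_mat[of Q m n n] by auto
    show ?thesis
      unfolding X_def L'_def
      by (subst mult_four_block_mat[of _ n n _ m _ m _ _ n _ m]) (use PQ in \<open>auto simp: a b c\<close>)
  qed
  have "det X = det (X * L)" using det_mult[OF X L(1)] dL by simp
  also have "\<dots> = char_poly (A * B)"
    unfolding XL char_poly_def cAB
    by (subst det_four_block_mat_lower_left_zero[of _ n _ m]) (use PQ in auto)
  finally have 1: "det X = char_poly (A * B)" .
  have "?x ^ m * det X = det (L' * X)" using det_mult[OF L(2) X] dL' by simp
  also have "\<dots> = ?x ^ n * char_poly (B * A)"
    unfolding LX char_poly_def cBA
    by (subst det_four_block_mat_lower_left_zero[of _ n _ m]) (use PQ in \<open>auto simp: det_smult\<close>)
  finally show ?thesis unfolding 1 .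
qed

text \<open>Since \<open>eta 0 = 0\<close>, the root 0 contributes nothing and a factor
  \<open>x ^ k\<close> is harmless. Both sides of \<open>char_poly_mult_swap\<close> can thus be
  read off one common polynomial.\<close>

lemma vn_entropy_nonzero_eigenvalues:
  assumes A: "A \<in> carrier_mat n n"
  shows "vn_entropy A = (\<Sum>e \<in> {e. e \<noteq> 0 \<and> poly ([:0,1:] ^ k * char_poly A) e = 0}.
    real (Polynomial.order e ([:0,1:] ^ k * char_poly A)) * eta (Re e))"
proof -
  have nz: "char_poly A \<noteq> 0" using degree_monic_char_poly[OF A] by auto
  hence fin: "finite {e. poly (char_poly A) e = 0}" by (rule poly_roots_finite)
  have ord: "Polynomial.order e ([:0,1:] ^ k * char_poly A) = Polynomial.order e (char_poly A)" if "e \<noteq> 0" for e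
  proof -
    have "Polynomial.order e ([:0,1:] ^ k) = 0" using that by (intro order_0I) (auto simp: poly_power)
    thus ?thesis using nz by (subst order_mult) auto
  qed
  have "vn_entropy A = (\<Sum>e \<in> {e. e \<noteq> 0 \<and> poly (char_poly A) e = 0}.
      real (Polynomial.order e (char_poly A)) * eta (Re e))"
    unfolding vn_entropy_def
    by (rule sum.mono_neutral_right) (use fin in \<open>auto simp: eta_def\<close>)
  also have "\<dots> = (\<Sum>e \<in> {e. e \<noteq> 0 \<and> poly ([:0,1:] ^ k * char_poly A) e = 0}.
    real (Polynomial.order e ([:0,1:] ^ k * char_poly A)) * eta (Re e))"
    by (rule sum.cong) (auto simp: ord poly_power)
  finally show ?thesis .
qed

lemma vn_entropy_mult_swap:
  assumes A: "A \<in> carrier_mat n m" and B: "B \<in> carrier_mat m n"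
  shows "vn_entropy (A * B) = vn_entropy (B * A)"
  using vn_entropy_nonzero_eigenvalues[of "A * B" n m] vn_entropy_nonzero_eigenvalues[of "B * A" m n]
    char_poly_mult_swap[OF A B] A B by simp

section \<open>Integral representation of relative entropy\<close>

text \<open>An explicit primitive replaces integration. It equals \<open>l * ln m - (m - l)\<close>
  at \<open>t = 0\<close> and tends to \<open>l * ln l\<close>, so its total increment is the
  relative entropy term \<open>l * ln l - l * ln m - l + m\<close>.\<close>

lemma relative_entropy_antiderivative:
  fixes l m t :: real
  assumes "0 \<le> l" "0 < m" "0 \<le> t"
  shows "((\<lambda>t. l * ln (l + (m - l) / (1 + t)) - (m - l) / (1 + t)) has_real_derivative
      (l - m)\<^sup>2 / (m + t * l) / (1 + t)\<^sup>2) (at t)"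
proof -
  have p: "0 < m + t * l" "0 < 1 + t" using assms by (auto intro: add_pos_nonneg)
  have e: "l + (m - l) / (1 + t) = (m + t * l) / (1 + t)" using p by (simp add: field_simps)
  hence q: "0 < l + (m - l) / (1 + t)" using p by simp
  have "((\<lambda>t. l * ln (l + (m - l) / (1 + t)) - (m - l) / (1 + t)) has_real_derivative
      l * ((- (m - l) / (1 + t)\<^sup>2) / (l + (m - l) / (1 + t))) - (- (m - l) / (1 + t)\<^sup>2)) (at t)"
    using p q by (auto intro!: derivative_eq_intros simp: power2_eq_square mult_ac)
  also have "l * ((- (m - l) / (1 + t)\<^sup>2) / (l + (m - l) / (1 + t))) - (- (m - l) / (1 + t)\<^sup>2)
      = (m - l) / (1 + t)\<^sup>2 * (1 - l * (1 + t) / (m + t * l))"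
    unfolding e using p by (simp add: divide_simps) (simp add: algebra_simps)
  also have "1 - l * (1 + t) / (m + t * l) = (m - l) / (m + t * l)"
    using p by (simp add: divide_simps) (simp add: algebra_simps)
  also have "(m - l) / (1 + t)\<^sup>2 * ((m - l) / (m + t * l)) = (l - m)\<^sup>2 / (m + t * l) / (1 + t)\<^sup>2"
    by (simp add: power2_eq_square algebra_simps)
  finally show ?thesis .
qed

lemma relative_entropy_antiderivative_limit:
  fixes l m :: real
  assumes "0 \<le> l" "0 < m"
  shows "((\<lambda>t. l * ln (l + (m - l) / (1 + t)) - (m - l) / (1 + t)) \<longlongrightarrow> l * ln l) at_top"
proof -
  have "filterlim (\<lambda>t::real. 1 + t) at_infinity at_top"
    by (intro filterlim_at_top_imp_at_infinity filterlim_tendsto_add_at_top[OF tendsto_const] filterlim_ident)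
  hence z: "((\<lambda>t. (m - l) / (1 + t)) \<longlongrightarrow> 0) at_top"
    by (intro tendsto_divide_0[OF tendsto_const])
  show ?thesis
  \<comment> \<open>Continuity of \<open>ln\<close> is available only at a nonzero limit point; for
    \<open>l = 0\<close> the logarithmic term is multiplied by 0.\<close>
  proof (cases "l = 0")
    case True
    thus ?thesis using tendsto_minus[OF z] by simp
  next
    case False
    hence "((\<lambda>t. l * ln (l + (m - l) / (1 + t)) - (m - l) / (1 + t)) \<longlongrightarrow> l * ln (l + 0) - 0) at_top"
      by (intro tendsto_intros z) auto
    thus ?thesis by simp
  qed
qed

text \<open>Both sides are integrated against \<open>dt / (1 + t)\<^sup>2\<close>, using
  \<open>l ln (l / m) - l + m = \<integral>\<^sub>0\<^sup>\<infinity> (l - m)\<^sup>2 / (m + t l) dt / (1 + t)\<^sup>2\<close>.\<close>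

lemma relative_entropy_mono:
  fixes w l m :: "'i \<Rightarrow> real" and w' l' m' :: "'j \<Rightarrow> real"
  assumes l: "\<And>i. i \<in> I \<Longrightarrow> 0 \<le> l i" "\<And>i. i \<in> J \<Longrightarrow> 0 \<le> l' i"
    and m: "\<And>i. i \<in> I \<Longrightarrow> 0 < m i" "\<And>i. i \<in> J \<Longrightarrow> 0 < m' i"
    and le: "\<And>t. 0 \<le> t \<Longrightarrow> (\<Sum>i\<in>J. w' i * ((l' i - m' i)\<^sup>2 / (m' i + t * l' i)))
      \<le> (\<Sum>i\<in>I. w i * ((l i - m i)\<^sup>2 / (m i + t * l i)))"
  shows "(\<Sum>i\<in>J. w' i * (l' i * ln (l' i) - l' i * ln (m' i) - l' i + m' i))
    \<le> (\<Sum>i\<in>I. w i * (l i * ln (l i) - l i * ln (m i) - l i + m i))"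
proof -
  define g where "g l m t = l * ln (l + (m - l) / (1 + t)) - (m - l) / (1 + t)" for l m t :: real
  \<comment> \<open>No integral is formed: \<open>d\<close> is a primitive of the difference of the
    two integrands, hence nondecreasing, and the claim says that \<open>d 0\<close> is at most the
    limit of \<open>d\<close>.\<close>
  define d where "d t = (\<Sum>i\<in>I. w i * g (l i) (m i) t) - (\<Sum>i\<in>J. w' i * g (l' i) (m' i) t)" for t
  define d' where "d' t = (\<Sum>i\<in>I. w i * ((l i - m i)\<^sup>2 / (m i + t * l i) / (1 + t)\<^sup>2))
    - (\<Sum>i\<in>J. w' i * ((l' i - m' i)\<^sup>2 / (m' i + t * l' i) / (1 + t)\<^sup>2))" for t
  have der: "(d has_real_derivative d' t) (at t)" if "0 \<le> t" for t
    unfolding d_def d'_def g_def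
    by (intro derivative_intros DERIV_sum DERIV_cmult relative_entropy_antiderivative)
       (use l m that in auto)
  have d'0: "0 \<le> d' t" if "0 \<le> t" for t
  proof -
    have "d' t = ((\<Sum>i\<in>I. w i * ((l i - m i)\<^sup>2 / (m i + t * l i)))
      - (\<Sum>i\<in>J. w' i * ((l' i - m' i)\<^sup>2 / (m' i + t * l' i)))) / (1 + t)\<^sup>2"
      by (simp add: d'_def diff_divide_distrib sum_divide_distrib)
    thus ?thesis using le[OF that] by simp
  qed
  have mono: "d 0 \<le> d t" if "0 \<le> t" for t
    by (rule DERIV_nonneg_imp_nondecreasing[OF that]) (use der d'0 in blast)
  let ?L = "(\<Sum>i\<in>I. w i * (l i * ln (l i))) - (\<Sum>i\<in>J. w' i * (l' i * ln (l' i)))"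
  have "(d \<longlongrightarrow> ?L) at_top"
    unfolding d_def g_def
    by (intro tendsto_diff tendsto_sum tendsto_mult_left relative_entropy_antiderivative_limit)
       (use l m in auto)
  hence "d 0 \<le> ?L"
    by (rule tendsto_lowerbound) (auto simp: eventually_at_top_linorder intro!: exI[of _ 0] mono)
  thus ?thesis
    by (simp add: d_def g_def algebra_simps sum.distrib sum_subtractf)
qed

section \<open>Monotonicity of relative entropy under pinching\<close>

lemma mtrace_mult:
  assumes "A \<in> carrier_mat n m" "B \<in> carrier_mat m n"
  shows "mtrace (A * B) = (\<Sum>i<n. \<Sum>j<m. A $$ (i,j) * B $$ (j,i))"
  unfolding mtrace_def
  by (rule sum.cong) (use assms mult_mat_index_sum[OF assms] in auto)

lemma mtrace_mult_comm:
  assumes "A \<in> carrier_mat n m" "B \<in> carrier_mat m n"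
  shows "mtrace (A * B) = mtrace (B * A)"
  unfolding mtrace_mult[OF assms] mtrace_mult[OF assms(2,1)]
  by (subst sum.swap) (simp add: mult.commute)

lemma mtrace_unitary_conj:
  assumes U: "U \<in> carrier_mat n n" "cadj U * U = 1\<^sub>m n" and B: "B \<in> carrier_mat n n"
  shows "mtrace (U * B * cadj U) = mtrace B"
proof -
  have "mtrace (U * B * cadj U) = mtrace (cadj U * (U * B))"
    by (rule mtrace_mult_comm) (use U B in auto)
  also have "cadj U * (U * B) = (cadj U * U) * B"
    by (rule assoc_mult_mat[symmetric]) (use U B in auto)
  finally show ?thesis using B U(2) by simp
qed

lemma mtrace_cadj_mult:
  assumes "X \<in> carrier_mat n m" "Z \<in> carrier_mat n m"
  shows "mtrace (cadj X * Z) = (\<Sum>i<m. \<Sum>j<n. cnj (X $$ (j,i)) * Z $$ (j,i))"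
  by (subst mtrace_mult[of _ m n]) (use assms in auto)

text \<open>Completing the square in the coordinates \<open>V\<^sup>* Y U\<close>, the maximum of \<open>quad t Y\<close> over \<open>Y\<close> is
  \<open>chi t\<close> below. As \<open>quad t Y\<close> is linear in the two states, \<open>chi t\<close> is jointly convex.\<close>

definition quad :: "real \<Rightarrow> complex mat \<Rightarrow> complex mat \<Rightarrow> complex mat \<Rightarrow> real" where
  "quad t Y \<rho> \<sigma> = 2 * Re (mtrace (cadj Y * \<rho>)) - 2 * Re (mtrace (cadj Y * \<sigma>))
     - Re (mtrace (cadj Y * \<sigma> * Y)) - t * Re (mtrace (Y * \<rho> * cadj Y))"

text \<open>Cyclicity of the trace moves each of the four terms into the eigenbases of the two
  states. There the entries of \<open>X\<close> decouple, and the states interact only through the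
  overlaps \<open>cadj V * U\<close>.\<close>

lemma quad_spectral:
  assumes U: "U \<in> carrier_mat n n" "cadj U * U = 1\<^sub>m n"
    and V: "V \<in> carrier_mat n n" "cadj V * V = 1\<^sub>m n"
    and X: "X \<in> carrier_mat n n"
  shows "quad t (V * X * cadj U) (U * real_diag n l * cadj U) (V * real_diag n m * cadj V)
    = (\<Sum>i<n. \<Sum>j<n. 2 * (l i - m j) * Re (cnj (X $$ (j,i)) * (cadj V * U) $$ (j,i))
        - (m j + t * l i) * (cmod (X $$ (j,i)))\<^sup>2)"
proof -
  let ?L = "real_diag n l" and ?M = "real_diag n m"
  define Y where "Y = V * X * cadj U"
  define Om where "Om = cadj V * U"
  note as = assoc_mult_mat[of _ n n _ n _ n] and mc = mult_carrier_mat[of _ n n _ n]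
  have [simp]: "Om \<in> carrier_mat n n" "Y \<in> carrier_mat n n" "cadj X \<in> carrier_mat n n"
      "cadj U \<in> carrier_mat n n" "cadj V \<in> carrier_mat n n"
    using U V X by (auto simp: Om_def Y_def)
  note [simp] = U(1) V(1) X
  have UU: "cadj U * (U * B) = B" if "B \<in> carrier_mat n n" for B
    using that as[of "cadj U" U B] U(2) by simp
  have VV: "cadj V * (V * B) = B" if "B \<in> carrier_mat n n" for B
    using that as[of "cadj V" V B] V(2) by simp
  have cY: "cadj Y = U * (cadj X * cadj V)"
    unfolding Y_def by (simp add: cadj_mult[of _ n n _ n] mc)
  have VO: "cadj V = Om * cadj U"
    unfolding Om_def using unitary_comm[OF U] right_mult_one_mat[of "cadj V" n n] by (simp add: as)
  have "cadj Y * (U * ?L * cadj U) = U * (cadj X * (Om * ?L)) * cadj U"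
    unfolding cY Om_def by (simp add: as mc)
  hence 1: "mtrace (cadj Y * (U * ?L * cadj U)) = mtrace (cadj X * (Om * ?L))"
    using mtrace_unitary_conj[OF U, of "cadj X * (Om * ?L)"] by (simp add: mc)
  have "cadj Y * (V * ?M * cadj V) = U * (cadj X * (?M * cadj V))"
    unfolding cY by (simp add: as mc VV)
  also have "\<dots> = U * (cadj X * (?M * Om)) * cadj U"
    unfolding VO by (simp add: as mc)
  finally have 2: "mtrace (cadj Y * (V * ?M * cadj V)) = mtrace (cadj X * (?M * Om))"
    using mtrace_unitary_conj[OF U, of "cadj X * (?M * Om)"] by (simp add: mc)
  have "cadj Y * (V * ?M * cadj V) * Y = U * (cadj X * (?M * X)) * cadj U"
    unfolding cY unfolding Y_def by (simp add: as mc VV)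
  hence 3: "mtrace (cadj Y * (V * ?M * cadj V) * Y) = mtrace (cadj X * (?M * X))"
    using mtrace_unitary_conj[OF U, of "cadj X * (?M * X)"] by (simp add: mc)
  have "Y * (U * ?L * cadj U) * cadj Y = V * (X * ?L * cadj X) * cadj V"
    unfolding cY unfolding Y_def by (simp add: as mc UU)
  hence "mtrace (Y * (U * ?L * cadj U) * cadj Y) = mtrace ((X * ?L) * cadj X)"
    using mtrace_unitary_conj[OF V, of "X * ?L * cadj X"] by (simp add: mc)
  also have "\<dots> = mtrace (cadj X * (X * ?L))"
    by (rule mtrace_mult_comm[of _ n n]) (simp_all add: mc)
  finally have 4: "mtrace (Y * (U * ?L * cadj U) * cadj Y) = mtrace (cadj X * (X * ?L))" .
  have "quad t Y (U * ?L * cadj U) (V * ?M * cadj V)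
    = (\<Sum>i<n. \<Sum>j<n. 2 * Re (cnj (X $$ (j,i)) * (Om $$ (j,i) * l i))
        - 2 * Re (cnj (X $$ (j,i)) * (m j * Om $$ (j,i)))
        - Re (cnj (X $$ (j,i)) * (m j * X $$ (j,i)))
        - t * Re (cnj (X $$ (j,i)) * (X $$ (j,i) * l i)))"
    unfolding quad_def 1 2 3 4
    by (subst (1 2 3 4) mtrace_cadj_mult[of _ n n])
       (simp_all add: mc mat_diag_mult_left[of _ n n] mat_diag_mult_right[of _ n n]
          sum_subtractf sum_distrib_left sum.distrib distrib_left)
  also have "\<dots> = (\<Sum>i<n. \<Sum>j<n. 2 * (l i - m j) * Re (cnj (X $$ (j,i)) * Om $$ (j,i))
        - (m j + t * l i) * (cmod (X $$ (j,i)))\<^sup>2)"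
    by (intro sum.cong refl) (simp add: cmod_power2, simp add: algebra_simps power2_eq_square)
  finally show ?thesis unfolding Y_def Om_def .
qed

definition chi :: "real \<Rightarrow> nat \<Rightarrow> complex mat \<Rightarrow> (nat \<Rightarrow> real) \<Rightarrow> complex mat \<Rightarrow> (nat \<Rightarrow> real) \<Rightarrow> real" where
  "chi t n U l V m =
    (\<Sum>i<n. \<Sum>j<n. (cmod ((cadj V * U) $$ (j,i)))\<^sup>2 * ((l i - m j)\<^sup>2 / (m j + t * l i)))"

text \<open>This expands \<open>|c x - a z|^2 / c \<ge> 0\<close>. Equality holds at
  \<open>x = a z / c\<close>, which is the choice of \<open>X\<close> in
  \<open>quad_attains_chi\<close>.\<close>

lemma complete_square_le:
  fixes x z :: complex and a c :: real
  assumes c: "0 < c"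
  shows "2 * a * Re (cnj x * z) - c * (cmod x)\<^sup>2 \<le> (cmod z)\<^sup>2 * (a\<^sup>2 / c)"
proof -
  have "0 \<le> (cmod (of_real c * x - of_real a * z))\<^sup>2 / c" using c by simp
  also have "(cmod (of_real c * x - of_real a * z))\<^sup>2
      = c * (c * (cmod x)\<^sup>2 - 2 * a * Re (cnj x * z)) + a\<^sup>2 * (cmod z)\<^sup>2"
    by (simp add: cmod_power2) (simp add: algebra_simps power2_eq_square)
  finally show ?thesis using c by (simp add: add_divide_distrib mult.commute)
qed

lemma quad_le_chi:
  assumes U: "U \<in> carrier_mat n n" "cadj U * U = 1\<^sub>m n"
    and V: "V \<in> carrier_mat n n" "cadj V * V = 1\<^sub>m n"
    and l: "\<And>i. i < n \<Longrightarrow> 0 \<le> l i" and m: "\<And>i. i < n \<Longrightarrow> 0 < m i" and t: "0 \<le> t"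
    and Y: "Y \<in> carrier_mat n n"
  shows "quad t Y (U * real_diag n l * cadj U) (V * real_diag n m * cadj V) \<le> chi t n U l V m"
proof -
  define X where "X = cadj V * Y * U"
  have X: "X \<in> carrier_mat n n" using U V Y by (auto simp: X_def)
  have "V * X * cadj U = (V * cadj V) * Y * (U * cadj U)"
    unfolding X_def by (rule mult_mat_assoc5) (use U V Y in auto)
  hence YX: "Y = V * X * cadj U" using unitary_comm[OF U] unitary_comm[OF V] Y by simp
  show ?thesis
    unfolding YX quad_spectral[OF U V X] chi_def
    by (intro sum_mono complete_square_le add_pos_nonneg mult_nonneg_nonneg) (use l m t in auto)
qed

lemma quad_attains_chi:
  assumes U: "U \<in> carrier_mat n n" "cadj U * U = 1\<^sub>m n"
    and V: "V \<in> carrier_mat n n" "cadj V * V = 1\<^sub>m n"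
    and l: "\<And>i. i < n \<Longrightarrow> 0 \<le> l i" and m: "\<And>i. i < n \<Longrightarrow> 0 < m i" and t: "0 \<le> t"
  obtains Y where "Y \<in> carrier_mat n n"
    "quad t Y (U * real_diag n l * cadj U) (V * real_diag n m * cadj V) = chi t n U l V m"
proof -
  define X where "X = mat n n (\<lambda>(j,i). of_real ((l i - m j) / (m j + t * l i)) * (cadj V * U) $$ (j,i))"
  have X: "X \<in> carrier_mat n n" by (auto simp: X_def)
  have "quad t (V * X * cadj U) (U * real_diag n l * cadj U) (V * real_diag n m * cadj V) = chi t n U l V m"
    unfolding quad_spectral[OF U V X] chi_def
  proof (intro sum.cong refl)
    fix i j assume "i \<in> {..<n}" "j \<in> {..<n}"
    hence ij: "i < n" "j < n" by auto
    define z where "z = (cadj V * U) $$ (j,i)"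
    define a where "a = l i - m j"
    define c where "c = m j + t * l i"
    have c: "0 < c" unfolding c_def using l m t ij by (intro add_pos_nonneg) auto
    have x: "X $$ (j,i) = of_real (a / c) * z" using ij by (simp add: X_def a_def c_def z_def)
    have r: "Re (cnj (of_real (a / c) * z) * z) = a / c * (cmod z)\<^sup>2"
      by (simp add: cmod_power2) (simp add: power2_eq_square algebra_simps)
    have s: "(cmod (of_real (a / c) * z))\<^sup>2 = (a / c)\<^sup>2 * (cmod z)\<^sup>2"
      by (simp add: norm_mult power_mult_distrib norm_divide power_divide)
    have "2 * a * Re (cnj (X $$ (j,i)) * z) - c * (cmod (X $$ (j,i)))\<^sup>2 = (cmod z)\<^sup>2 * (a\<^sup>2 / c)"
      unfolding x r s using c by (simp add: field_simps power2_eq_square)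
    thus "2 * (l i - m j) * Re (cnj (X $$ (j,i)) * (cadj V * U) $$ (j,i))
        - (m j + t * l i) * (cmod (X $$ (j,i)))\<^sup>2
      = (cmod ((cadj V * U) $$ (j,i)))\<^sup>2 * ((l i - m j)\<^sup>2 / (m j + t * l i))"
      unfolding a_def c_def z_def .
  qed
  moreover have "V * X * cadj U \<in> carrier_mat n n"
    using U(1) V(1) X by (intro mult_carrier_mat[of _ n n _ n]) auto
  ultimately show ?thesis using that by blast
qed

lemma mtrace_add: "A \<in> carrier_mat n n \<Longrightarrow> B \<in> carrier_mat n n \<Longrightarrow> mtrace (A + B) = mtrace A + mtrace B"
  by (auto simp: mtrace_def sum.distrib)

lemma mtrace_smult: "mtrace (c \<cdot>\<^sub>m A) = c * mtrace A" if "A \<in> carrier_mat n n"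
  using that by (auto simp: mtrace_def sum_distrib_left)

lemma quad_midpoint:
  assumes Y: "Y \<in> carrier_mat n n"
    and r: "r1 \<in> carrier_mat n n" "r2 \<in> carrier_mat n n" and s: "s1 \<in> carrier_mat n n" "s2 \<in> carrier_mat n n"
  shows "quad t Y ((1/2) \<cdot>\<^sub>m (r1 + r2)) ((1/2) \<cdot>\<^sub>m (s1 + s2)) = (quad t Y r1 s1 + quad t Y r2 s2) / 2"
proof -
  note mc = mult_carrier_mat[of _ n n _ n]
  have [simp]: "cadj Y \<in> carrier_mat n n" using Y by simp
  note [simp] = Y r s
  have d: "A * ((1/2) \<cdot>\<^sub>m (B + C)) = (1/2) \<cdot>\<^sub>m (A * B + A * C)"
    "((1/2) \<cdot>\<^sub>m (B + C)) * A = (1/2) \<cdot>\<^sub>m (B * A + C * A)"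
    if "A \<in> carrier_mat n n" "B \<in> carrier_mat n n" "C \<in> carrier_mat n n" for A B C :: "complex mat"
    using that mult_smult_distrib[of A n n "B + C" n "1/2"] mult_smult_assoc_mat[of "B + C" n n A n "1/2"]
    by (simp_all add: mult_add_distrib_mat[of _ n n _ n] add_mult_distrib_mat[of _ n n _ _ n])
  have tr: "Re (mtrace ((1/2) \<cdot>\<^sub>m (B + C))) = (Re (mtrace B) + Re (mtrace C)) / 2"
    if "B \<in> carrier_mat n n" "C \<in> carrier_mat n n" for B C
    using that by (simp add: mtrace_smult[of _ n] mtrace_add[of _ n])
  show ?thesis
    unfolding quad_def by (simp add: d tr mc) (simp add: field_simps)
qed

text \<open>Take the maximiser \<open>Y\<close> for the averaged pair. By linearity
  \<open>quad\<close> splits into the values at the original and at the conjugated pair. Each is at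
  most the original \<open>chi\<close>, as conjugating both states by \<open>D\<close> leaves the
  overlaps unchanged.\<close>

lemma chi_midpoint_le:
  assumes U: "U \<in> carrier_mat n n" "cadj U * U = 1\<^sub>m n"
    and V: "V \<in> carrier_mat n n" "cadj V * V = 1\<^sub>m n"
    and U': "U' \<in> carrier_mat n n" "cadj U' * U' = 1\<^sub>m n"
    and V': "V' \<in> carrier_mat n n" "cadj V' * V' = 1\<^sub>m n"
    and D: "D \<in> carrier_mat n n" "cadj D * D = 1\<^sub>m n"
    and l: "\<And>i. i < n \<Longrightarrow> 0 \<le> l i" "\<And>i. i < n \<Longrightarrow> 0 \<le> l' i"
    and m: "\<And>i. i < n \<Longrightarrow> 0 < m i" "\<And>i. i < n \<Longrightarrow> 0 < m' i" and t: "0 \<le> t"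
    and rho: "\<rho> = U * real_diag n l * cadj U" "U' * real_diag n l' * cadj U' = (1/2) \<cdot>\<^sub>m (\<rho> + D * \<rho> * cadj D)"
    and sig: "\<sigma> = V * real_diag n m * cadj V" "V' * real_diag n m' * cadj V' = (1/2) \<cdot>\<^sub>m (\<sigma> + D * \<sigma> * cadj D)"
  shows "chi t n U' l' V' m' \<le> chi t n U l V m"
proof -
  obtain Y where Y: "Y \<in> carrier_mat n n" and eq:
    "quad t Y (U' * real_diag n l' * cadj U') (V' * real_diag n m' * cadj V') = chi t n U' l' V' m'"
    using quad_attains_chi[where l = l' and m = m', OF U' V' l(2) m(2) t] by blast
  note as = assoc_mult_mat[of _ n n _ n _ n] and mc = mult_carrier_mat[of _ n n _ n]
  have conj: "D * (W * real_diag n k * cadj W) * cadj D = (D * W) * real_diag n k * cadj (D * W)"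
    and unit: "cadj (D * W) * (D * W) = cadj W * W"
    and mixed: "cadj (D * W) * (D * W') = cadj W * W'"
    if "W \<in> carrier_mat n n" "W' \<in> carrier_mat n n" for W W' :: "complex mat" and k
  proof -
    show "D * (W * real_diag n k * cadj W) * cadj D = (D * W) * real_diag n k * cadj (D * W)"
      using that D(1) by (subst mult_mat_assoc5) (auto simp: cadj_mult[of _ n n _ n])
    have m: "cadj (D * W) * (D * W') = cadj W * W'" if "W' \<in> carrier_mat n n" for W'
    proof -
      have "cadj D * (D * W') = W'" using as[of "cadj D" D W'] D that by simp
      thus ?thesis using \<open>W \<in> carrier_mat n n\<close> that D(1) by (simp add: cadj_mult[of _ n n _ n] as mc)
    qed
    show "cadj (D * W) * (D * W) = cadj W * W" "cadj (D * W) * (D * W') = cadj W * W'"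
      using m that by blast+
  qed
  have c: "\<rho> \<in> carrier_mat n n" "\<sigma> \<in> carrier_mat n n" "D * \<rho> * cadj D \<in> carrier_mat n n"
      "D * \<sigma> * cadj D \<in> carrier_mat n n"
    using U V D(1) unfolding rho(1) sig(1) by auto
  have "chi t n U' l' V' m' = (quad t Y \<rho> \<sigma> + quad t Y (D * \<rho> * cadj D) (D * \<sigma> * cadj D)) / 2"
    unfolding eq[symmetric] rho(2) sig(2) by (rule quad_midpoint[OF Y c(1,3,2,4)])
  also have "\<dots> \<le> (chi t n U l V m + chi t n U l V m) / 2"
  proof -
    have "quad t Y \<rho> \<sigma> \<le> chi t n U l V m"
      unfolding rho(1) sig(1) by (rule quad_le_chi) (use U V l m t Y in auto)
    moreover have "quad t Y (D * \<rho> * cadj D) (D * \<sigma> * cadj D) \<le> chi t n (D * U) l (D * V) m"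
      unfolding rho(1) sig(1) conj[OF U(1) U(1)] conj[OF V(1) V(1)]
      by (rule quad_le_chi) (use U V D l m t Y unit in auto)
    moreover have "chi t n (D * U) l (D * V) m = chi t n U l V m"
      unfolding chi_def mixed[OF V(1) U(1)] ..
    ultimately show ?thesis by simp
  qed
  finally show ?thesis by simp
qed

section \<open>Relative entropy in spectral coordinates\<close>

lemma unitary_sum_row:
  assumes "W \<in> carrier_mat n n" "cadj W * W = 1\<^sub>m n"
  shows "i < n \<Longrightarrow> (\<Sum>j<n. (cmod (W $$ (j,i)))\<^sup>2) = 1"
    and "i < n \<Longrightarrow> (\<Sum>j<n. (cmod (W $$ (i,j)))\<^sup>2) = 1"
proof -
  have col: "(\<Sum>j<n. (cmod (W $$ (j,i)))\<^sup>2) = 1"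
    if W: "W \<in> carrier_mat n n" "cadj W * W = 1\<^sub>m n" and i: "i < n" for W
  proof -
    have "complex_of_real (\<Sum>j<n. (cmod (W $$ (j,i)))\<^sup>2) = (\<Sum>j<n. cadj W $$ (i,j) * W $$ (j,i))"
      unfolding of_real_sum
      by (rule sum.cong[OF refl], subst cadj_index)
         (use W i in \<open>auto simp only: complex_norm_square mult.commute index_mult_mat lessThan_iff carrier_matD\<close>)
    also have "\<dots> = (cadj W * W) $$ (i,i)"
      by (rule mult_mat_index_sum[symmetric, of _ n n _ n]) (use W i in auto)
    finally show ?thesis using W i by (simp flip: of_real_sum)
  qed
  show "i < n \<Longrightarrow> (\<Sum>j<n. (cmod (W $$ (j,i)))\<^sup>2) = 1" using col assms by blast
  show "(\<Sum>j<n. (cmod (W $$ (i,j)))\<^sup>2) = 1" if "i < n"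
    using col[of "cadj W", OF _ _ that] assms unitary_comm[OF assms] that by simp
qed

lemma spectral_diagonal_entry:
  assumes U: "U \<in> carrier_mat n n" and V: "V \<in> carrier_mat n n" and j: "j < n"
  shows "Re ((cadj V * (U * real_diag n l * cadj U) * V) $$ (j,j))
    = (\<Sum>i<n. (cmod ((cadj V * U) $$ (j,i)))\<^sup>2 * l i)"
proof -
  define Om where "Om = cadj V * U"
  have Om: "Om \<in> carrier_mat n n" using U V by (auto simp: Om_def)
  have cOm: "cadj Om = cadj U * V" unfolding Om_def using U V by (subst cadj_mult[of _ n n _ n]) auto
  have "cadj V * (U * real_diag n l * cadj U) * V = (Om * real_diag n l) * cadj Om"
    unfolding cOm unfolding Om_def by (rule mult_mat_assoc5) (use U V in auto)
  hence "(cadj V * (U * real_diag n l * cadj U) * V) $$ (j,j)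
      = (\<Sum>i<n. (Om * real_diag n l) $$ (j,i) * cadj Om $$ (i,j))"
    by (simp only:) (rule mult_mat_index_sum, use Om j in auto)
  also have "\<dots> = (\<Sum>i<n. of_real ((cmod (Om $$ (j,i)))\<^sup>2 * l i))"
    by (rule sum.cong[OF refl], unfold of_real_mult complex_norm_square)
       (use Om j in \<open>simp add: mat_diag_mult_right[of _ n n]\<close>)
  finally show ?thesis unfolding Om_def by (simp flip: of_real_sum)
qed

text \<open>The squared overlaps are doubly stochastic, so they sum out of every term depending on
  one index. The mixed term collects the diagonal of \<rho> in the eigenbasis \<open>V\<close>, that
  is, the trace of \<rho> against the logarithm of the second state.\<close>

lemma spectral_relative_entropy:
  assumes U: "U \<in> carrier_mat n n" "cadj U * U = 1\<^sub>m n"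
    and V: "V \<in> carrier_mat n n" "cadj V * V = 1\<^sub>m n"
    and rho: "\<rho> = U * real_diag n l * cadj U"
  shows "(\<Sum>i<n. \<Sum>j<n. (cmod ((cadj V * U) $$ (j,i)))\<^sup>2 * (l i * ln (l i) - l i * ln (m j) - l i + m j))
    = (\<Sum>i<n. l i * ln (l i)) - (\<Sum>j<n. ln (m j) * Re ((cadj V * \<rho> * V) $$ (j,j)))
      - Re (mtrace \<rho>) + (\<Sum>j<n. m j)"
proof -
  define w where "w i j = (cmod ((cadj V * U) $$ (j,i)))\<^sup>2" for i j
  have Om: "cadj V * U \<in> carrier_mat n n" using U V by auto
  have VV: "V * (cadj V * U) = U" using assoc_mult_mat[of V n n "cadj V" n U n] unitary_comm[OF V] U V by simp
  have "cadj (cadj V * U) * (cadj V * U) = cadj U * (V * (cadj V * U))"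
    using U V by (simp add: cadj_mult[of _ n n _ n] assoc_mult_mat[of _ n n _ n _ n] mult_carrier_mat[of _ n n _ n])
  hence uOm: "cadj (cadj V * U) * (cadj V * U) = 1\<^sub>m n" using VV U by simp
  note s = unitary_sum_row[OF Om uOm, folded w_def]
  have tr: "mtrace \<rho> = of_real (\<Sum>i<n. l i)"
    unfolding rho by (subst mtrace_unitary_conj[OF U]) (auto simp: mtrace_def mat_diag_def)
  have "(\<Sum>i<n. \<Sum>j<n. w i j * (l i * ln (l i) - l i * ln (m j) - l i + m j))
    = (\<Sum>i<n. \<Sum>j<n. w i j * (l i * ln (l i))) - (\<Sum>i<n. \<Sum>j<n. w i j * (l i * ln (m j)))
      - (\<Sum>i<n. \<Sum>j<n. w i j * l i) + (\<Sum>i<n. \<Sum>j<n. w i j * m j)"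
    by (simp add: sum.distrib sum_subtractf algebra_simps)
  also have "(\<Sum>i<n. \<Sum>j<n. w i j * (l i * ln (l i))) = (\<Sum>i<n. l i * ln (l i))"
    by (simp add: s(1) flip: sum_distrib_right)
  also have "(\<Sum>i<n. \<Sum>j<n. w i j * l i) = (\<Sum>i<n. l i)"
    by (simp add: s(1) flip: sum_distrib_right)
  also have "(\<Sum>i<n. \<Sum>j<n. w i j * m j) = (\<Sum>j<n. m j)"
    by (subst sum.swap) (simp add: s(2) flip: sum_distrib_right)
  also have "(\<Sum>i<n. \<Sum>j<n. w i j * (l i * ln (m j))) = (\<Sum>j<n. ln (m j) * (\<Sum>i<n. w i j * l i))"
    by (subst sum.swap) (simp add: sum_distrib_left mult_ac)
  also have "\<dots> = (\<Sum>j<n. ln (m j) * Re ((cadj V * \<rho> * V) $$ (j,j)))"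
    unfolding rho w_def by (rule sum.cong[OF refl], subst spectral_diagonal_entry) (use U V in auto)
  finally show ?thesis unfolding tr w_def by simp
qed

lemma eta_ln: "0 \<le> x \<Longrightarrow> ln 2 * eta x = - (x * ln x)"
  by (auto simp: eta_def log_def)

text \<open>Relative entropy does not increase when both states are averaged with their conjugates
  by \<open>D\<close>; this is that inequality with the entropies on one side. The Gram forms of
  \<rho> and \<rho>' supply nonnegative spectra.\<close>

lemma pinching_entropy_bound:
  assumes M: "M \<in> carrier_mat k n" and N: "N \<in> carrier_mat k' n"
    and V: "V \<in> carrier_mat n n" "cadj V * V = 1\<^sub>m n"
    and V': "V' \<in> carrier_mat n n" "cadj V' * V' = 1\<^sub>m n"
    and D: "D \<in> carrier_mat n n" "cadj D * D = 1\<^sub>m n"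
    and m: "\<And>i. i < n \<Longrightarrow> 0 < m i" "\<And>i. i < n \<Longrightarrow> 0 < m' i"
    and rho: "\<rho> = cadj M * M" "\<rho>' = cadj N * N" "\<rho>' = (1/2) \<cdot>\<^sub>m (\<rho> + D * \<rho> * cadj D)"
    and sig: "\<sigma> = V * real_diag n m * cadj V" "V' * real_diag n m' * cadj V' = (1/2) \<cdot>\<^sub>m (\<sigma> + D * \<sigma> * cadj D)"
  shows "(\<Sum>j<n. ln (m j) * Re ((cadj V * \<rho> * V) $$ (j,j))) - (\<Sum>j<n. ln (m' j) * Re ((cadj V' * \<rho>' * V') $$ (j,j)))
    \<le> ln 2 * (vn_entropy \<rho>' - vn_entropy \<rho>)"
proof -
  obtain U l where U: "U \<in> carrier_mat n n" "cadj U * U = 1\<^sub>m n" and l: "\<And>i. i < n \<Longrightarrow> 0 \<le> l i"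
    and Ul: "\<rho> = U * real_diag n l * cadj U"
    using gram_spectral[OF M] rho(1) by metis
  obtain U' l' where U': "U' \<in> carrier_mat n n" "cadj U' * U' = 1\<^sub>m n" and l': "\<And>i. i < n \<Longrightarrow> 0 \<le> l' i"
    and Ul': "\<rho>' = U' * real_diag n l' * cadj U'"
    using gram_spectral[OF N] rho(2) by metis
  \<comment> \<open>The averaging preserves traces, so the linear terms \<open>- l + m\<close> agree
    on both sides and cancel.\<close>
  have tr: "mtrace ((1/2) \<cdot>\<^sub>m (\<tau> + D * \<tau> * cadj D)) = mtrace \<tau>" if "\<tau> \<in> carrier_mat n n" for \<tau>
  proof -
    have c: "D * \<tau> * cadj D \<in> carrier_mat n n" using D that by auto
    show ?thesis
      using that c mtrace_unitary_conj[OF D that]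
      by (subst mtrace_smult[of _ n]) (auto simp: mtrace_add[OF that c])
  qed
  have "mtrace \<rho>' = mtrace \<rho>" unfolding rho(3) by (rule tr) (use M rho in auto)
  moreover have "mtrace (V' * real_diag n m' * cadj V') = mtrace \<sigma>"
    unfolding sig(2) by (rule tr) (use V sig in auto)
  hence "of_real (\<Sum>j<n. m' j) = (of_real (\<Sum>j<n. m j) :: complex)"
    unfolding sig(1) mtrace_unitary_conj[OF V mat_diag_dim] mtrace_unitary_conj[OF V' mat_diag_dim]
    by (simp add: mtrace_def mat_diag_def)
  hence "(\<Sum>j<n. m' j) = (\<Sum>j<n. m j)" by (simp only: of_real_eq_iff)
  moreover have "(\<Sum>i<n. \<Sum>j<n. (cmod ((cadj V' * U') $$ (j,i)))\<^sup>2 * (l' i * ln (l' i) - l' i * ln (m' j) - l' i + m' j))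
    \<le> (\<Sum>i<n. \<Sum>j<n. (cmod ((cadj V * U) $$ (j,i)))\<^sup>2 * (l i * ln (l i) - l i * ln (m j) - l i + m j))"
    unfolding sum.cartesian_product split_def
  proof (rule relative_entropy_mono)
    fix t :: real assume t: "0 \<le> t"
    have "chi t n U' l' V' m' \<le> chi t n U l V m"
      by (rule chi_midpoint_le[OF U V U' V' D _ _ _ _ t Ul _ sig]) (use l l' m rho Ul' in auto)
    thus "(\<Sum>i\<in>{..<n} \<times> {..<n}. (cmod ((cadj V' * U') $$ (snd i, fst i)))\<^sup>2 *
          ((l' (fst i) - m' (snd i))\<^sup>2 / (m' (snd i) + t * l' (fst i))))
        \<le> (\<Sum>i\<in>{..<n} \<times> {..<n}. (cmod ((cadj V * U) $$ (snd i, fst i)))\<^sup>2 *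
          ((l (fst i) - m (snd i))\<^sup>2 / (m (snd i) + t * l (fst i))))"
      unfolding chi_def sum.cartesian_product split_def .
  qed (use l l' m in auto)
  moreover have "ln 2 * vn_entropy \<rho> = - (\<Sum>i<n. l i * ln (l i))"
    using l by (simp add: vn_entropy_unitary_diag[OF U Ul] sum_distrib_left eta_ln sum_negf)
  moreover have "ln 2 * vn_entropy \<rho>' = - (\<Sum>i<n. l' i * ln (l' i))"
    using l' by (simp add: vn_entropy_unitary_diag[OF U' Ul'] sum_distrib_left eta_ln sum_negf)
  ultimately show ?thesis
    unfolding spectral_relative_entropy[OF U V Ul] spectral_relative_entropy[OF U' V' Ul']
    by (simp add: algebra_simps)
qed

section \<open>Choi matrices\<close>

text \<open>The \<open>(a,b)\<close> entry of
  \<open>w 0 * sigma_z + w 1 * sigma_x + w 2 * sigma_y\<close>.\<close>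

definition pauli_dot :: "(nat \<Rightarrow> complex) \<Rightarrow> nat \<Rightarrow> nat \<Rightarrow> complex" where
  "pauli_dot w a b = (if a = 0 \<and> b = 0 then w 0 else if a = 0 then w 1 - \<i> * w 2
     else if b = 0 then w 1 + \<i> * w 2 else - w 0)"

text \<open>The \<open>(a,b)\<close> entry of the image of the matrix unit \<open>|i><j|\<close>
  under the linear extension of the Stokes map. Off the diagonal, \<open>|0><1|\<close> is half of
  \<open>sigma_x + \<i> * sigma_y\<close>, which explains the sign of \<open>\<i>\<close>.\<close>

definition out_entry :: "real mat \<Rightarrow> real vec \<Rightarrow> nat \<Rightarrow> nat \<Rightarrow> nat \<Rightarrow> nat \<Rightarrow> complex" where
  "out_entry R t i j a b =
    (if i = j
     then ((if a = b then 1 else 0)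
        + pauli_dot (\<lambda>k. of_real (t $ k + (if i = 0 then 1 else - 1) * R $$ (k,0))) a b) / 2
     else pauli_dot (\<lambda>k. of_real (R $$ (k,1)) + (if i = 0 then \<i> else - \<i>) * of_real (R $$ (k,2))) a b / 2)"

text \<open>Index \<open>2 * i + a\<close> stands for input basis state \<open>i\<close> and output basis state \<open>a\<close>. With
  \<open>M\<close> the matrix whose rows are the vectorised Kraus operators divided by \<open>\<surd>2\<close>, this is
  \<open>M\<^sup>* M\<close>, whereas the environment state is \<open>M M\<^sup>*\<close>; hence the complex conjugation.\<close>

definition choi :: "real mat \<Rightarrow> real vec \<Rightarrow> complex mat" where
  "choi R t = mat 4 4 (\<lambda>(m,n). cnj (out_entry R t (m div 2) (n div 2) (m mod 2) (n mod 2)) / 2)"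

definition block_diag :: "complex mat \<Rightarrow> complex mat" where
  "block_diag G = mat 4 4 (\<lambda>(m,n). if m div 2 = n div 2 then G $$ (m,n) else 0)"

lemma less_2_cases_nat: "(i :: nat) < 2 \<longleftrightarrow> i = 0 \<or> i = 1" by auto

lemma less_4_cases_nat: "(i :: nat) < 4 \<longleftrightarrow> i = 0 \<or> i = 1 \<or> i = 2 \<or> i = 3" by auto

lemma sum_less_2: "(\<Sum>i<2. f i) = f 0 + f (1 :: nat)"
  by (simp add: numeral_2_eq_2)

lemma sum_less_4: "(\<Sum>i<4. f i) = f 0 + f 1 + f 2 + f (3 :: nat)"
proof -
  have "{..<4} = {0,1,2,3 :: nat}" by auto
  thus ?thesis by (simp add: add.assoc)
qed

section \<open>Kraus operators in Pauli coordinates\<close>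

lemma triple_mult_index_2:
  fixes A B C :: "complex mat"
  assumes "A \<in> carrier_mat 2 2" "B \<in> carrier_mat 2 2" "C \<in> carrier_mat 2 2" "a < 2" "b < 2"
  shows "(A * B * C) $$ (a,b) = (\<Sum>i<2. \<Sum>j<2. A $$ (a,i) * B $$ (i,j) * C $$ (j,b))"
proof -
  have "(A * B * C) $$ (a,b) = (\<Sum>j<2. (A * B) $$ (a,j) * C $$ (j,b))"
    by (rule mult_mat_index_sum) (use assms in auto)
  also have "\<dots> = (\<Sum>j<2. (\<Sum>i<2. A $$ (a,i) * B $$ (i,j)) * C $$ (j,b))"
    by (rule sum.cong[OF refl], subst mult_mat_index_sum[of _ 2 2 _ 2]) (use assms in auto)
  finally show ?thesis by (simp add: sum_less_2 algebra_simps)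
qed

lemma kraus_apply_carrier:
  assumes "set Ks \<subseteq> carrier_mat 2 2" "\<rho> \<in> carrier_mat 2 2"
  shows "kraus_apply Ks \<rho> \<in> carrier_mat 2 2"
  using assms by (induction Ks) (auto simp: kraus_apply_def)

lemma kraus_apply_index:
  assumes "set Ks \<subseteq> carrier_mat 2 2" "\<rho> \<in> carrier_mat 2 2" "a < 2" "b < 2"
  shows "kraus_apply Ks \<rho> $$ (a,b)
    = (\<Sum>i<2. \<Sum>j<2. \<rho> $$ (i,j) * (\<Sum>K\<leftarrow>Ks. K $$ (a,i) * cnj (K $$ (b,j))))"
  using assms
proof (induction Ks)
  case Nil thus ?case by (simp add: kraus_apply_def)
next
  case (Cons K Ks)
  have K: "K \<in> carrier_mat 2 2" using Cons by auto
  have c: "kraus_apply Ks \<rho> \<in> carrier_mat 2 2" using Cons kraus_apply_carrier by auto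
  have "kraus_apply (K # Ks) \<rho> $$ (a,b) = (K * \<rho> * cadj K + kraus_apply Ks \<rho>) $$ (a,b)"
    by (simp add: kraus_apply_def)
  also have "\<dots> = (K * \<rho> * cadj K) $$ (a,b) + kraus_apply Ks \<rho> $$ (a,b)"
    using c Cons.prems by (subst index_add_mat) auto
  also have "(K * \<rho> * cadj K) $$ (a,b) = (\<Sum>i<2. \<Sum>j<2. \<rho> $$ (i,j) * (K $$ (a,i) * cnj (K $$ (b,j))))"
    by (subst triple_mult_index_2) (use K Cons.prems in \<open>auto simp: sum_less_2 mult_ac\<close>)
  finally show ?case using Cons by (simp add: sum_less_2 algebra_simps)
qed

lemma kraus_tp_carrier:
  assumes "set Ks \<subseteq> carrier_mat 2 2"
  shows "kraus_tp Ks \<in> carrier_mat 2 2"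
  using assms by (induction Ks) (auto simp: kraus_tp_def)

lemma mtrace_mult_pauli:
  assumes "\<rho> \<in> carrier_mat 2 2"
  shows "mtrace (\<rho> * pauli 0) = \<rho> $$ (0,0) - \<rho> $$ (1,1)"
    "mtrace (\<rho> * pauli 1) = \<rho> $$ (0,1) + \<rho> $$ (1,0)"
    "mtrace (\<rho> * pauli 2) = \<i> * \<rho> $$ (0,1) - \<i> * \<rho> $$ (1,0)"
proof -
  have c: "pauli k \<in> carrier_mat 2 2" for k
    by (auto simp: pauli_def sigma_z_def sigma_x_def sigma_y_def mat_of_rows_list_def)
  show "mtrace (\<rho> * pauli 0) = \<rho> $$ (0,0) - \<rho> $$ (1,1)"
    "mtrace (\<rho> * pauli 1) = \<rho> $$ (0,1) + \<rho> $$ (1,0)"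
    "mtrace (\<rho> * pauli 2) = \<i> * \<rho> $$ (0,1) - \<i> * \<rho> $$ (1,0)"
    unfolding mtrace_mult[OF assms c]
    by (simp_all add: sum_less_2 pauli_def sigma_z_def sigma_x_def sigma_y_def mat_of_rows_list_def)
qed

lemma stokes_map_carrier: "stokes_map R t \<rho> \<in> carrier_mat 2 2"
  unfolding stokes_map_def Let_def
  by (intro smult_carrier_mat add_carrier_mat) (auto simp: sigma_y_def mat_of_rows_list_def)

lemma stokes_map_index:
  assumes "R \<in> carrier_mat 3 3" "t \<in> carrier_vec 3" "\<rho> \<in> carrier_mat 2 2" "a < 2" "b < 2"
  shows "stokes_map R t \<rho> $$ (a,b) = ((if a = b then 1 else 0)
    + pauli_dot (\<lambda>k. of_real (t $ k + R $$ (k,0) * Re (\<rho> $$ (0,0) - \<rho> $$ (1,1))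
        + R $$ (k,1) * Re (\<rho> $$ (0,1) + \<rho> $$ (1,0))
        + R $$ (k,2) * Im (\<rho> $$ (1,0) - \<rho> $$ (0,1)))) a b) / 2"
proof -
  define r where "r = R *\<^sub>v bloch \<rho> + t"
  have r: "r $ k = t $ k + R $$ (k,0) * Re (\<rho> $$ (0,0) - \<rho> $$ (1,1))
        + R $$ (k,1) * Re (\<rho> $$ (0,1) + \<rho> $$ (1,0))
        + R $$ (k,2) * Im (\<rho> $$ (1,0) - \<rho> $$ (0,1))" if "k < 3" for k
  proof -
    have "(R *\<^sub>v bloch \<rho>) $ k = (\<Sum>j<3. R $$ (k,j) * Re (mtrace (\<rho> * pauli j)))"
      using assms that by (auto simp: scalar_prod_def bloch_def lessThan_atLeast0 intro!: sum.cong)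
    also have "\<dots> = R $$ (k,0) * Re (mtrace (\<rho> * pauli 0)) + R $$ (k,1) * Re (mtrace (\<rho> * pauli 1))
        + R $$ (k,2) * Re (mtrace (\<rho> * pauli 2))"
      by (simp add: numeral_3_eq_3 numeral_2_eq_2)
    finally show ?thesis using assms that unfolding r_def mtrace_mult_pauli[OF assms(3)] by simp
  qed
  show ?thesis
    using assms(4,5) r[of 0] r[of 1] r[of 2]
    unfolding less_2_cases_nat
    by (auto simp: stokes_map_def Let_def r_def[symmetric] pauli_dot_def sigma_z_def sigma_x_def
        sigma_y_def mat_of_rows_list_def)
qed

lemma density_pure:
  assumes w: "(cmod (w 0))\<^sup>2 + (cmod (w 1))\<^sup>2 = 1"
  shows "density (mat 2 2 (\<lambda>(i,j). w i * cnj (w j)))"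
proof -
  let ?\<rho> = "mat 2 2 (\<lambda>(i,j). w i * cnj (w j))"
  have "cadj ?\<rho> = ?\<rho>" by (rule eq_matI) auto
  moreover have "mtrace ?\<rho> = of_real ((cmod (w 0))\<^sup>2 + (cmod (w 1))\<^sup>2)"
    unfolding of_real_add complex_norm_square by (simp add: mtrace_def sum_less_2)
  moreover have "0 \<le> Re (\<Sum>i<2. cnj (v $ i) * (?\<rho> *\<^sub>v v) $ i)" if v: "v \<in> carrier_vec 2" for v
  proof -
    have mv: "(?\<rho> *\<^sub>v v) $ i = (\<Sum>j<2. w i * cnj (w j) * v $ j)" if "i < 2" for i
      using that v by (auto simp: scalar_prod_def lessThan_atLeast0 intro!: sum.cong)
    have lt: "(0 :: nat) < 2" "(1 :: nat) < 2" by auto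
    have "(\<Sum>i<2. cnj (v $ i) * (?\<rho> *\<^sub>v v) $ i)
        = (\<Sum>j<2. cnj (w j) * v $ j) * cnj (\<Sum>j<2. cnj (w j) * v $ j)"
      unfolding sum_less_2 mv[OF lt(1)] mv[OF lt(2)]
      by (simp add: algebra_simps)
    thus ?thesis by (simp only: complex_norm_square[symmetric]) simp
  qed
  ultimately show ?thesis unfolding density_def w by auto
qed

text \<open>The Kraus identity is given on density matrices only. Evaluation at the four pure states
  with amplitudes \<open>(1,0)\<close>, \<open>(0,1)\<close>, \<open>(h,h)\<close> and
  \<open>(h, \<i> h)\<close>, where \<open>h = 1 / sqrt 2\<close>, and polarisation recover the
  action on every matrix unit.\<close>

lemma kraus_correlation:
  assumes R: "R \<in> carrier_mat 3 3" and t: "t \<in> carrier_vec 3" and K: "is_kraus_rep R t Ks"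
    and ab: "a < 2" "b < 2" and ij: "i < 2" "j < 2"
  shows "(\<Sum>K\<leftarrow>Ks. K $$ (a,i) * cnj (K $$ (b,j))) = out_entry R t i j a b"
proof -
  define C where "C i j = (\<Sum>K\<leftarrow>Ks. K $$ (a,i) * cnj (K $$ (b,j)))" for i j
  have Ks: "set Ks \<subseteq> carrier_mat 2 2" using K by (auto simp: is_kraus_rep_def)
  let ?d = "if a = b then 1 else 0 :: complex"
  have pure: "w 0 * cnj (w 0) * C 0 0 + w 0 * cnj (w 1) * C 0 1 + w 1 * cnj (w 0) * C 1 0 + w 1 * cnj (w 1) * C 1 1
    = (?d + pauli_dot (\<lambda>k. of_real (t $ k + R $$ (k,0) * Re (w 0 * cnj (w 0) - w 1 * cnj (w 1))
        + R $$ (k,1) * Re (w 0 * cnj (w 1) + w 1 * cnj (w 0))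
        + R $$ (k,2) * Im (w 1 * cnj (w 0) - w 0 * cnj (w 1)))) a b) / 2"
    if "(cmod (w 0))\<^sup>2 + (cmod (w 1))\<^sup>2 = 1" for w :: "nat \<Rightarrow> complex"
  proof -
    let ?\<rho> = "mat 2 2 (\<lambda>(i,j). w i * cnj (w j))"
    have "kraus_apply Ks ?\<rho> $$ (a,b) = stokes_map R t ?\<rho> $$ (a,b)"
      using K density_pure[of w, OF that] by (auto simp: is_kraus_rep_def)
    hence "(\<Sum>i<2. \<Sum>j<2. ?\<rho> $$ (i,j) * C i j) = (?d + pauli_dot (\<lambda>k. of_real (t $ k
        + R $$ (k,0) * Re (?\<rho> $$ (0,0) - ?\<rho> $$ (1,1)) + R $$ (k,1) * Re (?\<rho> $$ (0,1) + ?\<rho> $$ (1,0))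
        + R $$ (k,2) * Im (?\<rho> $$ (1,0) - ?\<rho> $$ (0,1)))) a b) / 2"
      unfolding C_def
      by (subst kraus_apply_index[OF Ks, of ?\<rho> a b, symmetric], use ab in \<open>simp, simp, simp\<close>)
         (subst stokes_map_index[OF R t, of ?\<rho> a b, symmetric], use ab in auto)
    moreover have "?\<rho> $$ (0,0) = w 0 * cnj (w 0)" "?\<rho> $$ (0,1) = w 0 * cnj (w 1)"
      "?\<rho> $$ (1,0) = w 1 * cnj (w 0)" "?\<rho> $$ (1,1) = w 1 * cnj (w 1)" by auto
    ultimately show ?thesis by (simp only: sum_less_2 add.assoc)
  qed
  define h where "h = complex_of_real (1 / sqrt 2)"
  have hh: "h * cnj h = 1/2" "(cmod h)\<^sup>2 = 1/2" "h * h = 1/2"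
    by (simp_all add: h_def norm_divide power_divide flip: of_real_mult)
  have e00: "C 0 0 = (?d + pauli_dot (\<lambda>k. of_real (t $ k + R $$ (k,0))) a b) / 2"
    using pure[of "\<lambda>i. if i = 0 then 1 else 0"] by simp
  have e11: "C 1 1 = (?d + pauli_dot (\<lambda>k. of_real (t $ k - R $$ (k,0))) a b) / 2"
    using pure[of "\<lambda>i. if i = 0 then 0 else 1"] by simp
  have ex: "(C 0 0 + C 0 1 + C 1 0 + C 1 1) / 2 = (?d + pauli_dot (\<lambda>k. of_real (t $ k + R $$ (k,1))) a b) / 2"
    using pure[of "\<lambda>i. h"] by (simp add: hh add_divide_distrib)
  have hi: "h * cnj (\<i> * h) = - \<i> / 2" "\<i> * h * cnj h = \<i> / 2" "\<i> * h * cnj (\<i> * h) = 1/2"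
  proof -
    have "h * cnj (\<i> * h) = - \<i> * (h * cnj h)" "\<i> * h * cnj h = \<i> * (h * cnj h)"
      "\<i> * h * cnj (\<i> * h) = h * cnj h" by (simp_all add: complex_eq_iff)
    thus "h * cnj (\<i> * h) = - \<i> / 2" "\<i> * h * cnj h = \<i> / 2" "\<i> * h * cnj (\<i> * h) = 1/2"
      unfolding hh by simp_all
  qed
  have ey: "(C 0 0 - \<i> * C 0 1 + \<i> * C 1 0 + C 1 1) / 2 = (?d + pauli_dot (\<lambda>k. of_real (t $ k + R $$ (k,2))) a b) / 2"
  proof -
    define w where "w i = (if i = 0 then h else \<i> * h)" for i :: nat
    have w: "w 0 = h" "w 1 = \<i> * h" by (simp_all add: w_def)
    have "(cmod (w 0))\<^sup>2 + (cmod (w 1))\<^sup>2 = 1" unfolding w by (simp add: norm_mult hh)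
    from pure[of w, OF this, unfolded w hh hi] show ?thesis
      by (simp add: add_divide_distrib diff_divide_distrib)
  qed
  define T where "T = pauli_dot (\<lambda>k. of_real (t $ k)) a b"
  define P where "P l = pauli_dot (\<lambda>k. of_real (R $$ (k,l))) a b" for l
  have lin: "pauli_dot (\<lambda>k. of_real (t $ k + R $$ (k,l))) a b = T + P l"
    "pauli_dot (\<lambda>k. of_real (t $ k - R $$ (k,l))) a b = T - P l" for l
    by (auto simp: pauli_dot_def T_def P_def algebra_simps)
  have s: "C 0 0 + C 1 1 = ?d + T" unfolding e00 e11 lin by (simp add: field_simps)
  have half: "x / 2 = y / 2 \<Longrightarrow> x = y" for x y :: complex by simp
  have ex': "C 0 0 + C 0 1 + C 1 0 + C 1 1 = ?d + (T + P 1)"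
    by (rule half[OF ex[unfolded lin]])
  have ey': "C 0 0 - \<i> * C 0 1 + \<i> * C 1 0 + C 1 1 = ?d + (T + P 2)"
    by (rule half[OF ey[unfolded lin]])
  have "C 0 1 + C 1 0 = (C 0 0 + C 0 1 + C 1 0 + C 1 1) - (C 0 0 + C 1 1)" by simp
  hence x: "C 0 1 + C 1 0 = P 1" unfolding ex' s by simp
  have "\<i> * (C 1 0 - C 0 1) = (C 0 0 - \<i> * C 0 1 + \<i> * C 1 0 + C 1 1) - (C 0 0 + C 1 1)"
    by (simp add: right_diff_distrib)
  hence y: "\<i> * (C 1 0 - C 0 1) = P 2" unfolding ey' s by simp
  have y': "\<i> * P 2 = C 0 1 - C 1 0" unfolding y[symmetric] by (simp flip: mult.assoc)
  have "C 0 1 = (P 1 + \<i> * P 2) / 2" "C 1 0 = (P 1 - \<i> * P 2) / 2"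
    unfolding y' x[symmetric] by simp_all
  moreover have "out_entry R t 0 1 a b = (P 1 + \<i> * P 2) / 2" "out_entry R t 1 0 a b = (P 1 - \<i> * P 2) / 2"
    by (auto simp: out_entry_def pauli_dot_def P_def algebra_simps)
  ultimately have "C 0 1 = out_entry R t 0 1 a b" "C 1 0 = out_entry R t 1 0 a b"
    by (simp_all only:)
  moreover have "C 0 0 = out_entry R t 0 0 a b" "C 1 1 = out_entry R t 1 1 a b"
    unfolding e00 e11 by (simp_all add: out_entry_def)
  ultimately have "C i j = out_entry R t i j a b" using ij unfolding less_2_cases_nat by auto
  thus ?thesis unfolding C_def .
qed

section \<open>Vectorised Kraus operators and environment states\<close>

definition kraus_mat :: "complex mat list \<Rightarrow> complex mat" where
  "kraus_mat Ks = mat (length Ks) 4 (\<lambda>(k,m). Ks ! k $$ (m mod 2, m div 2) / of_real (sqrt 2))"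

text \<open>Two copies of the rows of \<open>kraus_mat\<close>, the first restricted to input 0 and
  the second to input 1. With \<open>N\<close> this matrix, \<open>N * cadj N\<close> is the joint
  state of the classical input and the environment, and \<open>cadj N * N\<close> is the pinched
  Choi matrix.\<close>

definition kraus_block :: "complex mat list \<Rightarrow> complex mat" where
  "kraus_block Ks = (let n = length Ks in mat (n + n) 4 (\<lambda>(k,m).
     if k < n then (if m < 2 then kraus_mat Ks $$ (k,m) else 0)
     else (if m < 2 then 0 else kraus_mat Ks $$ (k - n,m))))"

lemma kraus_mat_carrier [simp]: "kraus_mat Ks \<in> carrier_mat (length Ks) 4"
  by (simp add: kraus_mat_def)

lemma kraus_block_carrier [simp]: "kraus_block Ks \<in> carrier_mat (length Ks + length Ks) 4"
  by (simp add: kraus_block_def Let_def)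

lemma cadj_mult_self_index:
  assumes "M \<in> carrier_mat k n" "i < n" "j < n"
  shows "(cadj M * M) $$ (i,j) = (\<Sum>l<k. cnj (M $$ (l,i)) * M $$ (l,j))"
  by (subst mult_mat_index_sum[of _ n k _ n]) (use assms in auto)

lemma mult_cadj_self_index:
  assumes "M \<in> carrier_mat k n" "i < k" "j < k"
  shows "(M * cadj M) $$ (i,j) = (\<Sum>l<n. M $$ (i,l) * cnj (M $$ (j,l)))"
  by (subst mult_mat_index_sum[of _ k n _ k]) (use assms in auto)

lemma kraus_mat_gram:
  assumes R: "R \<in> carrier_mat 3 3" and t: "t \<in> carrier_vec 3" and K: "is_kraus_rep R t Ks"
  shows "cadj (kraus_mat Ks) * kraus_mat Ks = choi R t"
proof (rule eq_matI)
  fix i j assume "i < dim_row (choi R t)" "j < dim_col (choi R t)"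
  hence ij: "i < 4" "j < 4" by (auto simp: choi_def)
  have r: "complex_of_real (sqrt 2) * complex_of_real (sqrt 2) = 2"
    by (simp flip: of_real_mult)
  have "(cadj (kraus_mat Ks) * kraus_mat Ks) $$ (i,j)
      = (\<Sum>l<length Ks. cnj (kraus_mat Ks $$ (l,i)) * kraus_mat Ks $$ (l,j))"
    by (rule cadj_mult_self_index) (use ij in auto)
  also have "\<dots> = cnj (\<Sum>l<length Ks. Ks ! l $$ (i mod 2, i div 2) * cnj (Ks ! l $$ (j mod 2, j div 2))) / 2"
    unfolding cnj_sum sum_divide_distrib
    by (rule sum.cong) (use ij in \<open>auto simp: kraus_mat_def r\<close>)
  also have "(\<Sum>l<length Ks. Ks ! l $$ (i mod 2, i div 2) * cnj (Ks ! l $$ (j mod 2, j div 2)))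
      = (\<Sum>K\<leftarrow>Ks. K $$ (i mod 2, i div 2) * cnj (K $$ (j mod 2, j div 2)))"
    by (simp add: sum_list_sum_nth lessThan_atLeast0)
  also have "\<dots> = out_entry R t (i div 2) (j div 2) (i mod 2) (j mod 2)"
    by (rule kraus_correlation[OF R t K]) (use ij in auto)
  finally show "(cadj (kraus_mat Ks) * kraus_mat Ks) $$ (i,j) = choi R t $$ (i,j)"
    using ij by (simp add: choi_def)
qed (auto simp: choi_def kraus_mat_def)

lemma sum_lessThan_add_split:
  fixes f :: "nat \<Rightarrow> complex"
  shows "(\<Sum>l<a + b. f l) = (\<Sum>l<a. f l) + (\<Sum>l<b. f (a + l))"
  by (induction b) (simp_all add: add.assoc)

lemma kraus_block_gram:
  "cadj (kraus_block Ks) * kraus_block Ks = block_diag (cadj (kraus_mat Ks) * kraus_mat Ks)"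
proof (rule eq_matI)
  let ?G = "cadj (kraus_mat Ks) * kraus_mat Ks" and ?n = "length Ks"
  fix i j assume "i < dim_row (block_diag ?G)" "j < dim_col (block_diag ?G)"
  hence ij: "i < 4" "j < 4" by (auto simp: block_diag_def)
  have d: "i div 2 = j div 2 \<longleftrightarrow> (i < 2 \<longleftrightarrow> j < 2)"
    using ij unfolding less_4_cases_nat by auto
  have "(cadj (kraus_block Ks) * kraus_block Ks) $$ (i,j)
      = (\<Sum>l<?n + ?n. cnj (kraus_block Ks $$ (l,i)) * kraus_block Ks $$ (l,j))"
    by (rule cadj_mult_self_index) (use ij in auto)
  also have "\<dots> = (\<Sum>l<?n. cnj (kraus_block Ks $$ (l,i)) * kraus_block Ks $$ (l,j))
      + (\<Sum>l<?n. cnj (kraus_block Ks $$ (?n + l,i)) * kraus_block Ks $$ (?n + l,j))"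
    by (rule sum_lessThan_add_split)
  also have "\<dots> = (if i < 2 \<longleftrightarrow> j < 2 then (\<Sum>l<?n. cnj (kraus_mat Ks $$ (l,i)) * kraus_mat Ks $$ (l,j)) else 0)"
    using ij by (auto simp: kraus_block_def Let_def)
  also have "(\<Sum>l<?n. cnj (kraus_mat Ks $$ (l,i)) * kraus_mat Ks $$ (l,j)) = ?G $$ (i,j)"
    by (rule cadj_mult_self_index[symmetric]) (use ij in auto)
  finally show "(cadj (kraus_block Ks) * kraus_block Ks) $$ (i,j) = block_diag ?G $$ (i,j)"
    using ij by (simp add: block_diag_def d)
qed (auto simp: block_diag_def kraus_block_def Let_def)

lemma mtrace_zproj:
  assumes "K \<in> carrier_mat 2 2" "L \<in> carrier_mat 2 2" "x < 2"
  shows "mtrace (K * zproj x * cadj L) = K $$ (0,x) * cnj (L $$ (0,x)) + K $$ (1,x) * cnj (L $$ (1,x))"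
proof -
  have z: "zproj x \<in> carrier_mat 2 2" by (simp add: zproj_def)
  have e: "(K * zproj x * cadj L) $$ (a,a) = K $$ (a,x) * cnj (L $$ (a,x))" if "a < 2" for a
    by (subst triple_mult_index_2)
       (use assms z that in \<open>auto simp: sum_less_2 zproj_def less_2_cases_nat\<close>)
  have "dim_row (K * zproj x * cadj L) = 2" using assms by auto
  thus ?thesis unfolding mtrace_def using e[of 0] e[of 1] by (simp only: sum_less_2)
qed

text \<open>The environment states are Gram matrices of the form \<open>M * cadj M\<close>. By
  \<open>vn_entropy_mult_swap\<close> they have the entropy of the \<open>4 \<times> 4\<close>
  matrices \<open>cadj M * M\<close>, which depend on \<open>R\<close> and \<open>t\<close> alone
  and no longer on the chosen Kraus operators.\<close>

lemma H_XE_choi: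
  assumes ch: "is_channel R t"
  obtains Ks where "cadj (kraus_mat Ks) * kraus_mat Ks = choi R t"
    "cadj (kraus_block Ks) * kraus_block Ks = block_diag (choi R t)"
    "H_XE R t = vn_entropy (block_diag (choi R t)) - vn_entropy (choi R t)"
proof -
  define Ks where "Ks = kraus_of R t"
  have R: "R \<in> carrier_mat 3 3" and t: "t \<in> carrier_vec 3" using ch by (auto simp: is_channel_def)
  have K: "is_kraus_rep R t Ks"
    using ch unfolding is_channel_def Ks_def kraus_of_def by (auto intro: someI_ex)
  have Kc: "Ks ! k \<in> carrier_mat 2 2" if "k < length Ks" for k
    using K that unfolding is_kraus_rep_def by (meson nth_mem subset_iff)
  let ?n = "length Ks" and ?M = "kraus_mat Ks" and ?N = "kraus_block Ks"
  have gM: "cadj ?M * ?M = choi R t" by (rule kraus_mat_gram[OF R t K])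
  have gN: "cadj ?N * ?N = block_diag (choi R t)" unfolding kraus_block_gram gM ..
  define A where "A x = (1/2) \<cdot>\<^sub>m compl_channel R t (zproj x)" for x
  have Ac: "A x \<in> carrier_mat ?n ?n" for x
    by (simp add: A_def compl_channel_def Let_def Ks_def[symmetric])
  have Ae: "A x $$ (k,l) = (Ks ! k $$ (0,x) * cnj (Ks ! l $$ (0,x)) + Ks ! k $$ (1,x) * cnj (Ks ! l $$ (1,x))) / 2"
    if "k < ?n" "l < ?n" "x < 2" for k l x
    using that mtrace_zproj[OF Kc[OF that(1)] Kc[OF that(2)] that(3)]
    by (simp add: A_def compl_channel_def Let_def Ks_def[symmetric])
  have r: "complex_of_real (sqrt 2) * complex_of_real (sqrt 2) = 2"
    by (simp flip: of_real_mult)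
  have MM: "?M * cadj ?M = A 0 + A 1"
  proof (rule eq_matI)
    fix k l assume "k < dim_row (A 0 + A 1)" "l < dim_col (A 0 + A 1)"
    hence kl: "k < ?n" "l < ?n" using Ac[of 1] by auto
    show "(?M * cadj ?M) $$ (k,l) = (A 0 + A 1) $$ (k,l)"
      using kl Ac[of 0] Ac[of 1] Ae[OF kl, of 0] Ae[OF kl, of 1]
      by (subst mult_cadj_self_index[of _ ?n 4])
         (auto simp: sum_less_4 kraus_mat_def r add_divide_distrib)
  qed (use Ac[of 1] in \<open>auto simp: kraus_mat_def\<close>)
  have NN: "?N * cadj ?N = four_block_mat (A 0) (0\<^sub>m ?n ?n) (0\<^sub>m ?n ?n) (A 1)" (is "_ = ?B")
  proof (rule eq_matI)
    fix k l assume "k < dim_row ?B" "l < dim_col ?B"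
    hence kl: "k < ?n + ?n" "l < ?n + ?n" using Ac[of 0] Ac[of 1] by auto
    have "(?N * cadj ?N) $$ (k,l) = (\<Sum>m<4. ?N $$ (k,m) * cnj (?N $$ (l,m)))"
      by (rule mult_cadj_self_index) (use kl in auto)
    also have "\<dots> = ?B $$ (k,l)"
      using kl Ac[of 0] Ac[of 1] Ae[of k l 0] Ae[of "k - ?n" "l - ?n" 1]
      by (auto simp: sum_less_4 kraus_block_def kraus_mat_def Let_def r add_divide_distrib)
    finally show "(?N * cadj ?N) $$ (k,l) = ?B $$ (k,l)" .
  qed (use Ac[of 0] Ac[of 1] in \<open>auto simp: kraus_block_def Let_def\<close>)
  have "H_XE R t = vn_entropy (?N * cadj ?N) - vn_entropy (?M * cadj ?M)"
    unfolding NN MM by (simp add: H_XE_def Let_def Ks_def[symmetric] A_def)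
  also have "\<dots> = vn_entropy (cadj ?N * ?N) - vn_entropy (cadj ?M * ?M)"
    using vn_entropy_mult_swap[of ?N "?n + ?n" 4 "cadj ?N"] vn_entropy_mult_swap[of ?M ?n 4 "cadj ?M"]
    by simp
  finally show ?thesis using that gM gN by simp
qed

section \<open>Binary entropy\<close>

lemma eta_mult:
  assumes "0 \<le> x" "0 \<le> y"
  shows "eta (x * y) = x * eta y + y * eta x"
proof (cases "x = 0 \<or> y = 0")
  case False
  hence "0 < x" "0 < y" using assms by auto
  thus ?thesis by (auto simp: eta_def log_mult algebra_simps mult_le_0_iff)
qed (auto simp: eta_def)

lemma eta_one_half [simp]: "eta (1/2) = 1/2"
  by (simp add: eta_def log_divide)

lemma eta_half: "0 \<le> x \<Longrightarrow> eta (x / 2) = (x + eta x) / 2"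
  using eta_mult[of x "1/2"] by simp

lemma bin_entropy_eta: "bin_entropy ((1 + x) / 2) = eta ((1 + x) / 2) + eta ((1 - x) / 2)"
proof -
  have "1 - (1 + x) / 2 = (1 - x) / 2" by (simp add: field_simps)
  thus ?thesis unfolding bin_entropy_def by (simp only:)
qed

lemma bin_entropy_even: "bin_entropy ((1 - x) / 2) = bin_entropy ((1 + x) / 2)"
  using bin_entropy_eta[of x] bin_entropy_eta[of "- x"] by simp

lemma bin_entropy_ln:
  assumes "\<bar>x\<bar> \<le> 1"
  shows "ln 2 * bin_entropy ((1 + x) / 2)
    = - ((1 + x) / 2 * ln ((1 + x) / 2)) - (1 - x) / 2 * ln ((1 - x) / 2)"
  unfolding bin_entropy_eta distrib_left
  using assms by (subst (1 2) eta_ln) auto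

lemma eta_halves:
  assumes "\<bar>x\<bar> \<le> 1"
  shows "2 * eta ((1 + x) / 4) + 2 * eta ((1 - x) / 4) = 1 + bin_entropy ((1 + x) / 2)"
proof -
  have "eta ((1 + x) / 4) = ((1 + x) / 2 + eta ((1 + x) / 2)) / 2"
    "eta ((1 - x) / 4) = ((1 - x) / 2 + eta ((1 - x) / 2)) / 2"
    using assms eta_half[of "(1 + x) / 2"] eta_half[of "(1 - x) / 2"] by auto
  thus ?thesis unfolding bin_entropy_eta by (simp add: field_simps)
qed

text \<open>This is \<open>ln y \<le> y - 1\<close> at \<open>y = p / u\<close>, strict unless
  \<open>y = 1\<close>. Summed over a distribution, the corrections \<open>p - u\<close> cancel and
  Gibbs' inequality results.\<close>

lemma gibbs_term:
  fixes u p :: real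
  assumes "0 \<le> u" "0 < p"
  shows "u * ln p \<le> u * ln u + (p - u)" and "u \<noteq> p \<Longrightarrow> u * ln p < u * ln u + (p - u)"
proof -
  have *: "u * ln p \<le> u * ln u + (p - u) \<and> (u \<noteq> p \<longrightarrow> u * ln p < u * ln u + (p - u))"
  proof (cases "u = 0")
    case False
    hence u: "0 < u" using assms by simp
    have l: "ln (p / u) = ln p - ln u" using u assms by (simp add: ln_div)
    have 1: "ln (p / u) \<le> p / u - 1" using u assms by (intro ln_le_minus_one) auto
    have 2: "ln (p / u) \<noteq> p / u - 1" if "u \<noteq> p"
      using ln_eq_minus_one[of "p / u"] u assms that by auto
    have e: "u * ln p - u * ln u - (p - u) = u * (ln (p / u) - (p / u - 1))"
      unfolding l using u by (simp add: field_simps)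
    have "u * (ln (p / u) - (p / u - 1)) \<le> 0" using u 1 by (simp add: mult_le_0_iff)
    moreover have "u * (ln (p / u) - (p / u - 1)) < 0" if "u \<noteq> p"
      using u 1 2[OF that] by (simp add: mult_less_0_iff)
    ultimately show ?thesis using e by force
  qed (use assms in auto)
  show "u * ln p \<le> u * ln u + (p - u)" and "u \<noteq> p \<Longrightarrow> u * ln p < u * ln u + (p - u)"
    using * by blast+
qed

text \<open>Gibbs' inequality bounds the entropy at \<open>u\<close> strictly by the cross entropy
  of \<open>u\<close> relative to \<open>p\<close>. That exceeds the entropy at \<open>p\<close> by
  \<open>- (u - p) * (ln p - ln (1 - p))\<close>, which is at most 0 for
  \<open>1/2 \<le> p < u\<close>. Evenness reduces negative \<open>a\<close> to this case.\<close>

lemma bin_entropy_strict_decreasing: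
  assumes "\<bar>a\<bar> < x" "x \<le> 1"
  shows "bin_entropy ((1 + x) / 2) < bin_entropy ((1 + a) / 2)"
proof -
  have main: "bin_entropy ((1 + x) / 2) < bin_entropy ((1 + a) / 2)" if a: "0 \<le> a" "a < x" for a
  proof -
    define u where "u = (1 + x) / 2"
    define p where "p = (1 + a) / 2"
    have v: "(1 - x) / 2 = 1 - u" "(1 - a) / 2 = 1 - p" by (simp_all add: u_def p_def field_simps)
    have up: "p < u" "u \<le> 1" "1 / 2 \<le> p" using a assms by (auto simp: u_def p_def)
    have "u * ln p < u * ln u + (p - u)"
      using up by (intro gibbs_term(2)) auto
    moreover have "(1 - u) * ln (1 - p) \<le> (1 - u) * ln (1 - u) + ((1 - p) - (1 - u))"
      using up by (intro gibbs_term(1)) auto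
    moreover have "0 \<le> (u - p) * (ln p - ln (1 - p))"
      using up by (intro mult_nonneg_nonneg) auto
    ultimately have "- (u * ln u) - (1 - u) * ln (1 - u) < - (p * ln p) - (1 - p) * ln (1 - p)"
      by (simp add: algebra_simps)
    hence "ln 2 * bin_entropy ((1 + x) / 2) < ln 2 * bin_entropy ((1 + a) / 2)"
      using a assms by (subst (1 2) bin_entropy_ln) (auto simp: v simp flip: u_def p_def)
    thus ?thesis by simp
  qed
  show ?thesis
  proof (cases "0 \<le> a")
    case False
    thus ?thesis using main[of "- a"] assms bin_entropy_even[of a] by simp
  qed (use main assms in auto)
qed

lemma bin_entropy_decreasing:
  assumes "\<bar>a\<bar> \<le> x" "x \<le> 1"
  shows "bin_entropy ((1 + x) / 2) \<le> bin_entropy ((1 + a) / 2)"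
proof (cases "\<bar>a\<bar> = x")
  case True
  hence "a = x \<or> a = - x" by auto
  thus ?thesis using bin_entropy_even[of x] by auto
qed (use bin_entropy_strict_decreasing[of a x] assms in auto)

section \<open>The minimising channel\<close>

text \<open>The minimiser of the key rate when the \<open>z\<close>-\<open>x\<close> block is
  \<open>V diag(dz, dx) U\<close> with \<open>U\<close>, \<open>V\<close> the rotations by \<open>\<alpha>\<close>, \<open>\<beta>\<close>: here \<open>p = \<alpha> + \<beta>\<close> and \<open>q = \<beta> - \<alpha>\<close>.
  The entry \<open>dz * dx\<close> makes the Choi spectrum the product of the distributions
  \<open>(1 \<plusminus> dz) / 2\<close> and \<open>(1 \<plusminus> dx) / 2\<close>, which maximises its entropy.\<close>

definition opt_R :: "real \<Rightarrow> real \<Rightarrow> real \<Rightarrow> real \<Rightarrow> real mat" where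
  "opt_R dz dx p q = (let s = (dz + dx) / 2; d = (dz - dx) / 2 in
     mat 3 3 (\<lambda>(i,j).
       [[s * cos p + d * cos q, d * sin q - s * sin p, 0],
        [s * sin p + d * sin q, s * cos p - d * cos q, 0],
        [0, 0, dz * dx]] ! i ! j))"

text \<open>The columns are the vectorised rotations by \<open>p / 2\<close> and \<open>p / 2 + \<pi> / 2\<close> and the reflections
  with parameters \<open>q / 2\<close> and \<open>q / 2 + \<pi> / 2\<close>; they are the Kraus operators of the minimiser.\<close>

definition bell_entry :: "real \<Rightarrow> real \<Rightarrow> nat \<Rightarrow> nat \<Rightarrow> real" where
  "bell_entry p q m j =
     (let c = cos (p/2); s = sin (p/2); c' = cos (q/2); s' = sin (q/2) in
       [[c, - s, c', - s'], [s, c, s', c'], [- s, - c, s', c'], [c, - s, - c', s']] ! m ! j)"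

definition bell :: "real \<Rightarrow> real \<Rightarrow> complex mat" where
  "bell p q = mat 4 4 (\<lambda>(m,j). of_real (bell_entry p q m j / sqrt 2))"

text \<open>In the order of the columns of \<open>bell\<close>: the first two weights differ by
  \<open>(dz + dx) / 2\<close> and the last two by \<open>(dz - dx) / 2\<close>, the coefficients of
  the rotation and the reflection part in \<open>opt_R\<close>.\<close>

definition bell_weight :: "real \<Rightarrow> real \<Rightarrow> nat \<Rightarrow> real" where
  "bell_weight dz dx j =
     [(1 + dz) * (1 + dx), (1 - dz) * (1 - dx), (1 + dz) * (1 - dx), (1 - dz) * (1 + dx)] ! j / 4"

section \<open>The eigenbasis of the minimiser's Choi state\<close>

lemma half_angle:
  fixes p :: real
  shows "cos (p/2) * cos (p/2) = (1 + cos p) / 2" "sin (p/2) * sin (p/2) = (1 - cos p) / 2"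
    "sin (p/2) * cos (p/2) = sin p / 2" "cos (p/2) * sin (p/2) = sin p / 2"
  using cos_double_cos[of "p/2"] cos_double_sin[of "p/2"] sin_double[of "p/2"]
  by (simp_all add: power2_eq_square)

lemma nth_Cons_2_3 [simp]: "(x # xs) ! 2 = xs ! 1" "(x # xs) ! 3 = xs ! 2"
  by (simp_all add: numeral_2_eq_2 numeral_3_eq_3)

lemma bell_carrier [simp]: "bell p q \<in> carrier_mat 4 4" by (simp add: bell_def)

lemma bell_unitary: "cadj (bell p q) * bell p q = 1\<^sub>m 4"
proof (rule eq_matI)
  fix i j assume "i < dim_row (1\<^sub>m 4 :: complex mat)" "j < dim_col (1\<^sub>m 4 :: complex mat)"
  hence ij: "i < 4" "j < 4" by auto
  have e: "(\<Sum>m<4. bell_entry p q m i * bell_entry p q m j) = (if i = j then 2 else 0)"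
    using ij unfolding less_4_cases_nat
    by (elim disjE; simp add: bell_entry_def Let_def sum_less_4 half_angle; simp add: field_simps)
  have "(cadj (bell p q) * bell p q) $$ (i,j) = (\<Sum>m<4. cnj (bell p q $$ (m,i)) * bell p q $$ (m,j))"
    by (rule cadj_mult_self_index) (use ij in auto)
  also have "\<dots> = of_real ((\<Sum>m<4. bell_entry p q m i * bell_entry p q m j) / 2)"
    unfolding sum_divide_distrib of_real_sum
    by (rule sum.cong) (use ij in \<open>auto simp: bell_def simp flip: of_real_mult\<close>)
  finally show "(cadj (bell p q) * bell p q) $$ (i,j) = 1\<^sub>m 4 $$ (i,j)"
    unfolding e using ij by auto
qed (auto simp: bell_def)

lemma opt_R_index:
  "opt_R dz dx p q $$ (0,0) = (dz + dx) / 2 * cos p + (dz - dx) / 2 * cos q"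
  "opt_R dz dx p q $$ (0,1) = (dz - dx) / 2 * sin q - (dz + dx) / 2 * sin p"
  "opt_R dz dx p q $$ (1,0) = (dz + dx) / 2 * sin p + (dz - dx) / 2 * sin q"
  "opt_R dz dx p q $$ (1,1) = (dz + dx) / 2 * cos p - (dz - dx) / 2 * cos q"
  "opt_R dz dx p q $$ (2,0) = 0" "opt_R dz dx p q $$ (2,1) = 0"
  "opt_R dz dx p q $$ (0,2) = 0" "opt_R dz dx p q $$ (1,2) = 0" "opt_R dz dx p q $$ (2,2) = dz * dx"
  by (simp_all add: opt_R_def Let_def)

lemma opt_R_carrier [simp]: "opt_R dz dx p q \<in> carrier_mat 3 3"
  by (simp add: opt_R_def Let_def)

lemma out_entry_opt_R:
  assumes "i < 2" "j < 2" "a < 2" "b < 2"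
  shows "out_entry (opt_R dz dx p q) (0\<^sub>v 3) i j a b
    = of_real (\<Sum>l<4. bell_entry p q (2 * i + a) l * bell_entry p q (2 * j + b) l * bell_weight dz dx l)"
  using assms unfolding less_2_cases_nat
  by (elim disjE; simp add: out_entry_def pauli_dot_def opt_R_index[unfolded One_nat_def] bell_entry_def Let_def sum_less_4
      bell_weight_def half_angle complex_eq_iff; simp add: field_simps)

lemma unitary_diag_index:
  assumes W: "W \<in> carrier_mat n n" and ij: "i < n" "j < n"
  shows "(W * real_diag n l * cadj W) $$ (i,j) = (\<Sum>k<n. W $$ (i,k) * of_real (l k) * cnj (W $$ (j,k)))"
proof -
  have "(W * real_diag n l * cadj W) $$ (i,j) = (\<Sum>k<n. (W * real_diag n l) $$ (i,k) * cadj W $$ (k,j))"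
    by (rule mult_mat_index_sum) (use W ij in auto)
  also have "\<dots> = (\<Sum>k<n. W $$ (i,k) * of_real (l k) * cnj (W $$ (j,k)))"
    by (rule sum.cong) (use W ij in \<open>auto simp: mat_diag_mult_right[of _ n n]\<close>)
  finally show ?thesis .
qed

lemma quadratic_form_index:
  assumes V: "V \<in> carrier_mat n n" and A: "A \<in> carrier_mat n n" and j: "j < n"
  shows "(cadj V * A * V) $$ (j,j) = (\<Sum>b<n. \<Sum>a<n. cnj (V $$ (a,j)) * A $$ (a,b) * V $$ (b,j))"
proof -
  have "(cadj V * A * V) $$ (j,j) = (\<Sum>b<n. (cadj V * A) $$ (j,b) * V $$ (b,j))"
    by (rule mult_mat_index_sum) (use V A j in auto)
  also have "\<dots> = (\<Sum>b<n. (\<Sum>a<n. cnj (V $$ (a,j)) * A $$ (a,b)) * V $$ (b,j))"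
    by (rule sum.cong[OF refl], subst mult_mat_index_sum[of _ n n _ n]) (use V A j in auto)
  finally show ?thesis by (simp add: sum_distrib_right)
qed

lemma choi_carrier [simp]: "choi R t \<in> carrier_mat 4 4" by (simp add: choi_def)

lemma choi_opt_R:
  "choi (opt_R dz dx p q) (0\<^sub>v 3) = bell p q * real_diag 4 (bell_weight dz dx) * cadj (bell p q)" (is "?L = ?R")
proof (rule eq_matI)
  fix m n assume "m < dim_row ?R" "n < dim_col ?R"
  hence mn: "m < 4" "n < 4" by (auto simp: bell_def)
  have "?R $$ (m,n) = (\<Sum>l<4. bell p q $$ (m,l) * of_real (bell_weight dz dx l) * cnj (bell p q $$ (n,l)))"
    by (rule unitary_diag_index) (use mn in auto)
  also have "\<dots> = of_real ((\<Sum>l<4. bell_entry p q m l * bell_entry p q n l * bell_weight dz dx l) / 2)"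
    unfolding sum_divide_distrib of_real_sum
    by (rule sum.cong) (use mn in \<open>auto simp: bell_def simp flip: of_real_mult\<close>)
  finally show "?L $$ (m,n) = ?R $$ (m,n)"
    using mn out_entry_opt_R[of "m div 2" "n div 2" "m mod 2" "n mod 2" dz dx p q]
    by (simp add: choi_def less_mult_imp_div_less)
qed (auto simp: choi_def bell_def)

text \<open>For an arbitrary channel, the diagonal in this basis sees only the
  \<open>z\<close>-\<open>x\<close> block and \<open>R $$ (2,2)\<close>. This is why the comparison
  with the minimiser yields a bound in terms of the observed parameters.\<close>

lemma choi_bell_diagonal:
  assumes "j < 4"
  shows "Re ((cadj (bell p q) * choi R t * bell p q) $$ (j,j)) =
    [1 + R $$ (2,2) + (cos p * (R $$ (0,0) + R $$ (1,1)) + sin p * (R $$ (1,0) - R $$ (0,1))),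
     1 + R $$ (2,2) - (cos p * (R $$ (0,0) + R $$ (1,1)) + sin p * (R $$ (1,0) - R $$ (0,1))),
     1 - R $$ (2,2) + (cos q * (R $$ (0,0) - R $$ (1,1)) + sin q * (R $$ (1,0) + R $$ (0,1))),
     1 - R $$ (2,2) - (cos q * (R $$ (0,0) - R $$ (1,1)) + sin q * (R $$ (1,0) + R $$ (0,1)))] ! j / 4"
proof -
  have "(cadj (bell p q) * choi R t * bell p q) $$ (j,j)
      = (\<Sum>b<4. \<Sum>a<4. cnj (bell p q $$ (a,j)) * choi R t $$ (a,b) * bell p q $$ (b,j))"
    by (rule quadratic_form_index) (use assms in auto)
  also have "\<dots> = (\<Sum>b<4. \<Sum>a<4. of_real (bell_entry p q a j * bell_entry p q b j / 2) * choi R t $$ (a,b))"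
    by (intro sum.cong refl) (use assms in \<open>auto simp: bell_def simp flip: of_real_mult\<close>)
  finally have "Re ((cadj (bell p q) * choi R t * bell p q) $$ (j,j))
      = (\<Sum>b<4. \<Sum>a<4. bell_entry p q a j * bell_entry p q b j / 2 * Re (choi R t $$ (a,b)))"
    by simp
  also have "\<dots> = [1 + R $$ (2,2) + (cos p * (R $$ (0,0) + R $$ (1,1)) + sin p * (R $$ (1,0) - R $$ (0,1))),
     1 + R $$ (2,2) - (cos p * (R $$ (0,0) + R $$ (1,1)) + sin p * (R $$ (1,0) - R $$ (0,1))),
     1 - R $$ (2,2) + (cos q * (R $$ (0,0) - R $$ (1,1)) + sin q * (R $$ (1,0) + R $$ (0,1))),
     1 - R $$ (2,2) - (cos q * (R $$ (0,0) - R $$ (1,1)) + sin q * (R $$ (1,0) + R $$ (0,1)))] ! j / 4"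
    using assms unfolding less_4_cases_nat
    by (elim disjE; simp add: sum_less_4 choi_def out_entry_def pauli_dot_def bell_entry_def Let_def half_angle;
        simp add: field_simps)
  finally show ?thesis .
qed

section \<open>Pinching the Choi state of the minimiser\<close>

abbreviation phase_flip :: "complex mat" where
  "phase_flip \<equiv> real_diag 4 (\<lambda>i. if i < 2 then 1 else - 1)"

text \<open>Conjugation by the sign flip on input 1 negates exactly the off-diagonal blocks, so
  averaging removes them. This is the form that \<open>pinching_entropy_bound\<close> takes as
  input.\<close>

lemma block_diag_pinching:
  assumes G: "G \<in> carrier_mat 4 4"
  shows "block_diag G = (1/2) \<cdot>\<^sub>m (G + phase_flip * G * cadj phase_flip)"
proof (rule eq_matI)
  let ?R = "(1/2) \<cdot>\<^sub>m (G + phase_flip * G * cadj phase_flip)"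
  have c: "phase_flip * G \<in> carrier_mat 4 4" using G by (intro mult_carrier_mat[of _ 4 4 _ 4]) auto
  fix m n assume "m < dim_row ?R" "n < dim_col ?R"
  hence mn: "m < 4" "n < 4" by (auto simp: mat_diag_def)
  have d: "m div 2 = n div 2 \<longleftrightarrow> (m < 2 \<longleftrightarrow> n < 2)"
    using mn unfolding less_4_cases_nat by auto
  have "(phase_flip * G * cadj phase_flip) $$ (m,n)
      = of_real (if m < 2 then 1 else - 1) * G $$ (m,n) * of_real (if n < 2 then 1 else - 1)"
    unfolding cadj_real_diag mat_diag_mult_right[OF c] unfolding mat_diag_mult_left[OF G] using mn by simp
  thus "block_diag G $$ (m,n) = ?R $$ (m,n)"
    using mn G d by (simp add: block_diag_def mat_diag_def)
qed (use G in \<open>auto simp: block_diag_def mat_diag_def\<close>)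

lemma phase_flip_unitary: "cadj phase_flip * phase_flip = 1\<^sub>m 4"
  unfolding cadj_real_diag mat_diag_diag by (rule eq_matI) (auto simp: mat_diag_def)

text \<open>The spectrum of the pinched minimiser. The order is reversed in the second half because
  the Bloch vectors of the two outputs are opposite.\<close>

definition block_weight :: "real \<Rightarrow> nat \<Rightarrow> real" where
  "block_weight a k = [1 + a, 1 - a, 1 - a, 1 + a] ! k / 4"

text \<open>The two blocks have Bloch vectors of length \<open>\<bar>l\<bar>\<close> along a common
  axis at angle \<theta> in the \<open>z\<close>-\<open>x\<close> plane, so the rotation by
  \<open>\<theta>/2\<close> diagonalises both.\<close>

lemma block_diag_choi_opt_R:
  assumes "opt_R dz dx p q $$ (1,0) = l * sin \<theta>" "opt_R dz dx p q $$ (0,0) = l * cos \<theta>"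
  shows "\<exists>W. W \<in> carrier_mat 4 4 \<and> cadj W * W = 1\<^sub>m 4 \<and>
    block_diag (choi (opt_R dz dx p q) (0\<^sub>v 3)) = W * real_diag 4 (block_weight l) * cadj W"
proof -
  define c where "c = cos (\<theta>/2)"
  define s where "s = sin (\<theta>/2)"
  define w where "w m j = [[c, - s, 0, 0], [s, c, 0, 0], [0, 0, c, - s], [0, 0, s, c]] ! m ! j" for m j
  define W where "W = mat 4 4 (\<lambda>(m,j). complex_of_real (w m j))"
  note ha = half_angle[of \<theta>, folded c_def s_def]
  have W: "W \<in> carrier_mat 4 4" by (simp add: W_def)
  have "cadj W * W = 1\<^sub>m 4"
  proof (rule eq_matI)
    fix i j assume "i < dim_row (1\<^sub>m 4 :: complex mat)" "j < dim_col (1\<^sub>m 4 :: complex mat)"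
    hence ij: "i < 4" "j < 4" by auto
    have e: "(\<Sum>m<4. w m i * w m j) = (if i = j then 1 else 0)"
      using ij unfolding less_4_cases_nat
      by (elim disjE; simp add: w_def sum_less_4 ha; simp add: field_simps)
    have "(cadj W * W) $$ (i,j) = (\<Sum>m<4. cnj (W $$ (m,i)) * W $$ (m,j))"
      by (rule cadj_mult_self_index) (use ij W in auto)
    also have "\<dots> = of_real (\<Sum>m<4. w m i * w m j)"
      unfolding of_real_sum by (rule sum.cong) (use ij in \<open>auto simp: W_def\<close>)
    finally show "(cadj W * W) $$ (i,j) = 1\<^sub>m 4 $$ (i,j)"
      unfolding e using ij by auto
  qed (use W in auto)
  moreover have "block_diag (choi (opt_R dz dx p q) (0\<^sub>v 3)) = W * real_diag 4 (block_weight l) * cadj W" (is "?L = ?R")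
  proof (rule eq_matI)
    fix m n assume "m < dim_row ?R" "n < dim_col ?R"
    hence mn: "m < 4" "n < 4" using W by auto
    have "?R $$ (m,n) = (\<Sum>k<4. W $$ (m,k) * of_real (block_weight l k) * cnj (W $$ (n,k)))"
      by (rule unitary_diag_index[OF W mn])
    also have "\<dots> = of_real (\<Sum>k<4. w m k * w n k * block_weight l k)"
      unfolding of_real_sum by (rule sum.cong) (use mn in \<open>auto simp: W_def\<close>)
    also have "\<dots> = ?L $$ (m,n)"
      using mn assms unfolding less_4_cases_nat
      by (elim disjE; simp add: block_diag_def choi_def out_entry_def pauli_dot_def w_def sum_less_4
          opt_R_index(5) block_weight_def ha complex_eq_iff; simp add: field_simps)
    finally show "?L $$ (m,n) = ?R $$ (m,n)" ..
  qed (use W in \<open>auto simp: block_diag_def\<close>)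
  ultimately show ?thesis using W by blast
qed

lemma block_diag_choi_opt_R_diagonal:
  assumes "opt_R dz dx p q $$ (1,0) = 0"
  shows "block_diag (choi (opt_R dz dx p q) (0\<^sub>v 3))
    = real_diag 4 (block_weight (opt_R dz dx p q $$ (0,0)))" (is "?L = ?R")
proof (rule eq_matI)
  fix m n assume "m < dim_row ?R" "n < dim_col ?R"
  hence mn: "m < 4" "n < 4" by (auto simp: mat_diag_def)
  show "?L $$ (m,n) = ?R $$ (m,n)"
    using mn assms unfolding less_4_cases_nat
    by (elim disjE; simp add: block_diag_def choi_def out_entry_def pauli_dot_def
        opt_R_index(5) block_weight_def mat_diag_def)
qed (auto simp: block_diag_def mat_diag_def)

text \<open>The column is \<open>s\<close> times a unit vector plus \<open>d\<close> times another,
  and \<open>\<bar>s\<bar> + \<bar>d\<bar>\<close> is the larger of \<open>\<bar>dz\<bar>\<close>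
  and \<open>\<bar>dx\<bar>\<close>.\<close>

lemma opt_R_contraction:
  assumes "\<bar>dz\<bar> \<le> k" "\<bar>dx\<bar> \<le> k"
  shows "(opt_R dz dx p q $$ (0,0))\<^sup>2 + (opt_R dz dx p q $$ (1,0))\<^sup>2 \<le> k\<^sup>2"
proof -
  define s where "s = (dz + dx) / 2"
  define d where "d = (dz - dx) / 2"
  have 1: "cos x * cos x + sin x * sin x = 1" for x :: real
    using sin_cos_squared_add2[of x] by (simp add: power2_eq_square)
  have "(s * cp + d * cq)\<^sup>2 + (s * sp + d * sq)\<^sup>2
     = s\<^sup>2 * (cp * cp + sp * sp) + d\<^sup>2 * (cq * cq + sq * sq) + 2 * (s * d) * (cp * cq + sp * sq)"
    for cp cq sp sq :: real by (simp add: power2_eq_square algebra_simps)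
  hence "(s * cos p + d * cos q)\<^sup>2 + (s * sin p + d * sin q)\<^sup>2
     = s\<^sup>2 * (cos p * cos p + sin p * sin p) + d\<^sup>2 * (cos q * cos q + sin q * sin q)
       + 2 * (s * d) * (cos p * cos q + sin p * sin q)" .
  also have "\<dots> = s\<^sup>2 + d\<^sup>2 + 2 * (s * d) * cos (p - q)"
    unfolding 1 cos_diff by (simp only: mult_1_right)
  also have "\<dots> \<le> s\<^sup>2 + d\<^sup>2 + 2 * \<bar>s * d\<bar>"
  proof -
    have "s * d * cos (p - q) \<le> \<bar>s * d\<bar> * \<bar>cos (p - q)\<bar>" using abs_ge_self[of "s * d * cos (p - q)"] by (simp add: abs_mult)
    also have "\<dots> \<le> \<bar>s * d\<bar> * 1" by (intro mult_left_mono) auto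
    finally show ?thesis by simp
  qed
  also have "\<dots> = (\<bar>s\<bar> + \<bar>d\<bar>)\<^sup>2" by (simp add: power2_sum abs_mult)
  also have "\<dots> \<le> k\<^sup>2"
    using assms by (intro power_mono) (auto simp: s_def d_def abs_if field_simps)
  finally show ?thesis unfolding opt_R_index s_def d_def .
qed

section \<open>Comparison of \<open>H(X|E)\<close> with the minimiser\<close>

lemma bell_weight_nonneg: "\<bar>dz\<bar> \<le> 1 \<Longrightarrow> \<bar>dx\<bar> \<le> 1 \<Longrightarrow> j < 4 \<Longrightarrow> 0 \<le> bell_weight dz dx j"
  unfolding less_4_cases_nat by (auto simp: bell_weight_def)

lemma bell_weight_pos: "\<bar>dz\<bar> < 1 \<Longrightarrow> \<bar>dx\<bar> < 1 \<Longrightarrow> j < 4 \<Longrightarrow> 0 < bell_weight dz dx j"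
  unfolding less_4_cases_nat by (auto simp: bell_weight_def)

lemma block_weight_pos: "\<bar>a\<bar> < 1 \<Longrightarrow> j < 4 \<Longrightarrow> 0 < block_weight a j"
  unfolding less_4_cases_nat by (auto simp: block_weight_def)

text \<open>\<open>pinching_entropy_bound\<close> against the Choi state of the minimiser. The
  strict bounds on \<open>dz\<close> and \<open>dx\<close> make that state positive definite, and
  \<open>R $$ (1,0) = 0\<close> makes its pinching diagonal, so the second eigenbasis is the
  identity.\<close>

lemma H_XE_lower_bound:
  assumes ch: "is_channel R t" and d: "\<bar>dz\<bar> < 1" "\<bar>dx\<bar> < 1" and o: "opt_R dz dx p q $$ (1,0) = 0"
  shows "(\<Sum>j<4. ln (bell_weight dz dx j) * Re ((cadj (bell p q) * choi R t * bell p q) $$ (j,j)))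
    - (\<Sum>j<4. ln (block_weight (opt_R dz dx p q $$ (0,0)) j) * Re (choi R t $$ (j,j)))
    \<le> ln 2 * H_XE R t"
proof -
  obtain Ks where M: "cadj (kraus_mat Ks) * kraus_mat Ks = choi R t"
    and N: "cadj (kraus_block Ks) * kraus_block Ks = block_diag (choi R t)"
    and H: "H_XE R t = vn_entropy (block_diag (choi R t)) - vn_entropy (choi R t)"
    by (rule H_XE_choi[OF ch])
  let ?a = "opt_R dz dx p q $$ (0,0)"
  \<comment> \<open>A contraction factor below 1 keeps the spectrum of the pinched comparison state
    strictly positive.\<close>
  define k where "k = max \<bar>dz\<bar> \<bar>dx\<bar>"
  have k: "0 \<le> k" "k < 1" using d by (auto simp: k_def)
  have "?a\<^sup>2 \<le> k\<^sup>2" using opt_R_contraction[of dz k dx p q] o by (auto simp: k_def)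
  hence a: "\<bar>?a\<bar> < 1" using k abs_le_square_iff[of ?a k] by auto
  have one: "cadj (1\<^sub>m 4) = 1\<^sub>m 4" by (rule eq_matI) auto
  have V': "1\<^sub>m 4 * real_diag 4 (block_weight ?a) * cadj (1\<^sub>m 4) = block_diag (choi (opt_R dz dx p q) (0\<^sub>v 3))"
    unfolding block_diag_choi_opt_R_diagonal[OF o] one
    by (simp only: left_mult_one_mat[OF mat_diag_dim] right_mult_one_mat[OF mat_diag_dim])
  have bd: "block_diag (choi R t) \<in> carrier_mat 4 4" by (simp add: block_diag_def)
  have "(\<Sum>j<4. ln (bell_weight dz dx j) * Re ((cadj (bell p q) * choi R t * bell p q) $$ (j,j)))
    - (\<Sum>j<4. ln (block_weight ?a j) * Re ((cadj (1\<^sub>m 4) * block_diag (choi R t) * 1\<^sub>m 4) $$ (j,j)))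
    \<le> ln 2 * (vn_entropy (block_diag (choi R t)) - vn_entropy (choi R t))"
    by (rule pinching_entropy_bound[OF kraus_mat_carrier kraus_block_carrier bell_carrier bell_unitary
          one_carrier_mat _ mat_diag_dim phase_flip_unitary bell_weight_pos[OF d] block_weight_pos[OF a]
          M[symmetric] N[symmetric] block_diag_pinching[OF choi_carrier] choi_opt_R
          V'[unfolded block_diag_pinching[OF choi_carrier]]])
       (simp_all add: one)
  moreover have "cadj (1\<^sub>m 4) * block_diag (choi R t) * 1\<^sub>m 4 = block_diag (choi R t)"
    unfolding one using bd by simp
  moreover have "block_diag (choi R t) $$ (j,j) = choi R t $$ (j,j)" if "j < 4" for j
    using that by (simp add: block_diag_def)
  ultimately show ?thesis unfolding H by simp
qed

lemma choi_diagonal: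
  assumes "j < 4"
  shows "Re (choi R t $$ (j,j)) = [1 + (t $ 0 + R $$ (0,0)), 1 - (t $ 0 + R $$ (0,0)),
    1 + (t $ 0 - R $$ (0,0)), 1 - (t $ 0 - R $$ (0,0))] ! j / 4"
  using assms unfolding less_4_cases_nat
  by (elim disjE; simp add: choi_def out_entry_def pauli_dot_def)

text \<open>The comparison with \<open>dz = dx = 0\<close>, where the reference state is maximally
  mixed: all weights are \<open>1/4\<close> and the lower bound is 0.\<close>

lemma H_XE_nonneg:
  assumes "is_channel R t"
  shows "0 \<le> H_XE R t"
proof -
  have "0 \<le> ln 2 * H_XE R t"
    using H_XE_lower_bound[OF assms, of 0 0 0 0]
    by (simp add: sum_less_4 choi_diagonal choi_bell_diagonal bell_weight_def block_weight_def opt_R_index[unfolded One_nat_def])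
       (simp add: field_simps)
  thus ?thesis by (simp add: zero_le_mult_iff)
qed

section \<open>Bounds on the key rate\<close>

lemma gram_diagonal_nonneg:
  assumes V: "V \<in> carrier_mat n n" and M: "M \<in> carrier_mat k n" and j: "j < n"
  shows "0 \<le> Re ((cadj V * (cadj M * M) * V) $$ (j,j))"
proof -
  have c: "cadj M * M \<in> carrier_mat n n" "M * V \<in> carrier_mat k n" using M V by auto
  have "cadj V * (cadj M * M) * V = cadj (M * V) * (M * V)"
    using M V c assoc_mult_mat[of "cadj M" n k M n V n] assoc_mult_mat[of "cadj V" n n "cadj M" k "M * V" n]
      assoc_mult_mat[of "cadj V" n n "cadj M * M" n V n] by (simp add: cadj_mult[of _ k n _ n])
  also have "\<dots> $$ (j,j) = (\<Sum>l<k. cnj ((M * V) $$ (l,j)) * (M * V) $$ (l,j))"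
    by (rule cadj_mult_self_index[OF c(2) j j])
  finally show ?thesis by (simp add: sum_nonneg)
qed

lemma params_opt_R_D:
  assumes "params R t = params (opt_R dz dx p q) (0\<^sub>v 3)"
  shows "R $$ (0,0) = opt_R dz dx p q $$ (0,0)" "R $$ (0,1) = opt_R dz dx p q $$ (0,1)"
    "R $$ (1,0) = opt_R dz dx p q $$ (1,0)" "R $$ (1,1) = opt_R dz dx p q $$ (1,1)"
    "t $ 0 = 0" "t $ 1 = 0"
  using assms by (auto simp: params_def)

text \<open>Once the basis angles match those of the observed block, the trigonometric combinations
  collapse to \<open>dz + dx\<close> and \<open>dz - dx\<close>.\<close>

lemma choi_bell_diagonal_opt:
  assumes S: "params R t = params (opt_R dz dx p q) (0\<^sub>v 3)" and j: "j < 4"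
  shows "Re ((cadj (bell p q) * choi R t * bell p q) $$ (j,j)) =
    [1 + R $$ (2,2) + (dz + dx), 1 + R $$ (2,2) - (dz + dx),
     1 - R $$ (2,2) + (dz - dx), 1 - R $$ (2,2) - (dz - dx)] ! j / 4"
proof -
  have 1: "cos x * (y * cos x) + sin x * (y * sin x) = y" for x y :: real
  proof -
    have "cos x * (y * cos x) + sin x * (y * sin x) = y * ((sin x)\<^sup>2 + (cos x)\<^sup>2)"
      by (simp only: power2_eq_square algebra_simps)
    thus ?thesis by simp
  qed
  have e: "R $$ (0,0) + R $$ (1,1) = (dz + dx) * cos p" "R $$ (1,0) - R $$ (0,1) = (dz + dx) * sin p"
    "R $$ (0,0) - R $$ (1,1) = (dz - dx) * cos q" "R $$ (1,0) + R $$ (0,1) = (dz - dx) * sin q"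
    unfolding params_opt_R_D[OF S] opt_R_index by (simp_all add: field_simps)
  show ?thesis unfolding choi_bell_diagonal[OF j] e 1 ..
qed

text \<open>The four diagonal entries of the Choi matrix in the Bell basis are nonnegative, and
  adding suitable pairs eliminates \<open>R $$ (2,2)\<close>.\<close>

lemma channel_singular_values_le_1:
  assumes ch: "is_channel R t" and S: "params R t = params (opt_R dz dx p q) (0\<^sub>v 3)"
  shows "\<bar>dz\<bar> \<le> 1" "\<bar>dx\<bar> \<le> 1"
proof -
  obtain Ks where M: "cadj (kraus_mat Ks) * kraus_mat Ks = choi R t"
    by (rule H_XE_choi[OF ch])
  have nn: "0 \<le> Re ((cadj (bell p q) * choi R t * bell p q) $$ (j,j))" if "j < 4" for j
    unfolding M[symmetric] by (rule gram_diagonal_nonneg[OF bell_carrier kraus_mat_carrier that])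
  show "\<bar>dz\<bar> \<le> 1" "\<bar>dx\<bar> \<le> 1"
    using nn[of 0] nn[of 1] nn[of 2] nn[of 3] by (simp_all add: choi_bell_diagonal_opt[OF S] abs_le_iff)
qed

section \<open>The Shannon part of the key rate\<close>

lemma P_XY_index:
  assumes "R \<in> carrier_mat 3 3" "t \<in> carrier_vec 3" "x < 2" "y < 2"
  shows "P_XY R t x y = (1 + (if y = 0 then 1 else - 1) * (t $ 0 + (if x = 0 then 1 else - 1) * R $$ (0,0))) / 4"
proof -
  have z: "zproj x \<in> carrier_mat 2 2" by (simp add: zproj_def)
  show ?thesis
    unfolding P_XY_def stokes_map_index[OF assms(1,2) z assms(4,4)] using assms(3,4)
    unfolding less_2_cases_nat by (auto simp: pauli_dot_def zproj_def)
qed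

lemma H_XY_params:
  assumes "is_channel R t" "is_channel R' t'" "params R t = params R' t'"
  shows "H_XY R t = H_XY R' t'"
  using assms by (simp add: H_XY_def P_XY_index is_channel_def params_def)

lemma H_XY_eq:
  assumes "is_channel R t" "t $ 0 = 0" "\<bar>R $$ (0,0)\<bar> \<le> 1"
  shows "H_XY R t = bin_entropy ((1 + R $$ (0,0)) / 2)"
proof -
  have "H_XY R t = 2 * eta ((1 + R $$ (0,0)) / 4) + 2 * eta ((1 - R $$ (0,0)) / 4) - 2 * eta (1/2)"
    using assms by (simp add: H_XY_def P_XY_index is_channel_def sum_less_2 add_divide_distrib[symmetric])
  thus ?thesis unfolding eta_halves[OF assms(3)] by simp
qed

text \<open>\<open>H_XY\<close> is constant on the set and \<open>H_XE\<close> is nonnegative.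
  Boundedness is what allows the real infimum in \<open>min_K\<close> to be compared with individual
  key rates.\<close>

lemma key_rate_bdd_below: "bdd_below ((\<lambda>(R,t). key_rate R t) ` P_ba \<omega>)"
proof (cases "P_ba \<omega> = {}")
  case False
  then obtain R0 t0 where 0: "is_channel R0 t0" "params R0 t0 = \<omega>" by (auto simp: P_ba_def)
  show ?thesis
  proof (rule bdd_belowI[of _ "- H_XY R0 t0"])
    fix x assume "x \<in> (\<lambda>(R,t). key_rate R t) ` P_ba \<omega>"
    then obtain R t where x: "x = key_rate R t" and Rt: "is_channel R t" "params R t = \<omega>"
      by (auto simp: P_ba_def)
    show "- H_XY R0 t0 \<le> x"
      using H_XE_nonneg[OF Rt(1)] H_XY_params[OF Rt(1) 0(1)] Rt(2) 0(2) by (simp add: x key_rate_def)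
  qed
qed simp

text \<open>Shrinking \<open>d\<close> to \<open>k * d\<close> keeps each probability at least
  \<open>k\<close> times its old value, so the cross entropy exceeds the entropy by at most
  \<open>- ln k\<close>.\<close>

lemma scaled_cross_entropy_bound:
  fixes d k :: real
  assumes d: "\<bar>d\<bar> \<le> 1" and k: "0 < k" "k < 1"
  shows "ln k - ln 2 * bin_entropy ((1 + d) / 2)
    \<le> (1 + d) / 2 * ln ((1 + k * d) / 2) + (1 - d) / 2 * ln ((1 - k * d) / 2)"
proof -
  have t: "u * ln k + u * ln u \<le> u * ln v" if "0 \<le> u" "k * u \<le> v" for u v :: real
  proof (cases "u = 0")
    case False
    hence u: "0 < u" using that by simp
    have "ln (k * u) \<le> ln v" using u k that by (intro ln_mono) (auto intro: mult_pos_pos less_le_trans)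
    hence "ln k + ln u \<le> ln v" using u k by (simp add: ln_mult)
    from mult_left_mono[OF this, of u] show ?thesis using u by (simp add: distrib_left)
  qed simp
  have "(1 + d) / 2 * ln k + (1 + d) / 2 * ln ((1 + d) / 2) \<le> (1 + d) / 2 * ln ((1 + k * d) / 2)"
    using d k by (intro t) (auto simp: field_simps)
  moreover have "(1 - d) / 2 * ln k + (1 - d) / 2 * ln ((1 - d) / 2) \<le> (1 - d) / 2 * ln ((1 - k * d) / 2)"
    using d k by (intro t) (auto simp: field_simps)
  moreover have "(1 + d) / 2 * ln k + (1 - d) / 2 * ln k = ln k" by (simp add: field_simps)
  ultimately show ?thesis unfolding bin_entropy_ln[OF d] by linarith
qed

lemma scaled_abs_less_1:
  fixes d k :: real
  assumes "\<bar>d\<bar> \<le> 1" "0 < k" "k < 1"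
  shows "\<bar>k * d\<bar> < 1"
proof -
  have "k * \<bar>d\<bar> \<le> k * 1" using assms by (intro mult_left_mono) auto
  hence "k * \<bar>d\<bar> < 1" using assms by linarith
  thus ?thesis using assms by (simp add: abs_mult)
qed

lemma gibbs_binary:
  fixes a b :: real
  assumes "\<bar>a\<bar> \<le> 1" "\<bar>b\<bar> < 1"
  shows "(1 + a) / 2 * ln ((1 + b) / 2) + (1 - a) / 2 * ln ((1 - b) / 2) \<le> - ln 2 * bin_entropy ((1 + a) / 2)"
proof -
  have "(1 + a) / 2 * ln ((1 + b) / 2) \<le> (1 + a) / 2 * ln ((1 + a) / 2) + ((1 + b) / 2 - (1 + a) / 2)"
    using assms by (intro gibbs_term(1)) auto
  moreover have "(1 - a) / 2 * ln ((1 - b) / 2) \<le> (1 - a) / 2 * ln ((1 - a) / 2) + ((1 - b) / 2 - (1 - a) / 2)"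
    using assms by (intro gibbs_term(1)) auto
  moreover have "((1 + b) / 2 - (1 + a) / 2) + ((1 - b) / 2 - (1 - a) / 2) = 0" by (simp add: field_simps)
  ultimately show ?thesis using bin_entropy_ln[OF assms(1)] by linarith
qed

text \<open>For \<open>\<bar>dz\<bar> = 1\<close> or \<open>\<bar>dx\<bar> = 1\<close> the minimiser has a singular Choi state, so the comparison is made
  with the minimiser for \<open>k * dz\<close>, \<open>k * dx\<close> and then \<open>k\<close> tends to 1.\<close>

lemma key_rate_lower_bound:
  assumes ch: "is_channel R t" and S: "params R t = params (opt_R dz dx p q) (0\<^sub>v 3)"
    and o: "opt_R dz dx p q $$ (1,0) = 0"
  shows "1 - bin_entropy ((1 + dz) / 2) - bin_entropy ((1 + dx) / 2) \<le> key_rate R t"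
proof -
  note d = channel_singular_values_le_1[OF ch S]
  note S' = params_opt_R_D[OF S]
  define a where "a = R $$ (0,0)"
  have a: "\<bar>a\<bar> \<le> 1"
    using opt_R_contraction[OF d, of p q] unfolding o S'(1)[folded a_def, symmetric] by (simp add: abs_square_le_1)
  let ?h = "\<lambda>x. bin_entropy ((1 + x) / 2)"
  have bound: "2 * ln k - ln 2 * ?h dz - ln 2 * ?h dx + ln 2 * (1 + ?h a) \<le> ln 2 * H_XE R t"
    if k: "0 < k" "k < 1" for k
  proof -
    note kd = scaled_abs_less_1[OF d(1) k] scaled_abs_less_1[OF d(2) k] scaled_abs_less_1[OF a k]
    have s: "opt_R (k * dz) (k * dx) p q $$ (1,0) = k * opt_R dz dx p q $$ (1,0)"
      "opt_R (k * dz) (k * dx) p q $$ (0,0) = k * opt_R dz dx p q $$ (0,0)"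
      unfolding opt_R_index by (simp_all add: field_simps)
    hence s0: "opt_R (k * dz) (k * dx) p q $$ (1,0) = 0" "opt_R (k * dz) (k * dx) p q $$ (0,0) = k * a"
      using o S'(1) by (auto simp: a_def)
    let ?lz = "ln ((1 + k * dz) / 2)" and ?lz' = "ln ((1 - k * dz) / 2)"
    let ?lx = "ln ((1 + k * dx) / 2)" and ?lx' = "ln ((1 - k * dx) / 2)"
    let ?la = "ln ((1 + k * a) / 2)" and ?la' = "ln ((1 - k * a) / 2)"
    have pos: "0 < 1 + k * dz" "0 < 1 - k * dz" "0 < 1 + k * dx" "0 < 1 - k * dx" "0 < 1 + k * a" "0 < 1 - k * a"
      using kd by (auto simp: abs_less_iff)
    have prod: "ln (x * y / 4) = ln (x / 2) + ln (y / 2)" if "0 < x" "0 < y" for x y :: real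
      using that ln_mult[of "x / 2" "y / 2"] by simp
    have half: "ln (x / 4) = ln (x / 2) - ln 2" if "0 < x" for x :: real
      using that ln_div[of "x / 2" 2] by simp
    have b: "bell_weight (k * dz) (k * dx) 0 = (1 + k * dz) * (1 + k * dx) / 4"
      "bell_weight (k * dz) (k * dx) 1 = (1 - k * dz) * (1 - k * dx) / 4"
      "bell_weight (k * dz) (k * dx) 2 = (1 + k * dz) * (1 - k * dx) / 4"
      "bell_weight (k * dz) (k * dx) 3 = (1 - k * dz) * (1 + k * dx) / 4"
      by (simp_all add: bell_weight_def)
    have w: "block_weight (k * a) 0 = (1 + k * a) / 4" "block_weight (k * a) 1 = (1 - k * a) / 4"
      "block_weight (k * a) 2 = (1 - k * a) / 4" "block_weight (k * a) 3 = (1 + k * a) / 4"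
      by (simp_all add: block_weight_def)
    define r where "r = R $$ (2,2)"
    have g: "Re ((cadj (bell p q) * choi R t * bell p q) $$ (0,0)) = (1 + r + (dz + dx)) / 4"
      "Re ((cadj (bell p q) * choi R t * bell p q) $$ (1,1)) = (1 + r - (dz + dx)) / 4"
      "Re ((cadj (bell p q) * choi R t * bell p q) $$ (2,2)) = (1 - r + (dz - dx)) / 4"
      "Re ((cadj (bell p q) * choi R t * bell p q) $$ (3,3)) = (1 - r - (dz - dx)) / 4"
      using choi_bell_diagonal_opt[OF S, of 0] choi_bell_diagonal_opt[OF S, of 1]
        choi_bell_diagonal_opt[OF S, of 2] choi_bell_diagonal_opt[OF S, of 3] by (simp_all add: r_def)
    have c: "Re (choi R t $$ (0,0)) = (1 + a) / 4" "Re (choi R t $$ (1,1)) = (1 - a) / 4"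
      "Re (choi R t $$ (2,2)) = (1 - a) / 4" "Re (choi R t $$ (3,3)) = (1 + a) / 4"
      using choi_diagonal[of 0 R t] choi_diagonal[of 1 R t] choi_diagonal[of 2 R t] choi_diagonal[of 3 R t] S'(5)
      by (simp_all add: a_def)
    \<comment> \<open>The logarithms of the product weights are sums over the two factors, so only
      the marginals of the diagonal remain and the unobserved \<open>r\<close> cancels.\<close>
    have alg: "(A + B) * ((1 + r + (dz + dx)) / 4) + (A' + B') * ((1 + r - (dz + dx)) / 4)
        + (A + B') * ((1 - r + (dz - dx)) / 4) + (A' + B) * ((1 - r - (dz - dx)) / 4)
      = ((1 + dz) / 2 * A + (1 - dz) / 2 * A') + ((1 + dx) / 2 * B + (1 - dx) / 2 * B')"
      and alg': "(A - B) * ((1 + a) / 4) + (A' - B) * ((1 - a) / 4)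
        + (A' - B) * ((1 - a) / 4) + (A - B) * ((1 + a) / 4) = ((1 + a) / 2 * A + (1 - a) / 2 * A') - B"
      for A B A' B' :: real by (simp_all add: field_simps)
    have "(\<Sum>j<4. ln (bell_weight (k * dz) (k * dx) j) * Re ((cadj (bell p q) * choi R t * bell p q) $$ (j,j)))
      = (?lz + ?lx) * ((1 + r + (dz + dx)) / 4) + (?lz' + ?lx') * ((1 + r - (dz + dx)) / 4)
        + (?lz + ?lx') * ((1 - r + (dz - dx)) / 4) + (?lz' + ?lx) * ((1 - r - (dz - dx)) / 4)"
      unfolding sum_less_4 b g using pos by (simp only: prod)
    also have "\<dots> = ((1 + dz) / 2 * ?lz + (1 - dz) / 2 * ?lz') + ((1 + dx) / 2 * ?lx + (1 - dx) / 2 * ?lx')"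
      by (rule alg)
    also have "\<dots> \<ge> (ln k - ln 2 * ?h dz) + (ln k - ln 2 * ?h dx)"
      by (intro add_mono scaled_cross_entropy_bound d k)
    finally have 1: "(ln k - ln 2 * ?h dz) + (ln k - ln 2 * ?h dx)
      \<le> (\<Sum>j<4. ln (bell_weight (k * dz) (k * dx) j) * Re ((cadj (bell p q) * choi R t * bell p q) $$ (j,j)))" .
    have "(\<Sum>j<4. ln (block_weight (k * a) j) * Re (choi R t $$ (j,j)))
      = (?la - ln 2) * ((1 + a) / 4) + (?la' - ln 2) * ((1 - a) / 4)
        + (?la' - ln 2) * ((1 - a) / 4) + (?la - ln 2) * ((1 + a) / 4)"
      unfolding sum_less_4 w c using pos by (simp only: half)
    also have "\<dots> = ((1 + a) / 2 * ?la + (1 - a) / 2 * ?la') - ln 2"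
      by (rule alg')
    also have "\<dots> \<le> - ln 2 * ?h a - ln 2"
      by (intro diff_right_mono gibbs_binary a kd)
    finally have 2: "(\<Sum>j<4. ln (block_weight (k * a) j) * Re (choi R t $$ (j,j))) \<le> - ln 2 * ?h a - ln 2" .
    show ?thesis
      using H_XE_lower_bound[OF ch kd(1,2) s0(1)] 1 2 unfolding s0(2) by (simp add: algebra_simps)
  qed
  have "- ln 2 * ?h dz - ln 2 * ?h dx + ln 2 * (1 + ?h a) \<le> ln 2 * H_XE R t"
  proof (rule field_le_epsilon)
    fix e :: real assume "0 < e"
    \<comment> \<open>This choice of \<open>k\<close> makes the loss \<open>2 * ln k\<close> equal
      to \<open>- e\<close>.\<close>
    thus "- ln 2 * ?h dz - ln 2 * ?h dx + ln 2 * (1 + ?h a) \<le> ln 2 * H_XE R t + e"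
      using bound[of "exp (- e / 2)"] by simp
  qed
  hence "ln 2 * (1 + ?h a - ?h dz - ?h dx) \<le> ln 2 * H_XE R t" by (simp add: algebra_simps)
  hence "1 + ?h a - ?h dz - ?h dx \<le> H_XE R t" by simp
  moreover have "H_XY R t = ?h a" using H_XY_eq[OF ch S'(5)] a by (simp add: a_def)
  ultimately show ?thesis by (simp add: key_rate_def)
qed

section \<open>Realising the minimiser as a channel\<close>

lemma kraus_tp_index:
  assumes "set Ks \<subseteq> carrier_mat 2 2" "i < 2" "j < 2"
  shows "kraus_tp Ks $$ (i,j) = (\<Sum>a<2. \<Sum>K\<leftarrow>Ks. K $$ (a,j) * cnj (K $$ (a,i)))"
  using assms
proof (induction Ks)
  case Nil thus ?case by (simp add: kraus_tp_def)
next
  case (Cons K Ks)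
  have K: "K \<in> carrier_mat 2 2" using Cons by auto
  have c: "kraus_tp Ks \<in> carrier_mat 2 2" using Cons kraus_tp_carrier by auto
  have "kraus_tp (K # Ks) $$ (i,j) = (cadj K * K + kraus_tp Ks) $$ (i,j)"
    by (simp add: kraus_tp_def)
  also have "\<dots> = (cadj K * K) $$ (i,j) + kraus_tp Ks $$ (i,j)"
    using c Cons.prems by (subst index_add_mat) auto
  also have "(cadj K * K) $$ (i,j) = (\<Sum>a<2. cnj (K $$ (a,i)) * K $$ (a,j))"
    by (rule cadj_mult_self_index[OF K Cons.prems(2,3)])
  finally show ?case using Cons by (simp add: sum_less_2 algebra_simps)
qed

lemma out_entry_stokes:
  assumes R: "R \<in> carrier_mat 3 3" "t \<in> carrier_vec 3" and d: "density \<rho>" and ab: "a < 2" "b < 2"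
  shows "(\<Sum>i<2. \<Sum>j<2. \<rho> $$ (i,j) * out_entry R t i j a b) = stokes_map R t \<rho> $$ (a,b)"
proof -
  have \<rho>: "\<rho> \<in> carrier_mat 2 2" using d by (simp add: density_def)
  have h: "\<rho> $$ (i,j) = cnj (\<rho> $$ (j,i))" if "i < 2" "j < 2" for i j
    using d that \<rho> by (metis cadj_index carrier_matD density_def)
  have "\<rho> $$ (0,0) + \<rho> $$ (1,1) = 1" using d \<rho> by (simp add: density_def mtrace_def sum_less_2)
  moreover define x where "x = Re (\<rho> $$ (0,0))"
  define z where "z = \<rho> $$ (0,1)"
  have 00: "\<rho> $$ (0,0) = of_real x" using h[of 0 0] by (simp add: x_def complex_eq_iff)
  ultimately have 11: "\<rho> $$ (1,1) = of_real (1 - x)" by (simp add: algebra_simps)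
  have 10: "\<rho> $$ (1,0) = cnj z" using h[of 1 0] by (simp add: z_def)
  show ?thesis
    unfolding stokes_map_index[OF R \<rho> ab] sum_less_2 00 11 10 z_def[symmetric]
    using ab unfolding less_2_cases_nat
    by (elim disjE; simp add: out_entry_def pauli_dot_def complex_eq_iff; simp add: field_simps)
qed

text \<open>Converse of \<open>kraus_correlation\<close>: trace preservation is the sum of the
  correlations over equal outputs, and the action on a density matrix is their linear
  combination.\<close>

lemma is_kraus_repI:
  assumes R: "R \<in> carrier_mat 3 3" "t \<in> carrier_vec 3" and Ks: "Ks \<noteq> []" "set Ks \<subseteq> carrier_mat 2 2"
    and c: "\<And>i j a b. i < 2 \<Longrightarrow> j < 2 \<Longrightarrow> a < 2 \<Longrightarrow> b < 2 \<Longrightarrow>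
      (\<Sum>K\<leftarrow>Ks. K $$ (a,i) * cnj (K $$ (b,j))) = out_entry R t i j a b"
  shows "is_kraus_rep R t Ks"
proof -
  have "kraus_tp Ks = 1\<^sub>m 2"
  proof (rule eq_matI)
    fix i j assume "i < dim_row (1\<^sub>m 2 :: complex mat)" "j < dim_col (1\<^sub>m 2 :: complex mat)"
    hence ij: "i < 2" "j < 2" by auto
    have "kraus_tp Ks $$ (i,j) = (\<Sum>a<2. out_entry R t j i a a)"
      unfolding kraus_tp_index[OF Ks(2) ij] by (rule sum.cong) (use c ij in auto)
    thus "kraus_tp Ks $$ (i,j) = 1\<^sub>m 2 $$ (i,j)"
      using ij unfolding less_2_cases_nat
      by (elim disjE; simp add: sum_less_2 out_entry_def pauli_dot_def; simp add: field_simps)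
  qed (use kraus_tp_carrier[OF Ks(2)] in auto)
  moreover have "kraus_apply Ks \<rho> = stokes_map R t \<rho>" if d: "density \<rho>" for \<rho>
  proof (rule eq_matI)
    fix a b assume "a < dim_row (stokes_map R t \<rho>)" "b < dim_col (stokes_map R t \<rho>)"
    hence ab: "a < 2" "b < 2" using stokes_map_carrier[of R t \<rho>] by auto
    have \<rho>: "\<rho> \<in> carrier_mat 2 2" using d by (simp add: density_def)
    have "kraus_apply Ks \<rho> $$ (a,b) = (\<Sum>i<2. \<Sum>j<2. \<rho> $$ (i,j) * out_entry R t i j a b)"
      unfolding kraus_apply_index[OF Ks(2) \<rho> ab] by (intro sum.cong refl) (use c ab in auto)
    thus "kraus_apply Ks \<rho> $$ (a,b) = stokes_map R t \<rho> $$ (a,b)"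
      unfolding out_entry_stokes[OF R d ab] .
  next
    have "\<rho> \<in> carrier_mat 2 2" using d by (simp add: density_def)
    from kraus_apply_carrier[OF Ks(2) this]
    show "dim_row (kraus_apply Ks \<rho>) = dim_row (stokes_map R t \<rho>)"
      "dim_col (kraus_apply Ks \<rho>) = dim_col (stokes_map R t \<rho>)"
      using stokes_map_carrier[of R t \<rho>] by auto
  qed
  ultimately show ?thesis using Ks by (simp add: is_kraus_rep_def)
qed

text \<open>The columns of \<open>bell_entry\<close>, reshaped to \<open>2 \<times> 2\<close>
  matrices and scaled by the roots of the weights, are Kraus operators; the bounds on
  \<open>dz\<close> and \<open>dx\<close> make the weights nonnegative.\<close>

lemma opt_R_channel:
  assumes d: "\<bar>dz\<bar> \<le> 1" "\<bar>dx\<bar> \<le> 1"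
  shows "is_channel (opt_R dz dx p q) (0\<^sub>v 3)"
proof -
  define K where "K l = mat 2 2 (\<lambda>(a,i). complex_of_real (sqrt (bell_weight dz dx l) * bell_entry p q (2 * i + a) l))" for l
  have "is_kraus_rep (opt_R dz dx p q) (0\<^sub>v 3) (map K [0..<4])"
  proof (rule is_kraus_repI)
    fix i j a b :: nat assume ij: "i < 2" "j < 2" "a < 2" "b < 2"
    have "(\<Sum>L\<leftarrow>map K [0..<4]. L $$ (a,i) * cnj (L $$ (b,j))) = (\<Sum>l<4. K l $$ (a,i) * cnj (K l $$ (b,j)))"
      by (simp add: interv_sum_list_conv_sum_set_nat lessThan_atLeast0 o_def)
    also have "\<dots> = of_real (\<Sum>l<4. bell_entry p q (2 * i + a) l * bell_entry p q (2 * j + b) l * bell_weight dz dx l)"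
      unfolding of_real_sum
    proof (rule sum.cong[OF refl])
      fix l :: nat assume "l \<in> {..<4}"
      hence "sqrt (bell_weight dz dx l) * sqrt (bell_weight dz dx l) = bell_weight dz dx l"
        using bell_weight_nonneg[OF d, of l] by simp
      hence "sqrt (bell_weight dz dx l) * x * (sqrt (bell_weight dz dx l) * y) = x * y * bell_weight dz dx l" for x y
        by (metis mult.assoc mult.commute)
      thus "K l $$ (a,i) * cnj (K l $$ (b,j))
        = of_real (bell_entry p q (2 * i + a) l * bell_entry p q (2 * j + b) l * bell_weight dz dx l)"
        using ij by (simp add: K_def flip: of_real_mult)
    qed
    also have "\<dots> = out_entry (opt_R dz dx p q) (0\<^sub>v 3) i j a b" by (rule out_entry_opt_R[OF ij, symmetric])
    finally show "(\<Sum>L\<leftarrow>map K [0..<4]. L $$ (a,i) * cnj (L $$ (b,j))) = out_entry (opt_R dz dx p q) (0\<^sub>v 3) i j a b" .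
  qed (auto simp: K_def)
  thus ?thesis by (auto simp: is_channel_def)
qed

section \<open>Key rate of the minimiser and the resulting minimum\<close>

lemma entropy_bell_weight:
  assumes d: "\<bar>dz\<bar> \<le> 1" "\<bar>dx\<bar> \<le> 1"
  shows "(\<Sum>j<4. eta (bell_weight dz dx j)) = bin_entropy ((1 + dz) / 2) + bin_entropy ((1 + dx) / 2)"
proof -
  have m: "eta (x * y / 4) = x / 2 * eta (y / 2) + y / 2 * eta (x / 2)" if "0 \<le> x" "0 \<le> y" for x y
    using eta_mult[of "x / 2" "y / 2"] that by simp
  have nn: "0 \<le> 1 + dz" "0 \<le> 1 - dz" "0 \<le> 1 + dx" "0 \<le> 1 - dx" using d by (auto simp: abs_le_iff)
  have b: "bell_weight dz dx 0 = (1 + dz) * (1 + dx) / 4" "bell_weight dz dx 1 = (1 - dz) * (1 - dx) / 4"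
    "bell_weight dz dx 2 = (1 + dz) * (1 - dx) / 4" "bell_weight dz dx 3 = (1 - dz) * (1 + dx) / 4"
    by (simp_all add: bell_weight_def)
  have "(1 + dz) / 2 * X + (1 + dx) / 2 * Z + ((1 - dz) / 2 * X' + (1 - dx) / 2 * Z')
    + ((1 + dz) / 2 * X' + (1 - dx) / 2 * Z) + ((1 - dz) / 2 * X + (1 + dx) / 2 * Z') = Z + Z' + (X + X')"
    for X X' Z Z' :: real by (simp add: field_simps)
  thus ?thesis unfolding sum_less_4 b bin_entropy_eta using nn by (simp only: m)
qed

text \<open>Both spectra are explicit: the Choi state has product weights, so its entropy is a sum
  of two binary entropies, and the pinched state consists of two blocks whose Bloch vectors have
  length \<open>l\<close>.\<close>

lemma key_rate_opt_R:
  fixes dz dx p q :: real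
  assumes d: "\<bar>dz\<bar> \<le> 1" "\<bar>dx\<bar> \<le> 1"
  defines "a \<equiv> opt_R dz dx p q $$ (0,0)" and "b \<equiv> opt_R dz dx p q $$ (1,0)"
  shows "key_rate (opt_R dz dx p q) (0\<^sub>v 3) = 1 + bin_entropy ((1 + sqrt (a\<^sup>2 + b\<^sup>2)) / 2)
    - bin_entropy ((1 + a) / 2) - bin_entropy ((1 + dz) / 2) - bin_entropy ((1 + dx) / 2)"
proof -
  let ?R = "opt_R dz dx p q"
  note ch = opt_R_channel[OF d, of p q]
  define l where "l = sqrt (a\<^sup>2 + b\<^sup>2)"
  have le: "a\<^sup>2 + b\<^sup>2 \<le> 1" using opt_R_contraction[OF d, of p q] by (simp add: a_def b_def)
  hence l: "\<bar>l\<bar> \<le> 1" by (simp add: l_def)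
  have "a\<^sup>2 \<le> 1" using le zero_le_power2[of b] by linarith
  hence a: "\<bar>a\<bar> \<le> 1" by (simp add: abs_square_le_1)
  \<comment> \<open>The radius must be the nonnegative \<open>l\<close>; a negative polar radius is
    absorbed by adding \<open>pi\<close> to the angle.\<close>
  obtain \<theta> where th: "a = l * cos \<theta>" "b = l * sin \<theta>"
  proof -
    obtain r \<phi> where r: "a = r * cos \<phi>" "b = r * sin \<phi>" using polar_Ex[of a b] by blast
    have "a\<^sup>2 + b\<^sup>2 = r\<^sup>2 * ((sin \<phi>)\<^sup>2 + (cos \<phi>)\<^sup>2)" unfolding r by (simp only: power_mult_distrib algebra_simps)
    hence s: "l = \<bar>r\<bar>" by (simp add: l_def)
    show ?thesis
    proof (cases "0 \<le> r")
      case True thus ?thesis using that[of \<phi>] r s by simp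
    next
      case False thus ?thesis using that[of "\<phi> + pi"] r s by simp
    qed
  qed
  obtain W where W: "W \<in> carrier_mat 4 4" "cadj W * W = 1\<^sub>m 4"
    "block_diag (choi ?R (0\<^sub>v 3)) = W * real_diag 4 (block_weight l) * cadj W"
    using block_diag_choi_opt_R[OF th(2)[unfolded b_def] th(1)[unfolded a_def]] by blast
  have "vn_entropy (block_diag (choi ?R (0\<^sub>v 3))) = (\<Sum>j<4. eta (block_weight l j))"
    by (rule vn_entropy_unitary_diag[OF W])
  also have "\<dots> = 2 * eta ((1 + l) / 4) + 2 * eta ((1 - l) / 4)"
    by (simp add: sum_less_4 block_weight_def)
  finally have 1: "vn_entropy (block_diag (choi ?R (0\<^sub>v 3))) = 1 + bin_entropy ((1 + l) / 2)"
    unfolding eta_halves[OF l] .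
  have 2: "vn_entropy (choi ?R (0\<^sub>v 3)) = bin_entropy ((1 + dz) / 2) + bin_entropy ((1 + dx) / 2)"
    unfolding vn_entropy_unitary_diag[OF bell_carrier bell_unitary choi_opt_R] by (rule entropy_bell_weight[OF d])
  have "H_XE ?R (0\<^sub>v 3) = vn_entropy (block_diag (choi ?R (0\<^sub>v 3))) - vn_entropy (choi ?R (0\<^sub>v 3))"
    by (rule H_XE_choi[OF ch])
  moreover have "H_XY ?R (0\<^sub>v 3) = bin_entropy ((1 + a) / 2)"
    using H_XY_eq[OF ch] a by (simp add: a_def)
  ultimately show ?thesis unfolding key_rate_def 1 2 l_def by simp
qed

text \<open>The channel \<open>opt_R\<close> is feasible, so its key rate bounds the infimum. A
  nonzero \<open>R $$ (1,0)\<close> makes the length of the first column strictly exceed the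
  absolute value of \<open>R $$ (0,0)\<close>, and monotonicity of the binary entropy
  concludes.\<close>

lemma min_K_le:
  fixes dz dx p q :: real
  assumes d: "\<bar>dz\<bar> \<le> 1" "\<bar>dx\<bar> \<le> 1"
  defines "v \<equiv> 1 - bin_entropy ((1 + dz) / 2) - bin_entropy ((1 + dx) / 2)"
  shows "min_K (params (opt_R dz dx p q) (0\<^sub>v 3)) \<le> v"
    and "opt_R dz dx p q $$ (1,0) \<noteq> 0 \<Longrightarrow> min_K (params (opt_R dz dx p q) (0\<^sub>v 3)) < v"
proof -
  let ?R = "opt_R dz dx p q"
  define a where "a = ?R $$ (0,0)"
  define b where "b = ?R $$ (1,0)"
  have ab: "a\<^sup>2 + b\<^sup>2 \<le> 1" using opt_R_contraction[OF d, of p q] by (simp add: a_def b_def)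
  have "(?R, 0\<^sub>v 3) \<in> P_ba (params ?R (0\<^sub>v 3))" using opt_R_channel[OF d] by (simp add: P_ba_def)
  hence "min_K (params ?R (0\<^sub>v 3)) \<le> key_rate ?R (0\<^sub>v 3)"
    unfolding min_K_def by (intro cInf_lower key_rate_bdd_below) force
  also have "\<dots> = v + bin_entropy ((1 + sqrt (a\<^sup>2 + b\<^sup>2)) / 2) - bin_entropy ((1 + a) / 2)"
    unfolding key_rate_opt_R[OF d] v_def a_def b_def by simp
  finally have m: "min_K (params ?R (0\<^sub>v 3))
    \<le> v + bin_entropy ((1 + sqrt (a\<^sup>2 + b\<^sup>2)) / 2) - bin_entropy ((1 + a) / 2)" .
  have s: "\<bar>a\<bar> \<le> sqrt (a\<^sup>2 + b\<^sup>2)" "sqrt (a\<^sup>2 + b\<^sup>2) \<le> 1"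
    using ab by (auto intro: real_le_rsqrt)
  show "min_K (params ?R (0\<^sub>v 3)) \<le> v" using m bin_entropy_decreasing[OF s] by simp
  assume "?R $$ (1,0) \<noteq> 0"
  hence "\<bar>a\<bar> < sqrt (a\<^sup>2 + b\<^sup>2)" by (intro real_less_rsqrt) (simp add: b_def)
  from bin_entropy_strict_decreasing[OF this s(2)]
  show "min_K (params ?R (0\<^sub>v 3)) < v" using m by simp
qed

text \<open>When \<open>R $$ (1,0) = 0\<close>, the length of the column is
  \<open>\<bar>a\<bar>\<close>; evenness of the entropy then cancels the two middle terms of the key
  rate, and the value meets \<open>key_rate_lower_bound\<close>.\<close>

lemma min_K_attained:
  fixes dz dx p q :: real
  assumes d: "\<bar>dz\<bar> \<le> 1" "\<bar>dx\<bar> \<le> 1" and o: "opt_R dz dx p q $$ (1,0) = 0"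
  defines "v \<equiv> 1 - bin_entropy ((1 + dz) / 2) - bin_entropy ((1 + dx) / 2)"
    and "A \<equiv> (\<lambda>(R,t). key_rate R t) ` P_ba (params (opt_R dz dx p q) (0\<^sub>v 3))"
  shows "is_minimum A v" "min_K (params (opt_R dz dx p q) (0\<^sub>v 3)) = v"
proof -
  let ?R = "opt_R dz dx p q"
  have "bin_entropy ((1 + \<bar>x\<bar>) / 2) = bin_entropy ((1 + x) / 2)" for x
    using bin_entropy_even[of x] by (cases "0 \<le> x") auto
  hence "key_rate ?R (0\<^sub>v 3) = v" unfolding key_rate_opt_R[OF d] o v_def by simp
  moreover have "(?R, 0\<^sub>v 3) \<in> P_ba (params ?R (0\<^sub>v 3))" using opt_R_channel[OF d] by (simp add: P_ba_def)
  ultimately have vA: "v \<in> A" unfolding A_def by force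
  have lb: "v \<le> x" if "x \<in> A" for x
    using that key_rate_lower_bound[OF _ _ o] by (auto simp: A_def P_ba_def v_def)
  show "is_minimum A v" using vA lb by (simp add: is_minimum_def)
  show "min_K (params ?R (0\<^sub>v 3)) = v"
    unfolding min_K_def A_def[symmetric] by (rule cInf_eq_minimum[OF vA lb])
qed

section \<open>Planar rotations and the group \<open>SO2\<close>\<close>

definition rot :: "real \<Rightarrow> real mat" where
  "rot \<theta> = mat 2 2 (\<lambda>(i,j). if i = j then cos \<theta> else if i = 0 then - sin \<theta> else sin \<theta>)"

lemma rot_index:
  "rot \<theta> $$ (0,0) = cos \<theta>" "rot \<theta> $$ (0,1) = - sin \<theta>" "rot \<theta> $$ (1,0) = sin \<theta>" "rot \<theta> $$ (1,1) = cos \<theta>"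
  by (simp_all add: rot_def)

lemma rot_carrier [simp]: "rot \<theta> \<in> carrier_mat 2 2" by (simp add: rot_def)

lemma mult_mat_index_2:
  fixes A B :: "real mat"
  assumes "A \<in> carrier_mat 2 2" "B \<in> carrier_mat 2 2" "i < 2" "j < 2"
  shows "(A * B) $$ (i,j) = A $$ (i,0) * B $$ (0,j) + A $$ (i,1) * B $$ (1,j)"
  using assms by (subst mult_mat_index_sum[of _ 2 2 _ 2]) (auto simp: sum_less_2)

lemma eq_mat_2I:
  assumes "A \<in> carrier_mat 2 2" "B \<in> carrier_mat 2 2"
    "A $$ (0,0) = B $$ (0,0)" "A $$ (0,1) = B $$ (0,1)" "A $$ (1,0) = B $$ (1,0)" "A $$ (1,1) = B $$ (1,1)"
  shows "A = B"
  by (rule eq_matI) (use assms in \<open>auto simp: less_2_cases_nat\<close>)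

lemma rot_mult: "rot a * rot b = rot (a + b)"
proof (rule eq_mat_2I)
  have "(rot a * rot b) $$ (i,j) = rot a $$ (i,0) * rot b $$ (0,j) + rot a $$ (i,1) * rot b $$ (1,j)"
    if "i < 2" "j < 2" for i j by (rule mult_mat_index_2) (use that in auto)
  note e = this[of 0 0] this[of 0 1] this[of 1 0] this[of 1 1]
  show "(rot a * rot b) $$ (0,0) = rot (a + b) $$ (0,0)" "(rot a * rot b) $$ (0,1) = rot (a + b) $$ (0,1)"
    "(rot a * rot b) $$ (1,0) = rot (a + b) $$ (1,0)" "(rot a * rot b) $$ (1,1) = rot (a + b) $$ (1,1)"
    using e by (simp_all add: rot_index[unfolded One_nat_def] cos_add sin_add)
qed (auto intro: mult_carrier_mat[of _ 2 2 _ 2])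

lemma rot_0: "rot 0 = 1\<^sub>m 2"
  by (rule eq_mat_2I) (auto simp: rot_def)

lemma det_mat_2:
  fixes A :: "real mat"
  assumes A: "A \<in> carrier_mat 2 2"
  shows "det A = A $$ (0,0) * A $$ (1,1) - A $$ (1,0) * A $$ (0,1)"
proof -
  have c: "mat_delete A i 0 \<in> carrier_mat 1 1" for i
    using mat_delete_carrier[OF A, of i 0] by simp
  have "det A = (\<Sum>i<2. A $$ (i,0) * cofactor A i 0)"
    by (rule laplace_expansion_column[OF A]) simp
  thus ?thesis
    unfolding cofactor_def sum_less_2 det_single[OF c]
    using A by (simp add: mat_delete_def)
qed

lemma SO2_iff_rot: "Q \<in> SO2 \<longleftrightarrow> (\<exists>\<theta>. Q = rot \<theta>)"
proof
  assume "Q \<in> SO2"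
  hence Q: "Q \<in> carrier_mat 2 2" and QT: "Q * transpose_mat Q = 1\<^sub>m 2" and "det Q = 1" by (auto simp: SO2_def)
  define a where "a = Q $$ (0,0)" define b where "b = Q $$ (0,1)"
  define c where "c = Q $$ (1,0)" define d where "d = Q $$ (1,1)"
  have t: "transpose_mat Q \<in> carrier_mat 2 2" using Q by simp
  have o: "(1\<^sub>m 2 :: real mat) $$ (i,j) = Q $$ (i,0) * Q $$ (j,0) + Q $$ (i,1) * Q $$ (j,1)" if "i < 2" "j < 2" for i j
    unfolding QT[symmetric] mult_mat_index_2[OF Q t that] using Q that by simp
  have 1: "a * a + b * b = 1" using o[of 0 0] by (simp add: a_def b_def)
  have 2: "a * c + b * d = 0" using o[of 0 1] by (simp add: a_def b_def c_def d_def)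
  have 3: "a * d - c * b = 1" using \<open>det Q = 1\<close> det_mat_2[OF Q] by (simp add: a_def b_def c_def d_def)
  \<comment> \<open>Combinations of the orthogonality and determinant relations express the second
    row through the unit first row.\<close>
  have "d * (a * a + b * b) = a * (a * d - c * b) + b * (a * c + b * d)" by (simp add: algebra_simps)
  hence d: "d = a" using 1 2 3 by simp
  have "c * (a * a + b * b) = a * (a * c + b * d) - b * (a * d - c * b)" by (simp add: algebra_simps)
  hence c: "c = - b" using 1 2 3 by simp
  have "a\<^sup>2 + c\<^sup>2 = 1" using 1 c by (simp add: power2_eq_square)
  then obtain \<theta> where "a = cos \<theta>" "c = sin \<theta>" using sincos_total_2pi by metis
  hence "Q = rot \<theta>" using Q c d
    by (intro eq_mat_2I) (auto simp: rot_index[unfolded One_nat_def] a_def b_def c_def d_def)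
  thus "\<exists>\<theta>. Q = rot \<theta>" ..
next
  assume "\<exists>\<theta>. Q = rot \<theta>"
  then obtain \<theta> where Q: "Q = rot \<theta>" ..
  have "transpose_mat (rot \<theta>) = rot (- \<theta>)" by (rule eq_mat_2I) (auto simp: rot_def)
  moreover have "det (rot \<theta>) = 1"
    unfolding det_mat_2[OF rot_carrier] rot_index
    using sin_cos_squared_add[of \<theta>] by (simp add: power2_eq_square)
  ultimately show "Q \<in> SO2" unfolding SO2_def Q by (simp add: rot_mult rot_0)
qed

lemma rot_inverse:
  assumes "Q \<in> carrier_mat 2 2" "Q * rot \<theta> = 1\<^sub>m 2"
  shows "Q = rot (- \<theta>)"
proof -
  have "Q = Q * (rot \<theta> * rot (- \<theta>))" using assms(1) by (simp add: rot_mult rot_0)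
  also have "\<dots> = (Q * rot \<theta>) * rot (- \<theta>)"
    by (rule assoc_mult_mat[symmetric, of _ 2 2 _ 2 _ 2]) (use assms in auto)
  finally show ?thesis unfolding assms(2) left_mult_one_mat[OF rot_carrier] .
qed

text \<open>The diagonal matrix is \<open>s\<close> times the identity plus \<open>d\<close> times
  \<open>diag(1, -1)\<close>. Between the two rotations the first part becomes the rotation by
  \<alpha> + \<beta>, the second a reflection with angle \<beta> - \<alpha>.\<close>

lemma params_svd:
  assumes R: "mat 2 2 (\<lambda>(i,j). R $$ (i,j)) = rot \<beta> * mat_diag 2 (\<lambda>i. if i = 0 then dz else dx) * rot \<alpha>"
  shows "params R (0\<^sub>v 3) = params (opt_R dz dx (\<alpha> + \<beta>) (\<beta> - \<alpha>)) (0\<^sub>v 3)"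
proof -
  let ?D = "mat_diag 2 (\<lambda>i. if i = 0 then dz else dx)"
  have c: "rot \<beta> * ?D \<in> carrier_mat 2 2" by (rule mult_carrier_mat[of _ 2 2]) auto
  have e: "R $$ (i,j) = rot \<beta> $$ (i,0) * dz * rot \<alpha> $$ (0,j) + rot \<beta> $$ (i,1) * dx * rot \<alpha> $$ (1,j)"
    if "i < 2" "j < 2" for i j
  proof -
    have "R $$ (i,j) = (rot \<beta> * ?D * rot \<alpha>) $$ (i,j)" unfolding R[symmetric] using that by simp
    also have "\<dots> = rot \<beta> $$ (i,0) * dz * rot \<alpha> $$ (0,j) + rot \<beta> $$ (i,1) * dx * rot \<alpha> $$ (1,j)"
      unfolding mult_mat_index_2[OF c rot_carrier that] unfolding mat_diag_mult_right[OF rot_carrier]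
      using that by simp
    finally show ?thesis .
  qed
  show ?thesis
    using e[of 0 0] e[of 0 1] e[of 1 0] e[of 1 1]
    unfolding params_def opt_R_index rot_index
    by (simp add: cos_add sin_add cos_diff sin_diff field_simps)
qed

lemma sum_less_3: "(\<Sum>i<3. f i) = f 0 + f 1 + f (2 :: nat)"
  by (simp add: numeral_3_eq_3 numeral_2_eq_2)

text \<open>Compensation only shifts the two angles and leaves \<open>dz\<close> and
  \<open>dx\<close> fixed, so one upper bound serves for all compensations.\<close>

lemma params_compensate:
  assumes R: "R \<in> carrier_mat 3 3" and S: "params R (0\<^sub>v 3) = params (opt_R dz dx p q) (0\<^sub>v 3)"
  shows "case_prod params (compensate R (0\<^sub>v 3) (rot a) (rot b))
    = params (opt_R dz dx (p + a + b) (q + b - a)) (0\<^sub>v 3)"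
proof -
  define A where "A = fst (rot_channel (rot a))"
  define B where "B = fst (rot_channel (rot b))"
  have A: "A \<in> carrier_mat 3 3" "B \<in> carrier_mat 3 3" by (auto simp: A_def B_def rot_channel_def)
  have Ai: "fst (rot_channel (rot x)) $$ (i,j) = (if i < 2 \<and> j < 2 then rot x $$ (i,j) else if i = j then 1 else 0)"
    if "i < 3" "j < 3" for i j x using that by (simp add: rot_channel_def)
  have t: "snd (compensate R (0\<^sub>v 3) (rot a) (rot b)) = 0\<^sub>v 3"
  proof -
    have z: "M *\<^sub>v 0\<^sub>v 3 = 0\<^sub>v 3" if "M \<in> carrier_mat 3 3" for M :: "real mat"
      by (rule eq_vecI) (use that in auto)
    have "snd (rot_channel Q) = 0\<^sub>v 3" for Q by (simp add: rot_channel_def)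
    thus ?thesis by (simp add: compensate_def stokes_comp_def B_def[symmetric] z[OF R] z[OF A(2)])
  qed
  have f: "fst (compensate R (0\<^sub>v 3) (rot a) (rot b)) = B * (R * A)"
    by (simp add: compensate_def stokes_comp_def A_def B_def)
  have e: "(B * (R * A)) $$ (i,j) = (rot b $$ (i,0) * (R $$ (0,0) * rot a $$ (0,j) + R $$ (0,1) * rot a $$ (1,j)))
     + rot b $$ (i,1) * (R $$ (1,0) * rot a $$ (0,j) + R $$ (1,1) * rot a $$ (1,j))" if "i < 2" "j < 2" for i j
  proof -
    have RA: "R * A \<in> carrier_mat 3 3" using R A by auto
    have "(B * (R * A)) $$ (i,j) = (\<Sum>k<3. B $$ (i,k) * (\<Sum>l<3. R $$ (k,l) * A $$ (l,j)))"
      by (subst mult_mat_index_sum[OF A(2) RA], use that in \<open>simp, simp\<close>, intro sum.cong refl)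
         (subst mult_mat_index_sum[OF R A(1)], use that in auto)
    thus ?thesis using that unfolding sum_less_3 A_def B_def by (simp add: Ai)
  qed
  have lt: "(0 :: nat) < 2" "(1 :: nat) < 2" by auto
  let ?R' = "opt_R dz dx (p + a + b) (q + b - a)"
  have "(B * (R * A)) $$ (0,0) = ?R' $$ (0,0)" "(B * (R * A)) $$ (0,1) = ?R' $$ (0,1)"
    "(B * (R * A)) $$ (1,0) = ?R' $$ (1,0)" "(B * (R * A)) $$ (1,1) = ?R' $$ (1,1)"
    unfolding e[OF lt(1) lt(1)] e[OF lt(1) lt(2)] e[OF lt(2) lt(1)] e[OF lt(2) lt(2)]
      params_opt_R_D(1-4)[OF S] opt_R_index rot_index
    by (simp_all add: cos_add sin_add cos_diff sin_diff algebra_simps add_divide_distrib diff_divide_distrib)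
  thus ?thesis unfolding split_def t f params_def by (simp only:)
qed

text \<open>Parallelism in the plane is the vanishing of a \<open>2 \<times> 2\<close> determinant,
  here up to sign. Since \<open>(cos \<beta>, - sin \<beta>)\<close> is a unit vector, the scalar
  \<open>c\<close> is the inner product.\<close>

lemma parallel_iff:
  "(\<exists>c :: real. (dz * cos \<alpha> = c * cos \<beta> \<and> dx * sin \<alpha> = c * - sin \<beta>)
      \<or> (cos \<beta> = c * (dz * cos \<alpha>) \<and> - sin \<beta> = c * (dx * sin \<alpha>)))
    \<longleftrightarrow> dz * cos \<alpha> * sin \<beta> + dx * sin \<alpha> * cos \<beta> = 0" (is "?L \<longleftrightarrow> ?R")
proof
  assume ?L
  then obtain c where "(dz * cos \<alpha> = c * cos \<beta> \<and> dx * sin \<alpha> = c * - sin \<beta>)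
      \<or> (cos \<beta> = c * (dz * cos \<alpha>) \<and> sin \<beta> = - (c * (dx * sin \<alpha>)))" by force
  thus ?R by (elim disjE conjE) (simp_all add: algebra_simps)
next
  assume r: ?R
  have 1: "cos \<beta> * cos \<beta> + sin \<beta> * sin \<beta> = 1"
    using sin_cos_squared_add2[of \<beta>] by (simp add: power2_eq_square)
  define c where "c = dz * cos \<alpha> * cos \<beta> - dx * sin \<alpha> * sin \<beta>"
  have "c * cos \<beta> = dz * cos \<alpha> * (cos \<beta> * cos \<beta> + sin \<beta> * sin \<beta>)
      - sin \<beta> * (dz * cos \<alpha> * sin \<beta> + dx * sin \<alpha> * cos \<beta>)"
    by (simp only: c_def algebra_simps)
  hence "dz * cos \<alpha> = c * cos \<beta>" unfolding 1 r by simp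
  moreover have "c * - sin \<beta> = dx * sin \<alpha> * (cos \<beta> * cos \<beta> + sin \<beta> * sin \<beta>)
      - cos \<beta> * (dz * cos \<alpha> * sin \<beta> + dx * sin \<alpha> * cos \<beta>)"
    by (simp only: c_def algebra_simps)
  hence "dx * sin \<alpha> = c * - sin \<beta>" unfolding 1 r by simp
  ultimately show ?L by blast
qed

theorem theorem3:
  fixes R :: "real mat" and t :: "real vec" and U V QAs QBs :: "real mat" and dz dx :: real
  assumes chan: "is_channel R t"
    and unital: "t = 0\<^sub>v 3"
    and U: "U \<in> SO2" and V: "V \<in> SO2"
    and svd: "mat 2 2 (\<lambda>(i,j). R $$ (i,j)) = V * mat_diag 2 (\<lambda>i. if i = 0 then dz else dx) * U"
    and QAs: "QAs \<in> carrier_mat 2 2" "QAs * U = 1\<^sub>m 2" "U * QAs = 1\<^sub>m 2"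
    and QBs: "QBs \<in> carrier_mat 2 2" "QBs * V = 1\<^sub>m 2" "V * QBs = 1\<^sub>m 2"
  shows "let Es = compensate R t QAs QBs; \<omega>s = params (fst Es) (snd Es);
             val = 1 - bin_entropy ((1 + dz) / 2) - bin_entropy ((1 + dx) / 2);
             Ut_z = col (mat_diag 2 (\<lambda>i. if i = 0 then dz else dx) * U) 0;
             V_z = row V 0
         in is_maximum {min_K (case_prod params (compensate R t QA QB)) | QA QB. QA \<in> SO2 \<and> QB \<in> SO2} val
          \<and> G2 R t = val
          \<and> is_minimum ((\<lambda>(R',t'). key_rate R' t') ` P_ba \<omega>s) val
          \<and> min_K \<omega>s = val
          \<and> (min_K (params R t) = min_K \<omega>s \<longleftrightarrow> (\<exists>c::real. Ut_z = c \<cdot>\<^sub>v V_z \<or> V_z = c \<cdot>\<^sub>v Ut_z))"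
proof -
  obtain \<alpha> \<beta> where ab: "U = rot \<alpha>" "V = rot \<beta>" using U V SO2_iff_rot by blast
  have Q: "QAs = rot (- \<alpha>)" "QBs = rot (- \<beta>)"
    using rot_inverse[OF QAs(1) QAs(2)[unfolded ab]] rot_inverse[OF QBs(1) QBs(2)[unfolded ab]] by auto
  let ?D = "mat_diag 2 (\<lambda>i. if i = 0 then dz else dx)"
  define v where "v = 1 - bin_entropy ((1 + dz) / 2) - bin_entropy ((1 + dx) / 2)"
  define \<omega> where "\<omega> = case_prod params (compensate R t QAs QBs)"
  define A where "A = {min_K (case_prod params (compensate R t QA QB)) | QA QB. QA \<in> SO2 \<and> QB \<in> SO2}"
  have R: "R \<in> carrier_mat 3 3" using chan by (simp add: is_channel_def)
  have S: "params R (0\<^sub>v 3) = params (opt_R dz dx (\<alpha> + \<beta>) (\<beta> - \<alpha>)) (0\<^sub>v 3)"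
    by (rule params_svd) (use svd ab in simp)
  note d = channel_singular_values_le_1[OF chan[unfolded unital] S]
  \<comment> \<open>The inverse rotations bring both angles to 0, leaving the diagonal block
    \<open>diag(dz, dx)\<close>.\<close>
  have \<omega>: "\<omega> = params (opt_R dz dx 0 0) (0\<^sub>v 3)"
    unfolding \<omega>_def unital Q params_compensate[OF R S] by simp
  have "opt_R dz dx 0 0 $$ (1,0) = 0" unfolding opt_R_index by simp
  note m = min_K_attained[OF d this, folded \<omega> v_def]
  have "v \<in> A"
    unfolding A_def using m(2) Q SO2_iff_rot by (auto simp: \<omega>_def)
  moreover have "x \<le> v" if "x \<in> A" for x
  proof -
    obtain a b where "x = min_K (case_prod params (compensate R t (rot a) (rot b)))"
    proof -
      obtain QA QB where "x = min_K (case_prod params (compensate R t QA QB))" "QA \<in> SO2" "QB \<in> SO2"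
        using \<open>x \<in> A\<close> unfolding A_def by blast
      thus ?thesis using that SO2_iff_rot by metis
    qed
    thus ?thesis unfolding unital params_compensate[OF R S] using min_K_le(1)[OF d] by (simp add: v_def)
  qed
  ultimately have max: "is_maximum A v" and sup: "G2 R t = v"
    unfolding is_maximum_def G2_def A_def[symmetric] by (auto intro: cSup_eq_maximum)
  \<comment> \<open>The entry \<open>R $$ (1,0)\<close> of the uncompensated channel is exactly the
    expression in \<open>parallel_iff\<close>, so the strict and the attained case of the bound
    decide the equivalence.\<close>
  have o: "opt_R dz dx (\<alpha> + \<beta>) (\<beta> - \<alpha>) $$ (1,0) = dz * cos \<alpha> * sin \<beta> + dx * sin \<alpha> * cos \<beta>"
    unfolding opt_R_index by (simp add: sin_add sin_diff field_simps)
  have "min_K (params R t) = v \<longleftrightarrow> opt_R dz dx (\<alpha> + \<beta>) (\<beta> - \<alpha>) $$ (1,0) = 0"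
    unfolding unital S v_def
    using min_K_le(2)[OF d, of "\<alpha> + \<beta>" "\<beta> - \<alpha>"] min_K_attained(2)[OF d] by (metis less_irrefl)
  moreover have "(\<exists>c. col (?D * U) 0 = c \<cdot>\<^sub>v row V 0 \<or> row V 0 = c \<cdot>\<^sub>v col (?D * U) 0)
      \<longleftrightarrow> dz * cos \<alpha> * sin \<beta> + dx * sin \<alpha> * cos \<beta> = 0"
  proof -
    have vec2: "x = y \<longleftrightarrow> x $ 0 = y $ 0 \<and> x $ 1 = y $ 1"
      if "x \<in> carrier_vec 2" "y \<in> carrier_vec 2" for x y :: "real vec"
      using that by (auto intro!: eq_vecI simp: less_2_cases_nat)
    have u: "col (?D * U) 0 = vec 2 (\<lambda>i. if i = 0 then dz * cos \<alpha> else dx * sin \<alpha>)"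
      unfolding ab mat_diag_mult_left[OF rot_carrier] by (rule eq_vecI) (auto simp: rot_def)
    have w: "row V 0 = vec 2 (\<lambda>i. if i = 0 then cos \<beta> else - sin \<beta>)"
      unfolding ab by (rule eq_vecI) (auto simp: rot_def)
    show ?thesis unfolding u w parallel_iff[symmetric] by (subst (1 2) vec2) auto
  qed
  ultimately show ?thesis
    using max sup m o unfolding Let_def \<omega>_def split_def A_def v_def by simp
qed

end
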